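(* Let $\tau\in L^{1}_{loc}(\mathbb{R})$ vanish on $(-\infty,0)$, have convergent (improper) Laplace transform $\mathcal{L}\{\tau;s\}=\int_0^\infty\tau(x)e^{-sx}\,\mathrm{d}x$ for $\Re e\, s>0$, and be boundedly decreasing. Then $\tau$ is boundedly oscillating if and only if there is a function $G(s)$ analytic on the intersection of $\Re e\, s>0$ with a complex neighborhood of $s=0$ such that both $\mathcal{L}\{\tau;s\}-G(s)/s$ and $G(s)$ admit pseudomeasure boundary behavior at $s=0$. Furthermore, in that case, for sufficiently small $\lambda>0$ there is $g\in L^\infty(\mathbb{R})$ whose Fourier transform satisfies $\hat g(t)=\lim_{\sigma\to0^+}G(\sigma+it)$ in $\mathcal{D}'(-\lambda,\lambda)$, and $\tau(x)=\int_0^x g(y)\,\mathrm{d}y+O(1)$ as $x\to\infty$.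
   Context: A real-valued function $\tau$ is boundedly decreasing if there is $\delta>0$ with $\liminf_{x\to\infty}\inf_{h\in[0,\delta]}(\tau(x+h)-\tau(x))>-\infty$ (for complex-valued functions: real and imaginary parts are). A function $\tau$ is boundedly oscillating if there is $\delta>0$ with $\limsup_{x\to\infty}\sup_{h\in[0,\delta]}|\tau(x+h)-\tau(x)|<\infty$. The Fourier transform is $\hat\varphi(t)=\int e^{-itx}\varphi(x)\,\mathrm{d}x$, extended to tempered distributions by duality. A tempered distribution $f$ is a pseudomeasure if $\hat f\in L^\infty(\mathbb{R})$. An analytic function $F$ defined on $\{\Re e\, s>0\}$ near $0$ has pseudomeasure boundary behavior at $s=0$ if there is an open interval $U\ni0$ such that $F(\sigma+it)$ converges in $\mathcal{D}'(U)$ as $\sigma\to0^+$ to a distribution that coincides, near each point of $U$, with a pseudomeasure. *)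

theory Defs
  imports "HOL-Analysis.Analysis"
begin

definition bdd_decreasing_real :: "(real \<Rightarrow> real) \<Rightarrow> bool" where
  "bdd_decreasing_real f \<longleftrightarrow> (\<exists>\<delta>>0.
     Liminf at_top (\<lambda>x. INF h\<in>{0..\<delta>}. ereal (f (x + h) - f x)) > -\<infinity>)"

definition bdd_decreasing :: "(real \<Rightarrow> complex) \<Rightarrow> bool" where
  "bdd_decreasing f \<longleftrightarrow> bdd_decreasing_real (\<lambda>x. Re (f x)) \<and> bdd_decreasing_real (\<lambda>x. Im (f x))"

definition bdd_oscillating :: "(real \<Rightarrow> complex) \<Rightarrow> bool" where
  "bdd_oscillating f \<longleftrightarrow> (\<exists>\<delta>>0.
     Limsup at_top (\<lambda>x. SUP h\<in>{0..\<delta>}. ereal (norm (f (x + h) - f x))) < \<infinity>)"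

definition laplace_partial :: "(real \<Rightarrow> complex) \<Rightarrow> complex \<Rightarrow> real \<Rightarrow> complex" where
  "laplace_partial \<tau> s T = (LINT x:{0..T}|lborel. \<tau> x * exp (- s * of_real x))"

definition laplace_converges :: "(real \<Rightarrow> complex) \<Rightarrow> complex \<Rightarrow> bool" where
  "laplace_converges \<tau> s \<longleftrightarrow> (\<exists>L. (laplace_partial \<tau> s \<longlongrightarrow> L) at_top)"

definition laplace :: "(real \<Rightarrow> complex) \<Rightarrow> complex \<Rightarrow> complex" where
  "laplace \<tau> s = Lim at_top (laplace_partial \<tau> s)"

fun vderiv_iter :: "nat \<Rightarrow> (real \<Rightarrow> complex) \<Rightarrow> real \<Rightarrow> complex" where
  "vderiv_iter 0 f = f"
| "vderiv_iter (Suc n) f = (\<lambda>x. vector_derivative (vderiv_iter n f) (at x))"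

definition smooth_fun :: "(real \<Rightarrow> complex) \<Rightarrow> bool" where
  "smooth_fun f \<longleftrightarrow> (\<forall>n x. vderiv_iter n f differentiable (at x))"

definition tsupport :: "(real \<Rightarrow> complex) \<Rightarrow> real set" where
  "tsupport f = closure {x. f x \<noteq> 0}"

definition test_fun :: "real set \<Rightarrow> (real \<Rightarrow> complex) \<Rightarrow> bool" where
  "test_fun U \<phi> \<longleftrightarrow> smooth_fun \<phi> \<and> compact (tsupport \<phi>) \<and> tsupport \<phi> \<subseteq> U"

definition fourier :: "(real \<Rightarrow> complex) \<Rightarrow> real \<Rightarrow> complex" where
  "fourier \<phi> t = (LINT x|lborel. exp (- \<i> * of_real (t * x)) * \<phi> x)"

definition inv_fourier :: "(real \<Rightarrow> complex) \<Rightarrow> real \<Rightarrow> complex" where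
  "inv_fourier \<phi> u = (LINT x|lborel. exp (\<i> * of_real (u * x)) * \<phi> x) / of_real (2 * pi)"

definition Linf :: "(real \<Rightarrow> complex) \<Rightarrow> bool" where
  "Linf h \<longleftrightarrow> h \<in> borel_measurable lborel \<and> (\<exists>C. AE x in lborel. norm (h x) \<le> C)"

definition dist_boundary_limit ::
  "(complex \<Rightarrow> complex) \<Rightarrow> real set \<Rightarrow> ((real \<Rightarrow> complex) \<Rightarrow> complex) \<Rightarrow> bool" where
  "dist_boundary_limit F U T \<longleftrightarrow> (\<forall>\<phi>. test_fun U \<phi> \<longrightarrow>
     ((\<lambda>\<sigma>. LINT t|lborel. F (of_real \<sigma> + \<i> * of_real t) * \<phi> t) \<longlongrightarrow> T \<phi>) (at_right 0))"

text \<open>A pseudomeasure f (tempered distribution with \<open>\<hat>f = h \<in> L\<^sup>\<infinity>\<close>) acts on test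
  functions by \<open>\<langle>f,\<phi>\<rangle> = \<langle>\<hat>f, \<F>\<^sup>-\<^sup>1\<phi>\<rangle> = \<integral> h(u) (\<F>\<^sup>-\<^sup>1\<phi>)(u) du\<close>.\<close>
definition pseudomeasure_action :: "(real \<Rightarrow> complex) \<Rightarrow> (real \<Rightarrow> complex) \<Rightarrow> complex" where
  "pseudomeasure_action h \<phi> = (LINT u|lborel. h u * inv_fourier \<phi> u)"

definition pseudomeasure_boundary :: "(complex \<Rightarrow> complex) \<Rightarrow> bool" where
  "pseudomeasure_boundary F \<longleftrightarrow> (\<exists>a b T. a < 0 \<and> 0 < b \<and>
     dist_boundary_limit F {a<..<b} T \<and>
     (\<forall>t0\<in>{a<..<b}. \<exists>W. open W \<and> t0 \<in> W \<and> W \<subseteq> {a<..<b} \<and>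
        (\<exists>h. Linf h \<and> (\<forall>\<phi>. test_fun W \<phi> \<longrightarrow> T \<phi> = pseudomeasure_action h \<phi>))))"

definition admissible_G :: "(real \<Rightarrow> complex) \<Rightarrow> (complex \<Rightarrow> complex) \<Rightarrow> bool" where
  "admissible_G \<tau> G \<longleftrightarrow> (\<exists>V. open V \<and> 0 \<in> V \<and> G holomorphic_on ({s. Re s > 0} \<inter> V)) \<and>
     pseudomeasure_boundary (\<lambda>s. laplace \<tau> s - G s / s) \<and> pseudomeasure_boundary G"

end

theory Submission
  imports Defs "HOL-Probability.Probability"
begin

text \<open>Given an admissible \<open>G\<close>, let \<open>g\<close> be the bounded function whose Fourier transform is the
  boundary value of \<open>G\<close> near 0, and let \<open>f(x) = \<tau>(x) - \<integral>\<^sub>0\<^sup>x g\<close>. Then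
  \<open>s \<L>{f;s} = s (\<L>{\<tau>;s} - G(s)/s) + G(s) - \<L>{g;s}\<close> has a distributional boundary value near 0.
  Testing it against \<open>\<phi>(t) (e\<^sup>i\<^sup>h\<^sup>t - 1)/t\<close> bounds, uniformly in \<open>h \<ge> 0\<close>, the increments from
  \<open>0\<close> to \<open>h\<close> of the averages of \<open>f e\<^sup>-\<^sup>\<sigma>\<^sup>x\<close> against translates of the Fourier transform \<open>K\<close> of
  \<open>\<phi>\<close> in the limit \<open>\<sigma> \<rightarrow> 0\<close>; the uniform boundedness principle handles the dependence of
  \<open>(e\<^sup>h\<^sup>s - 1)/s\<close> on \<open>\<sigma>\<close>. Choosing \<open>K \<ge> 0\<close>, bounded decrease turns this first into linear growth
  of \<open>f\<close>, then into boundedness of the averages, and finally into boundedness of \<open>f\<close>. Conversely,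
  if \<open>\<tau>\<close> is boundedly oscillating, \<open>G\<close> is the Laplace transform of a difference quotient of \<open>\<tau>\<close>.\<close>

section \<open>Smooth functions and test functions\<close>

text \<open>Distributional convergence is tested against one fixed function at a time, whereas
  dividing by \<open>s\<close> rather than by \<open>t\<close> produces a multiplier that moves with
  \<sigma>; this is the obstacle that dominated convergence does not remove. The bounds are uniform
  in \<open>h\<close> for two reasons. Multiplication by \<open>it\<close> undoes the division and
  leaves \<open>K(x - h) - K(x)\<close>, whose mass is at most twice that of \<open>K\<close>. The
  boundary value of \<open>G\<close> is the transform of \<open>g\<close> on the whole line, while a
  Laplace transform sees only the half-line; the leftover on \<open>x < 0\<close> is paired with the
  integral of \<open>K\<close> over \<open>[x - h, x]\<close>, which decays like
  \<open>1/(1 + x^2)\<close> uniformly in \<open>h\<close>. This asks for fourth-order decay of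
  \<open>K\<close>, obtained by squaring a transform with second-order decay. The undamped averages
  are known to converge only once growth is controlled, so the linear bound is read off from a
  single damped average with \<open>\<sigma> h < ln 2\<close>. Real and imaginary parts can be
  separated because \<open>K\<close> is real.\<close>

lemma vderiv_iter_Suc_right:
  "vderiv_iter (Suc n) f = vderiv_iter n (\<lambda>x. vector_derivative f (at x))"
  by (induction n) auto

lemma smooth_fun_has_vector_derivative:
  assumes "smooth_fun f"
  shows "(f has_vector_derivative vector_derivative f (at x)) (at x)"
  using assms[unfolded smooth_fun_def, rule_format, of 0] by (simp add: vector_derivative_works)

lemma smooth_fun_vector_derivative:
  assumes "smooth_fun f"
  shows "smooth_fun (\<lambda>x. vector_derivative f (at x))"
  unfolding smooth_fun_def
  using assms[unfolded smooth_fun_def, rule_format, of "Suc n" for n]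
  by (simp add: vderiv_iter_Suc_right del: vderiv_iter.simps)

lemma smooth_funE:
  assumes "smooth_fun f"
  obtains f' where "smooth_fun f'" "\<And>x. (f has_vector_derivative f' x) (at x)"
  using smooth_fun_has_vector_derivative[OF assms] smooth_fun_vector_derivative[OF assms] by blast

lemma smooth_fun_continuous:
  assumes "smooth_fun f"
  shows "continuous_on A f"
  using smooth_fun_has_vector_derivative[OF assms]
  by (meson continuous_at_imp_continuous_on has_vector_derivative_continuous)

text \<open>By induction all iterated derivatives stay in a set that is closed under one
  differentiation. Smoothness of concrete functions is obtained by guessing such a set, without
  formulas for higher derivatives.\<close>

lemma smooth_fun_coinduct:
  assumes "f \<in> S"
    and "\<And>g. g \<in> S \<Longrightarrow> \<exists>g'\<in>S. \<forall>x. (g has_vector_derivative g' x) (at x)"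
  shows "smooth_fun f"
proof -
  have "vderiv_iter n f \<in> S" for n
  proof (induction n)
    case (Suc n)
    then obtain g' where "g' \<in> S" "\<And>x. (vderiv_iter n f has_vector_derivative g' x) (at x)"
      using assms(2) by blast
    moreover from this(2) have "vderiv_iter (Suc n) f = g'"
      by (auto intro!: ext vector_derivative_at)
    ultimately show ?case by simp
  qed (use assms in simp)
  then show ?thesis
    unfolding smooth_fun_def using assms(2)
    by (metis differentiableI_vector)
qed

text \<open>The Leibniz rule turns a product into a sum of two products, so closure under sums gives
  a set stable under differentiation and replaces the binomial formula.\<close>

inductive_set product_span :: "(real \<Rightarrow> complex) set" where
  mult: "smooth_fun f \<Longrightarrow> smooth_fun g \<Longrightarrow> (\<lambda>x. f x * g x) \<in> product_span"
| add: "f \<in> product_span \<Longrightarrow> g \<in> product_span \<Longrightarrow> (\<lambda>x. f x + g x) \<in> product_span"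

lemma smooth_fun_product_span:
  assumes "f \<in> product_span"
  shows "smooth_fun f"
proof (rule smooth_fun_coinduct[OF assms])
  fix g assume "g \<in> product_span"
  then show "\<exists>g'\<in>product_span. \<forall>x. (g has_vector_derivative g' x) (at x)"
  proof induction
    case (mult f g)
    obtain f' where f': "smooth_fun f'" "\<And>x. (f has_vector_derivative f' x) (at x)"
      using smooth_funE[OF mult(1)] by blast
    obtain g' where g': "smooth_fun g'" "\<And>x. (g has_vector_derivative g' x) (at x)"
      using smooth_funE[OF mult(2)] by blast
    have "\<forall>x. ((\<lambda>x. f x * g x) has_vector_derivative (f x * g' x + f' x * g x)) (at x)"
      using f'(2) g'(2) by (auto intro!: has_vector_derivative_mult)
    moreover have "(\<lambda>x. f x * g' x + f' x * g x) \<in> product_span"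
      by (rule product_span.add; rule product_span.mult; fact)
    ultimately show ?case by (rule bexI[where x = "\<lambda>x. f x * g' x + f' x * g x"])
  next
    case (add f g)
    from add.IH obtain f' g' where f': "f' \<in> product_span" "\<And>x. (f has_vector_derivative f' x) (at x)"
      and g': "g' \<in> product_span" "\<And>x. (g has_vector_derivative g' x) (at x)" by blast
    show ?case
      by (rule bexI[where x = "\<lambda>x. f' x + g' x"])
         (auto intro: has_vector_derivative_add f' g' product_span.add)
  qed
qed

lemma smooth_fun_const: "smooth_fun (\<lambda>x. c)"
proof (rule smooth_fun_coinduct[where S = "range (\<lambda>c x. c)"])
  fix g :: "real \<Rightarrow> complex" assume "g \<in> range (\<lambda>c x. c)"
  then show "\<exists>g'\<in>range (\<lambda>c x. c). \<forall>x. (g has_vector_derivative g' x) (at x)"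
    by (intro bexI[where x = "\<lambda>x. 0"]) auto
qed simp

lemma smooth_fun_mult: "smooth_fun f \<Longrightarrow> smooth_fun g \<Longrightarrow> smooth_fun (\<lambda>x. f x * g x)"
  by (rule smooth_fun_product_span, rule product_span.mult[of f g])

lemma smooth_fun_of_derivative:
  assumes "smooth_fun f'" "\<And>x. (f has_vector_derivative f' x) (at x)"
  shows "smooth_fun f"
proof (rule smooth_fun_coinduct[where S = "insert f (Collect smooth_fun)"])
  fix g assume "g \<in> insert f (Collect smooth_fun)"
  then show "\<exists>g'\<in>insert f (Collect smooth_fun). \<forall>x. (g has_vector_derivative g' x) (at x)"
    using assms by (cases "g = f") (auto elim: smooth_funE)
qed simp

lemma smooth_fun_of_real: "smooth_fun of_real"
  by (rule smooth_fun_of_derivative[OF smooth_fun_const[of 1]])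
     (use has_vector_derivative_of_real[OF DERIV_ident] in simp)

lemma smooth_fun_affine:
  assumes "smooth_fun f"
  shows "smooth_fun (\<lambda>x. f (a + b * x))"
\<comment> \<open>The constant multiples in the set absorb the factor \<open>b\<close> that each use
  of the chain rule produces.\<close>
proof (rule smooth_fun_coinduct[where S = "{\<lambda>x. c * f (a + b * x) |c f. smooth_fun f}"])
  show "(\<lambda>x. f (a + b * x)) \<in> {\<lambda>x. c * f (a + b * x) |c f. smooth_fun f}"
    using assms by (auto intro!: exI[of _ 1])
next
  fix g assume "g \<in> {\<lambda>x. c * f (a + b * x) |c f. smooth_fun f}"
  then obtain c f where g: "g = (\<lambda>x. c * f (a + b * x))" and f: "smooth_fun f" by blast
  obtain f' where f': "smooth_fun f'" "\<And>x. (f has_vector_derivative f' x) (at x)"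
    using smooth_funE[OF f] by blast
  have "(g has_vector_derivative c * (of_real b * f' (a + b * x))) (at x)" for x
  proof -
    have "((\<lambda>x. a + b * x) has_vector_derivative b) (at x)"
      by (auto intro!: derivative_eq_intros)
    from vector_diff_chain_at[OF this f'(2)]
    have "((\<lambda>x. f (a + b * x)) has_vector_derivative of_real b * f' (a + b * x)) (at x)"
      by (simp add: o_def scaleR_conv_of_real)
    then show ?thesis
      unfolding g by (rule has_vector_derivative_mult_right)
  qed
  moreover have "(\<lambda>x. c * (of_real b * f' (a + b * x))) \<in> {\<lambda>x. c * f (a + b * x) |c f. smooth_fun f}"
    using f' by (auto intro!: exI[of _ "c * of_real b"] exI[of _ f'])
  ultimately show "\<exists>g'\<in>{\<lambda>x. c * f (a + b * x) |c f. smooth_fun f}.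
      \<forall>x. (g has_vector_derivative g' x) (at x)"
    by (intro bexI[where x = "\<lambda>x. c * (of_real b * f' (a + b * x))"]) auto
qed

text \<open>Differentiation under the integral sign multiplies the coefficient \<open>c y\<close> by
  \<open>\<i> * of_real y\<close>, and the result is again continuous. Smoothness in
  \<open>t\<close> thus needs only continuity of \<open>c\<close>, which later lets \<open>c\<close>
  range over a Banach space.\<close>

lemma smooth_fun_integral_exp:
  fixes c :: "real \<Rightarrow> complex"
  assumes "continuous_on {0..h} c"
  shows "smooth_fun (\<lambda>t. integral {0..h} (\<lambda>y. c y * exp (\<i> * of_real (y * t))))"
proof (rule smooth_fun_coinduct[where
      S = "{\<lambda>t. integral {0..h} (\<lambda>y. c y * exp (\<i> * of_real (y * t))) |c. continuous_on {0..h} c}"])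
  fix g assume "g \<in> {\<lambda>t. integral {0..h} (\<lambda>y. c y * exp (\<i> * of_real (y * t))) |c. continuous_on {0..h} c}"
  then obtain c where g: "g = (\<lambda>t. integral {0..h} (\<lambda>y. c y * exp (\<i> * of_real (y * t))))"
    and c: "continuous_on {0..h} c" by blast
  define c' where "c' = (\<lambda>y. c y * (\<i> * of_real y))"
  have c': "continuous_on {0..h} c'"
    unfolding c'_def by (intro continuous_intros c)
  have "(g has_vector_derivative integral (cbox 0 h) (\<lambda>y. c' y * exp (\<i> * of_real (y * t)))) (at t within UNIV)" for t
    unfolding g cbox_interval[symmetric]
  proof (rule leibniz_rule_vector_derivative)
    fix x y :: real
    show "((\<lambda>x. c y * exp (\<i> * of_real (y * x))) has_vector_derivative c' y * exp (\<i> * of_real (y * x))) (at x within UNIV)"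
      unfolding c'_def
      by (rule has_vector_derivative_eq_rhs, rule has_vector_derivative_mult_right,
          rule field_vector_diff_chain_at[of "\<lambda>x. \<i> * of_real (y * x)" "\<i> * of_real y" _ exp, unfolded o_def])
         (auto intro!: derivative_eq_intros simp: has_vector_derivative_def scaleR_conv_of_real)
  next
    fix x :: real
    show "(\<lambda>y. c y * exp (\<i> * of_real (y * x))) integrable_on cbox 0 h"
      using c by (intro integrable_continuous) (auto intro!: continuous_intros)
  next
    show "continuous_on (UNIV \<times> cbox 0 h) (\<lambda>(x, y). c' y * exp (\<i> * of_real (y * x)))"
      using c' unfolding split_def
      by (intro continuous_intros continuous_on_compose2[OF c']) auto
  qed auto
  then show "\<exists>g'\<in>{\<lambda>t. integral {0..h} (\<lambda>y. c y * exp (\<i> * of_real (y * t))) |c. continuous_on {0..h} c}.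
      \<forall>x. (g has_vector_derivative g' x) (at x)"
    using c' by auto
qed (use assms in auto)

lemma smooth_fun_cis: "smooth_fun (\<lambda>t. exp (\<i> * of_real (h * t)))"
proof (rule smooth_fun_coinduct[where S = "{\<lambda>t. c * exp (\<i> * of_real (h * t)) |c. True}"])
  show "(\<lambda>t. exp (\<i> * of_real (h * t))) \<in> {\<lambda>t. c * exp (\<i> * of_real (h * t)) |c. True}"
    by (auto intro!: exI[of _ 1])
next
  fix g assume "g \<in> {\<lambda>t. c * exp (\<i> * of_real (h * t)) |c. True}"
  then obtain c where g: "g = (\<lambda>t. c * exp (\<i> * of_real (h * t)))" by blast
  have "(g has_vector_derivative (c * (\<i> * of_real h)) * exp (\<i> * of_real (h * t))) (at t)" for t
    unfolding g
    by (rule has_vector_derivative_eq_rhs, rule has_vector_derivative_mult_right,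
        rule field_vector_diff_chain_at[of "\<lambda>x. \<i> * of_real (h * x)" "\<i> * of_real h" _ exp, unfolded o_def])
       (auto intro!: derivative_eq_intros simp: has_vector_derivative_def scaleR_conv_of_real)
  then show "\<exists>g'\<in>{\<lambda>t. c * exp (\<i> * of_real (h * t)) |c. True}. \<forall>x. (g has_vector_derivative g' x) (at x)"
    by auto
qed

lemma tsupport_eq_0: "x \<notin> tsupport f \<Longrightarrow> f x = 0"
  unfolding tsupport_def using closure_subset[of "{x. f x \<noteq> 0}"] by blast

lemma tsupport_minimal: "closed S \<Longrightarrow> (\<And>x. f x \<noteq> 0 \<Longrightarrow> x \<in> S) \<Longrightarrow> tsupport f \<subseteq> S"
  unfolding tsupport_def by (rule closure_minimal) auto

lemma closed_tsupport: "closed (tsupport f)"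
  unfolding tsupport_def by simp

lemma compact_tsupport: "tsupport f \<subseteq> K \<Longrightarrow> compact K \<Longrightarrow> compact (tsupport f)"
  using compact_Int_closed[OF _ closed_tsupport, of K f] by (simp add: Int_absorb1)

lemma test_funI:
  assumes "smooth_fun \<phi>" "\<And>x. x \<notin> {a..b} \<Longrightarrow> \<phi> x = 0" "{a..b} \<subseteq> U"
  shows "test_fun U \<phi>"
proof -
  have "tsupport \<phi> \<subseteq> {a..b}"
    using assms(2) by (intro tsupport_minimal) auto
  moreover from this have "compact (tsupport \<phi>)"
    by (rule compact_tsupport) simp
  ultimately show ?thesis
    unfolding test_fun_def using assms by auto
qed

lemma test_fun_smooth: "test_fun U \<phi> \<Longrightarrow> smooth_fun \<phi>"
  by (simp add: test_fun_def)

lemma test_fun_mono: "test_fun U \<phi> \<Longrightarrow> U \<subseteq> V \<Longrightarrow> test_fun V \<phi>"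
  by (auto simp: test_fun_def)

lemma test_fun_mult:
  assumes "smooth_fun m" "test_fun U \<phi>"
  shows "test_fun U (\<lambda>x. m x * \<phi> x)"
proof -
  have sub: "tsupport (\<lambda>x. m x * \<phi> x) \<subseteq> tsupport \<phi>"
    by (rule tsupport_minimal[OF closed_tsupport]) (metis mult_zero_right tsupport_eq_0)
  moreover have "compact (tsupport (\<lambda>x. m x * \<phi> x))"
    using assms(2) by (intro compact_tsupport[OF sub]) (simp add: test_fun_def)
  ultimately show ?thesis
    using assms unfolding test_fun_def by (auto intro: smooth_fun_mult)
qed

lemma test_fun_bounds:
  assumes "test_fun U \<phi>"
  obtains R where "R > 0" "\<And>x. x \<notin> {-R..R} \<Longrightarrow> \<phi> x = 0"
proof -
  from assms have "bounded (tsupport \<phi>)"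
    unfolding test_fun_def by (simp add: compact_imp_bounded)
  then obtain R where "R > 0" "\<And>x. x \<in> tsupport \<phi> \<Longrightarrow> \<bar>x\<bar> \<le> R"
    unfolding bounded_pos by auto
  then show ?thesis
    by (intro that[of R]) (auto intro!: tsupport_eq_0 simp: abs_le_iff, smt (verit))
qed

lemma integrable_compact_support:
  fixes f :: "real \<Rightarrow> 'a::euclidean_space"
  assumes "continuous_on UNIV f" "\<And>x. x \<notin> {a..b} \<Longrightarrow> f x = 0"
  shows "integrable lborel f"
proof -
  have "set_integrable lborel {a..b} f"
    using assms(1) by (intro borel_integrable_atLeastAtMost') (auto intro: continuous_on_subset)
  moreover have "(\<lambda>x. indicator {a..b} x *\<^sub>R f x) = f"
    using assms(2) by (auto simp: indicator_def)
  ultimately show ?thesis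
    by (simp add: set_integrable_def)
qed

lemma test_fun_integrable:
  assumes "test_fun U \<phi>"
  shows "integrable lborel \<phi>"
proof -
  obtain R where "\<And>x. x \<notin> {-R..R} \<Longrightarrow> \<phi> x = 0"
    using test_fun_bounds[OF assms] by blast
  then show ?thesis
    using integrable_compact_support[OF smooth_fun_continuous[OF test_fun_smooth[OF assms]]] by blast
qed

lemma smooth_fun_measurable: "smooth_fun f \<Longrightarrow> f \<in> borel_measurable borel"
  using smooth_fun_continuous borel_measurable_continuous_onI by blast

section \<open>Fourier transforms of test functions\<close>

definition flat :: "nat \<Rightarrow> real \<Rightarrow> real" where
  "flat n x = (if x > 0 then exp (- 1 / x) / x ^ n else 0)"

lemma flat_at_right_0: "(flat n \<longlongrightarrow> 0) (at_right 0)"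
proof -
  have "((\<lambda>x. (1 / x) ^ n / exp (1 / x)) \<longlongrightarrow> 0) (at_right (0::real))"
    using filterlim_compose[OF tendsto_power_div_exp_0 filterlim_inverse_at_top_right, of n]
    by (simp add: inverse_eq_divide)
  moreover have "\<forall>\<^sub>F x in at_right 0. (1 / x) ^ n / exp (1 / x) = flat n x"
    by (auto simp: eventually_at_filter flat_def exp_minus field_simps)
  ultimately show ?thesis
    by (rule Lim_transform_eventually)
qed

text \<open>For positive \<open>x\<close> this is the quotient rule, the second term coming from the
  derivative of \<open>- 1 / x\<close>. At 0 the right-hand difference quotient is
  \<open>flat (Suc n)\<close>, which tends to 0 because the exponential beats every power.\<close>

lemma flat_has_derivative:
  "(flat n has_real_derivative (- real n * flat (Suc n) x + flat (n + 2) x)) (at x)"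
proof -
  consider "x > 0" | "x < 0" | "x = 0" by linarith
  then show ?thesis
  proof cases
    case 1
    have "((\<lambda>x. exp (- 1 / x) / x ^ n) has_real_derivative
        (- real n * flat (Suc n) x + flat (n + 2) x)) (at x)"
    proof -
      have p: "((\<lambda>x. x ^ n) has_real_derivative real n * x ^ n / x) (at x)"
        using 1 DERIV_pow[of n x] by (cases n) auto
      show ?thesis
        by (rule DERIV_cong[OF DERIV_divide[OF _ p, of _ "exp (- 1 / x) / x\<^sup>2"]])
           (use 1 in \<open>auto intro!: derivative_eq_intros simp: flat_def field_simps power2_eq_square\<close>)
    qed
    then show ?thesis
      by (rule has_field_derivative_transform_within_open[of _ _ _ "{0<..}"])
         (use 1 in \<open>auto simp: flat_def\<close>)
  next
    case 2
    have "((\<lambda>x. 0) has_real_derivative (- real n * flat (Suc n) x + flat (n + 2) x)) (at x)"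
      using 2 by (simp add: flat_def)
    then show ?thesis
      by (rule has_field_derivative_transform_within_open[of _ _ _ "{..<0}"])
         (use 2 in \<open>auto simp: flat_def\<close>)
  next
    case 3
    have "((\<lambda>h. (flat n (0 + h) - flat n 0) / h) \<longlongrightarrow> 0) (at 0)"
      unfolding at_within_union[of 0 "{..<0}" "{0<..}", symmetric] filterlim_split_at
    proof (rule filterlim_split_at)
      show "((\<lambda>h. (flat n (0 + h) - flat n 0) / h) \<longlongrightarrow> 0) (at_left 0)"
        by (rule Lim_transform_eventually[OF tendsto_const])
           (auto simp: eventually_at_filter flat_def)
      show "((\<lambda>h. (flat n (0 + h) - flat n 0) / h) \<longlongrightarrow> 0) (at_right 0)"
        by (rule Lim_transform_eventually[OF flat_at_right_0[of "Suc n"]])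
           (auto simp: eventually_at_filter flat_def)
    qed
    then show ?thesis
      using 3 by (simp add: DERIV_def flat_def)
  qed
qed

inductive_set flat_span :: "(real \<Rightarrow> complex) set" where
  scale: "(\<lambda>x. c * of_real (flat n x)) \<in> flat_span"
| add: "f \<in> flat_span \<Longrightarrow> g \<in> flat_span \<Longrightarrow> (\<lambda>x. f x + g x) \<in> flat_span"

lemma smooth_fun_flat: "smooth_fun (\<lambda>x. of_real (flat n x))"
proof (rule smooth_fun_coinduct)
  show "(\<lambda>x. of_real (flat n x)) \<in> flat_span"
    using flat_span.scale[of 1 n] by simp
next
  fix g assume "g \<in> flat_span"
  then show "\<exists>g'\<in>flat_span. \<forall>x. (g has_vector_derivative g' x) (at x)"
  proof induction
    case (scale c n)
    show ?case
    proof (rule bexI[where x = "\<lambda>x. (- c * of_nat n) * of_real (flat (Suc n) x) + c * of_real (flat (n + 2) x)"], safe)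
      fix x
      have "((\<lambda>x. c * of_real (flat n x)) has_vector_derivative
          c * of_real (- real n * flat (Suc n) x + flat (n + 2) x)) (at x)"
        by (intro has_vector_derivative_mult_right has_vector_derivative_of_real flat_has_derivative)
      then show "((\<lambda>x. c * of_real (flat n x)) has_vector_derivative
          (- c * of_nat n) * of_real (flat (Suc n) x) + c * of_real (flat (n + 2) x)) (at x)"
        by (simp add: algebra_simps)
    qed (rule flat_span.add; rule flat_span.scale)
  next
    case (add f g)
    from add.IH obtain f' g' where f': "f' \<in> flat_span" "\<And>x. (f has_vector_derivative f' x) (at x)"
      and g': "g' \<in> flat_span" "\<And>x. (g has_vector_derivative g' x) (at x)" by blast
    show ?case
      by (rule bexI[where x = "\<lambda>x. f' x + g' x"])
         (auto intro: has_vector_derivative_add f' g' flat_span.add)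
  qed
qed

lemma ex_bump:
  fixes l :: real
  assumes "l > 0"
  obtains \<psi> :: "real \<Rightarrow> real" where
    "smooth_fun (\<lambda>x. of_real (\<psi> x))" "\<And>x. \<psi> x \<ge> 0" "\<And>x. \<psi> (- x) = \<psi> x"
    "\<And>x. x \<in> {-l<..<l} \<Longrightarrow> \<psi> x > 0" "\<And>x. x \<notin> {-l..l} \<Longrightarrow> \<psi> x = 0"
proof -
  \<comment> \<open>Both factors are positive exactly when \<open>\<bar>x\<bar> < l\<close>, and
    reflection swaps them.\<close>
  define \<psi> where "\<psi> = (\<lambda>x. flat 0 (l + x) * flat 0 (l - x))"
  have "smooth_fun (\<lambda>x. of_real (flat 0 (l + 1 * x)) * of_real (flat 0 (l + (- 1) * x)))"
    by (rule smooth_fun_mult; rule smooth_fun_affine[OF smooth_fun_flat])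
  then have "smooth_fun (\<lambda>x. of_real (\<psi> x))"
    by (simp add: \<psi>_def)
  then show ?thesis
    by (rule that) (use assms in \<open>auto simp: \<psi>_def flat_def mult.commute\<close>)
qed

section \<open>Exchange of integrals, decay of Fourier transforms and inversion\<close>

lemma fubini_bounded_kernel:
  fixes a b :: "real \<Rightarrow> complex" and k :: "real \<Rightarrow> real \<Rightarrow> complex"
  assumes a: "integrable lborel a" and b: "integrable lborel b"
    and k: "(\<lambda>(x, y). k x y) \<in> borel_measurable (borel \<Otimes>\<^sub>M borel)"
    and B: "\<And>x y. norm (k x y) \<le> B"
  shows "(LINT x|lborel. a x * (LINT y|lborel. b y * k x y)) =
    (LINT y|lborel. b y * (LINT x|lborel. a x * k x y))"
proof -
  note [measurable] = borel_measurable_integrable[OF a, simplified] borel_measurable_integrable[OF b, simplified] k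
  have B': "norm (k x y) \<le> \<bar>B\<bar>" for x y
    using B[of x y] by linarith
  have sec: "integrable lborel (\<lambda>y. b y * k x y)" for x
    by (rule Bochner_Integration.integrable_bound[OF integrable_mult_left[OF b, of "of_real B"]])
       (auto simp: norm_mult intro!: AE_I2 mult_left_mono B')
  have "integrable (lborel \<Otimes>\<^sub>M lborel) (\<lambda>(x, y). a x * (b y * k x y))"
  proof (rule lborel_pair.Fubini_integrable)
    show "integrable lborel (\<lambda>x. LINT y|lborel. norm (case (x, y) of (x, y) \<Rightarrow> a x * (b y * k x y)))"
    proof (rule Bochner_Integration.integrable_bound)
      show "integrable lborel (\<lambda>x. norm (a x) * ((LINT y|lborel. norm (b y)) * B))"
        using a by (intro integrable_mult_left integrable_norm) simp
      show "(\<lambda>x. LINT y|lborel. norm (case (x, y) of (x, y) \<Rightarrow> a x * (b y * k x y))) \<in> borel_measurable lborel"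
        by measurable
      have "norm (LINT y|lborel. norm (a x * (b y * k x y))) \<le> norm (norm (a x) * ((LINT y|lborel. norm (b y)) * B))" for x
      proof -
        have "(LINT y|lborel. norm (a x * (b y * k x y))) \<le> (LINT y|lborel. norm (a x) * (norm (b y) * B))"
          using B by (intro integral_mono integrable_norm integrable_mult_right integrable_mult_left sec b)
             (auto simp: norm_mult intro!: mult_left_mono)
        moreover have "0 \<le> (LINT y|lborel. norm (a x * (b y * k x y)))"
          by (intro Bochner_Integration.integral_nonneg) auto
        ultimately show ?thesis by simp
      qed
      then show "AE x in lborel. norm (LINT y|lborel. norm (case (x, y) of (x, y) \<Rightarrow> a x * (b y * k x y)))
          \<le> norm (norm (a x) * ((LINT y|lborel. norm (b y)) * B))"
        by simp
    qed
    show "AE x in lborel. integrable lborel (\<lambda>y. case (x, y) of (x, y) \<Rightarrow> a x * (b y * k x y))"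
      using sec by simp
  qed measurable
  from lborel_pair.Fubini_integral[OF this]
  have "(LINT x|lborel. LINT y|lborel. a x * (b y * k x y)) = (LINT y|lborel. LINT x|lborel. b y * (a x * k x y))"
    by (simp add: mult.left_commute)
  then show ?thesis by simp
qed

lemma norm_fourier_le:
  assumes "integrable lborel p"
  shows "norm (fourier p x) \<le> (LINT t|lborel. norm (p t))"
  unfolding fourier_def
  by (rule order_trans[OF integral_norm_bound]) (simp add: norm_mult)

lemma integrable_fourier_integrand:
  assumes "integrable lborel p"
  shows "integrable lborel (\<lambda>t. exp (- \<i> * of_real (x * t)) * p t)"
  by (rule Bochner_Integration.integrable_bound[OF assms])
     (use assms in \<open>auto simp: norm_mult intro!: borel_measurable_times dest: borel_measurable_integrable\<close>)

lemma continuous_fourier: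
  assumes "integrable lborel p"
  shows "continuous_on UNIV (fourier p)"
proof -
  have "(fourier p \<longlongrightarrow> fourier p x) (at x)" for x
    unfolding tendsto_at_iff_sequentially
  proof (intro allI impI)
    fix X :: "nat \<Rightarrow> real" assume X: "X \<longlonglongrightarrow> x"
    note [measurable] = borel_measurable_integrable[OF assms, simplified]
    show "(fourier p \<circ> X) \<longlonglongrightarrow> fourier p x"
      unfolding o_def fourier_def
      by (rule integral_dominated_convergence[where w = "\<lambda>t. norm (p t)"])
         (use X assms in \<open>auto simp: norm_mult intro!: tendsto_intros\<close>)
  qed
  then show ?thesis
    by (simp add: continuous_on_def)
qed

lemma test_fun_derivative:
  assumes \<phi>: "test_fun U \<phi>" and \<phi>': "smooth_fun \<phi>'" "\<And>x. (\<phi> has_vector_derivative \<phi>' x) (at x)"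
  shows "test_fun U \<phi>'"
proof -
  have sub: "tsupport \<phi>' \<subseteq> tsupport \<phi>"
  proof (rule tsupport_minimal[OF closed_tsupport])
    fix x assume "\<phi>' x \<noteq> 0"
    show "x \<in> tsupport \<phi>"
    proof (rule ccontr)
      assume x: "x \<notin> tsupport \<phi>"
      have "(\<phi> has_vector_derivative 0) (at x)"
        by (rule has_vector_derivative_transform_within_open[of "\<lambda>_. 0" _ _ "- tsupport \<phi>"])
           (use x closed_tsupport in \<open>auto simp: tsupport_eq_0\<close>)
      with \<phi>'(2)[of x] \<open>\<phi>' x \<noteq> 0\<close> show False
        by (metis vector_derivative_at)
    qed
  qed
  then show ?thesis
    using \<phi> \<phi>' compact_tsupport[OF sub] by (auto simp: test_fun_def)
qed

text \<open>Integration by parts over an interval that contains both supports, so that the boundary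
  terms vanish.\<close>

lemma fourier_derivative:
  assumes \<phi>: "test_fun U \<phi>" and \<phi>': "smooth_fun \<phi>'" "\<And>x. (\<phi> has_vector_derivative \<phi>' x) (at x)"
  shows "fourier \<phi>' x = \<i> * of_real x * fourier \<phi> x"
proof -
  note t' = test_fun_derivative[OF assms]
  obtain R1 where R1: "R1 > 0" "\<And>x. x \<notin> {-R1..R1} \<Longrightarrow> \<phi> x = 0"
    using test_fun_bounds[OF \<phi>] by blast
  obtain R2 where R2: "R2 > 0" "\<And>x. x \<notin> {-R2..R2} \<Longrightarrow> \<phi>' x = 0"
    using test_fun_bounds[OF t'] by blast
  \<comment> \<open>The bounds on the supports say nothing at \<open>R1\<close> and
    \<open>- R1\<close> themselves; the added 1 puts the endpoints \<open>R\<close> and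
    \<open>- R\<close> where \<open>\<phi>\<close> is known to vanish.\<close>
  define R where "R = max R1 R2 + 1"
  define E where "E = (\<lambda>t. exp (- \<i> * of_real (x * t)) :: complex)"
  have E: "(E has_vector_derivative - \<i> * of_real x * E t) (at t)" for t
    unfolding E_def
    by (rule has_vector_derivative_eq_rhs,
        rule field_vector_diff_chain_at[of "\<lambda>t. - \<i> * of_real (x * t)" "- \<i> * of_real x" _ exp, unfolded o_def])
       (auto intro!: derivative_eq_intros simp: has_vector_derivative_def scaleR_conv_of_real)
  have cE: "continuous_on A E" for A
    unfolding E_def by (intro continuous_intros)
  have "has_bochner_integral lborel (\<lambda>t. indicator {-R..R} t *\<^sub>R (E t * \<phi>' t + - \<i> * of_real x * E t * \<phi> t))
     (E R * \<phi> R - E (- R) * \<phi> (- R))"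
  proof (rule has_bochner_integral_FTC_Icc)
    show "- R \<le> R" using R1(1) by (simp add: R_def)
    show "((\<lambda>t. E t * \<phi> t) has_vector_derivative E t * \<phi>' t + - \<i> * of_real x * E t * \<phi> t) (at t within {-R..R})" for t
      by (rule has_vector_derivative_at_within, rule has_vector_derivative_mult[OF E \<phi>'(2)])
    show "continuous_on {-R..R} (\<lambda>t. E t * \<phi>' t + - \<i> * of_real x * E t * \<phi> t)"
      by (intro continuous_intros cE smooth_fun_continuous \<phi>' test_fun_smooth[OF \<phi>])
  qed
  moreover have "(\<lambda>t. indicator {-R..R} t *\<^sub>R (E t * \<phi>' t + - \<i> * of_real x * E t * \<phi> t)) =
      (\<lambda>t. E t * \<phi>' t - \<i> * of_real x * (E t * \<phi> t))"
  proof
    fix t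
    have "\<phi> t = 0 \<and> \<phi>' t = 0" if "t \<notin> {-R..R}"
    proof -
      have "t \<notin> {-R1..R1}" "t \<notin> {-R2..R2}"
        using that by (auto simp: R_def max_def split: if_splits)
      then show ?thesis using R1(2) R2(2) by blast
    qed
    then show "indicator {-R..R} t *\<^sub>R (E t * \<phi>' t + - \<i> * of_real x * E t * \<phi> t) =
      E t * \<phi>' t - \<i> * of_real x * (E t * \<phi> t)"
      by (auto simp: indicator_def)
  qed
  moreover have "\<phi> R = 0" "\<phi> (- R) = 0"
    using R1(1) by (auto intro!: R1(2) simp: R_def)
  ultimately have "(LINT t|lborel. E t * \<phi>' t - \<i> * of_real x * (E t * \<phi> t)) = 0"
    by (simp add: has_bochner_integral_iff)
  moreover have "integrable lborel (\<lambda>t. E t * \<phi>' t)" "integrable lborel (\<lambda>t. E t * \<phi> t)"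
    unfolding E_def by (intro integrable_fourier_integrand test_fun_integrable[OF \<phi>] test_fun_integrable[OF t'])+
  ultimately show ?thesis
    by (simp add: fourier_def E_def Bochner_Integration.integral_diff)
qed

text \<open>Up to sign, \<open>x\<^sup>2\<close> times the transform is the transform of the second
  derivative, hence bounded; adding the bound for the transform itself produces the factor
  \<open>1 + x\<^sup>2\<close>.\<close>

lemma fourier_test_fun_decay:
  assumes \<phi>: "test_fun U \<phi>"
  obtains D where "D > 0" "\<And>x. norm (fourier \<phi> x) \<le> D / (1 + x\<^sup>2)"
proof -
  obtain \<phi>1 where 1: "smooth_fun \<phi>1" "\<And>x. (\<phi> has_vector_derivative \<phi>1 x) (at x)"
    using smooth_funE[OF test_fun_smooth[OF \<phi>]] by blast
  obtain \<phi>2 where 2: "smooth_fun \<phi>2" "\<And>x. (\<phi>1 has_vector_derivative \<phi>2 x) (at x)"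
    using smooth_funE[OF 1(1)] by blast
  note t1 = test_fun_derivative[OF \<phi> 1] and t2 = test_fun_derivative[OF test_fun_derivative[OF \<phi> 1] 2]
  have *: "fourier \<phi>2 x = - of_real (x\<^sup>2) * fourier \<phi> x" for x
    using fourier_derivative[OF \<phi> 1, of x] fourier_derivative[OF t1 2, of x]
    by (simp add: power2_eq_square algebra_simps)
  define D where "D = (LINT t|lborel. norm (\<phi> t)) + (LINT t|lborel. norm (\<phi>2 t)) + 1"
  show ?thesis
  proof (rule that)
    have "0 \<le> (LINT t|lborel. norm (\<phi> t))" "0 \<le> (LINT t|lborel. norm (\<phi>2 t))"
      by (auto intro!: Bochner_Integration.integral_nonneg)
    then show "D > 0" unfolding D_def by linarith
    fix x
    have "x\<^sup>2 * norm (fourier \<phi> x) = norm (fourier \<phi>2 x)"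
      by (simp add: * norm_mult norm_power)
    then have "(1 + x\<^sup>2) * norm (fourier \<phi> x) \<le> D"
      using norm_fourier_le[OF test_fun_integrable[OF \<phi>], of x] norm_fourier_le[OF test_fun_integrable[OF t2], of x]
      by (simp add: D_def algebra_simps)
    then show "norm (fourier \<phi> x) \<le> D / (1 + x\<^sup>2)"
      by (simp add: pos_le_divide_eq add_pos_nonneg mult.commute)
  qed
qed

lemma integrable_inverse_1_plus_square: "integrable lborel (\<lambda>x::real. 1 / (1 + x\<^sup>2))"
  using Sinc_Integral.integrable_inverse_1_plus_square
  by (simp add: set_integrable_def inverse_eq_divide)

lemma fourier_test_fun_integrable:
  assumes \<phi>: "test_fun U \<phi>"
  shows "integrable lborel (fourier \<phi>)"
proof -
  obtain D where "D > 0" "\<And>x. norm (fourier \<phi> x) \<le> D / (1 + x\<^sup>2)"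
    using fourier_test_fun_decay[OF \<phi>] by blast
  then show ?thesis
    by (intro Bochner_Integration.integrable_bound[OF integrable_mult_right[OF integrable_inverse_1_plus_square, of D]])
       (auto intro!: borel_measurable_continuous_onI continuous_fourier test_fun_integrable[OF \<phi>] AE_I2)
qed

lemma integrable_bounded_mult_fourier:
  assumes \<phi>: "test_fun U \<phi>" and p: "p \<in> borel_measurable borel" "\<And>x. norm (p x) \<le> B"
  shows "integrable lborel (\<lambda>x. p x * fourier \<phi> x)"
proof (rule Bochner_Integration.integrable_bound)
  show "integrable lborel (\<lambda>x. of_real B * fourier \<phi> x)"
    by (intro integrable_mult_right fourier_test_fun_integrable[OF \<phi>])
  show "(\<lambda>x. p x * fourier \<phi> x) \<in> borel_measurable lborel"
    using p(1) borel_measurable_integrable[OF fourier_test_fun_integrable[OF \<phi>]] by simp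
  show "AE x in lborel. norm (p x * fourier \<phi> x) \<le> norm (of_real B * fourier \<phi> x)"
    using order_trans[OF p(2) abs_ge_self] by (intro AE_I2) (simp add: norm_mult mult_right_mono)
qed

lemma lborel_integral_reflect:
  fixes f :: "real \<Rightarrow> 'a::{banach, second_countable_topology}"
  shows "(LINT x|lborel. f (- x)) = (LINT x|lborel. f x)"
  using lborel_integral_real_affine[of "-1" f 0] by simp

lemma inv_fourier_eq: "inv_fourier \<phi> u = fourier \<phi> (- u) / of_real (2 * pi)"
  by (simp add: inv_fourier_def fourier_def)

lemma test_fun_bounded:
  assumes "test_fun U \<phi>"
  obtains B where "B > 0" "\<And>x. norm (\<phi> x) \<le> B"
proof -
  obtain R where R: "\<And>x. x \<notin> {-R..R} \<Longrightarrow> \<phi> x = 0"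
    using test_fun_bounds[OF assms] by blast
  have "compact (\<phi> ` {-R..R})"
    by (intro compact_continuous_image smooth_fun_continuous test_fun_smooth[OF assms]) simp
  from compact_imp_bounded[OF this] obtain B where B: "B > 0" "\<forall>y\<in>\<phi> ` {-R..R}. norm y \<le> B"
    unfolding bounded_pos by blast
  have "norm (\<phi> x) \<le> B" for x
    using R[of x] B by (cases "x \<in> {-R..R}") (auto simp del: atLeastAtMost_iff)
  then show ?thesis
    using that[of B] B(1) by blast
qed

lemma integrable_std_normal_density: "integrable lborel std_normal_density"
  using integrable_normal_density[of 1 0] by simp

lemma fourier_std_normal:
  "(LINT x|lborel. of_real (std_normal_density x) * exp (\<i> * of_real (w * x))) = exp (- of_real (w\<^sup>2 / 2))"
proof -
  have "char std_normal_distribution w = (LINT x|lborel. std_normal_density x *\<^sub>R iexp (w * x))"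
    unfolding char_def by (subst integral_density) auto
  then show ?thesis
    by (simp add: char_std_normal_distribution scaleR_conv_of_real exp_of_real[symmetric])
qed

text \<open>Damping by a Gaussian of width tending to infinity turns the inversion integral into a
  convolution with an approximate identity.\<close>

lemma inv_fourier_fourier:
  assumes \<phi>: "test_fun U \<phi>"
  shows "inv_fourier (fourier \<phi>) t = \<phi> t"
proof -
  define N where "N = (\<lambda>x. complex_of_real (std_normal_density x))"
  define e where "e = (\<lambda>n. 1 / real (Suc n))"
  have e0: "e n > 0" for n by (simp add: e_def)
  have e_lim: "e \<longlonglongrightarrow> 0"
    unfolding e_def using LIMSEQ_inverse_real_of_nat by (simp add: inverse_eq_divide)
  have N_int: "integrable lborel N"
    unfolding N_def using integrable_std_normal_density by simp
  note [measurable] = borel_measurable_integrable[OF N_int, simplified] smooth_fun_measurable[OF test_fun_smooth[OF \<phi>]]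
  have N_cont: "isCont N 0"
    unfolding N_def std_normal_density_def by (intro continuous_intros) auto
  have N_le: "norm (N x) \<le> norm (N 0)" for x
    by (simp add: N_def std_normal_density_def divide_right_mono norm_divide)
  \<comment> \<open>The damped inversion integral. Its limit is computed twice, directly and as a
    Gaussian average of \<open>\<phi>\<close> around \<open>t\<close>, and the two values are
    equated.\<close>
  define I where "I = (\<lambda>n. LINT x|lborel. exp (\<i> * of_real (t * x)) * N (e n * x) * fourier \<phi> x)"
  note F_int = fourier_test_fun_integrable[OF \<phi>]
  note [measurable] = borel_measurable_integrable[OF F_int, simplified]
  have lim1: "I \<longlonglongrightarrow> (LINT x|lborel. exp (\<i> * of_real (t * x)) * N 0 * fourier \<phi> x)"
    unfolding I_def
  proof (rule integral_dominated_convergence[where w = "\<lambda>x. norm (N 0) * norm (fourier \<phi> x)"])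
    show "AE x in lborel. (\<lambda>n. exp (\<i> * of_real (t * x)) * N (e n * x) * fourier \<phi> x) \<longlonglongrightarrow>
        exp (\<i> * of_real (t * x)) * N 0 * fourier \<phi> x"
    proof (intro AE_I2 tendsto_intros)
      fix x
      have "(\<lambda>n. e n * x) \<longlonglongrightarrow> 0"
        using tendsto_mult_left_zero[OF e_lim] by simp
      then show "(\<lambda>n. N (e n * x)) \<longlonglongrightarrow> N 0"
        by (rule isCont_tendsto_compose[OF N_cont])
    qed
    show "AE x in lborel. norm (exp (\<i> * of_real (t * x)) * N (e n * x) * fourier \<phi> x)
        \<le> norm (N 0) * norm (fourier \<phi> x)" for n
      by (intro AE_I2) (simp add: norm_mult mult_right_mono[OF N_le])
    show "integrable lborel (\<lambda>x. norm (N 0) * norm (fourier \<phi> x))"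
      using F_int by simp
  qed measurable
  have I_eq: "I n = (LINT v|lborel. \<phi> (t + e n * v) * exp (- of_real (v\<^sup>2 / 2)))" for n
  proof -
    have a_int: "integrable lborel (\<lambda>x. exp (\<i> * of_real (t * x)) * N (e n * x))"
    proof (rule Bochner_Integration.integrable_bound)
      show "integrable lborel (\<lambda>x. N (e n * x))"
        using e0[of n] lborel_integrable_real_affine[OF N_int, of "e n" 0] by simp
      show "AE x in lborel. norm (exp (\<i> * of_real (t * x)) * N (e n * x)) \<le> norm (N (e n * x))"
        by (intro AE_I2) (simp add: norm_mult)
    qed measurable
    have "I n = (LINT x|lborel. (exp (\<i> * of_real (t * x)) * N (e n * x)) *
        (LINT y|lborel. \<phi> y * exp (- \<i> * of_real (x * y))))"
      unfolding I_def fourier_def by (simp add: mult.commute)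
    also have "\<dots> = (LINT y|lborel. \<phi> y * (LINT x|lborel. (exp (\<i> * of_real (t * x)) * N (e n * x)) * exp (- \<i> * of_real (x * y))))"
      by (rule fubini_bounded_kernel[OF a_int test_fun_integrable[OF \<phi>], where B = 1]) auto
    \<comment> \<open>After scaling by \<open>e n\<close> the inner integral is the characteristic
      function of the standard normal law at \<open>(t - y) / e n\<close>; the substitution
      \<open>y = t + e n * v\<close> then cancels the denominator.\<close>
    also have "\<dots> = (LINT y|lborel. \<phi> y * (exp (- of_real (((t - y) / e n)\<^sup>2 / 2)) / of_real (e n)))"
    proof (intro Bochner_Integration.integral_cong refl)
      fix y
      have "(LINT x|lborel. (exp (\<i> * of_real (t * x)) * N (e n * x)) * exp (- \<i> * of_real (x * y))) =
          (LINT x|lborel. N (0 + e n * x) * exp (\<i> * of_real (((t - y) / e n) * (0 + e n * x))))"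
        using e0[of n]
        by (intro Bochner_Integration.integral_cong) (auto simp: exp_diff exp_minus exp_add[symmetric] field_simps)
      also have "\<dots> = exp (- of_real (((t - y) / e n)\<^sup>2 / 2)) / of_real (e n)"
        using lborel_integral_real_affine[of "e n" "\<lambda>x. N x * exp (\<i> * of_real (((t - y) / e n) * x))" 0] e0[of n]
          fourier_std_normal[of "(t - y) / e n"]
        by (simp add: N_def scaleR_conv_of_real field_simps)
      finally show "\<phi> y * (LINT x|lborel. (exp (\<i> * of_real (t * x)) * N (e n * x)) * exp (- \<i> * of_real (x * y))) =
        \<phi> y * (exp (- of_real (((t - y) / e n)\<^sup>2 / 2)) / of_real (e n))" by simp
    qed
    also have "\<dots> = (LINT v|lborel. \<phi> (t + e n * v) * exp (- of_real (v\<^sup>2 / 2)))"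
      using e0[of n] by (subst lborel_integral_real_affine[where c = "e n" and t = t])
        (auto simp: scaleR_conv_of_real)
    finally show ?thesis .
  qed
  obtain B where B: "\<And>x. norm (\<phi> x) \<le> B"
    using test_fun_bounded[OF \<phi>] by blast
  have G_eq: "exp (- of_real (v\<^sup>2 / 2)) = of_real (sqrt (2 * pi)) * N v" for v
    by (simp add: N_def std_normal_density_def exp_of_real[symmetric])
  have "I \<longlonglongrightarrow> (LINT v|lborel. \<phi> t * exp (- of_real (v\<^sup>2 / 2)))"
    unfolding I_eq
  proof (rule integral_dominated_convergence[where w = "\<lambda>v. B * norm (of_real (sqrt (2 * pi)) * N v)"])
    show "integrable lborel (\<lambda>v. B * norm (of_real (sqrt (2 * pi)) * N v))"
      using N_int by (intro integrable_mult_right integrable_norm) simp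
    show "AE v in lborel. (\<lambda>n. \<phi> (t + e n * v) * exp (- of_real (v\<^sup>2 / 2))) \<longlonglongrightarrow> \<phi> t * exp (- of_real (v\<^sup>2 / 2))"
    proof (intro AE_I2 tendsto_intros)
      fix v
      have "(\<lambda>n. t + e n * v) \<longlonglongrightarrow> t"
        using tendsto_add[OF tendsto_const tendsto_mult_left_zero[OF e_lim], of t v] by simp
      moreover have "isCont \<phi> t"
        using smooth_fun_continuous[OF test_fun_smooth[OF \<phi>], of UNIV] continuous_on_eq_continuous_at by blast
      ultimately show "(\<lambda>n. \<phi> (t + e n * v)) \<longlonglongrightarrow> \<phi> t"
        using isCont_tendsto_compose by blast
    qed
    show "AE v in lborel. norm (\<phi> (t + e n * v) * exp (- of_real (v\<^sup>2 / 2))) \<le> B * norm (of_real (sqrt (2 * pi)) * N v)" for n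
      unfolding G_eq norm_mult using B by (intro AE_I2 mult_right_mono mult_mono) auto
  qed measurable
  moreover have "(LINT v|lborel. \<phi> t * exp (- of_real (v\<^sup>2 / 2))) = \<phi> t * of_real (sqrt (2 * pi))"
  proof -
    have "(LINT v|lborel. N v) = 1"
      using fourier_std_normal[of 0] by (simp add: N_def)
    then show ?thesis
      unfolding G_eq integral_mult_right_zero by simp
  qed
  ultimately have "(LINT x|lborel. exp (\<i> * of_real (t * x)) * N 0 * fourier \<phi> x) = \<phi> t * of_real (sqrt (2 * pi))"
    using LIMSEQ_unique[OF lim1] by simp
  moreover have "(LINT x|lborel. exp (\<i> * of_real (t * x)) * N 0 * fourier \<phi> x) =
      N 0 * (LINT x|lborel. exp (\<i> * of_real (t * x)) * fourier \<phi> x)"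
    by (simp add: mult.assoc mult.left_commute[of _ "N 0"])
  moreover have "N 0 = 1 / of_real (sqrt (2 * pi))"
    by (simp add: N_def std_normal_density_def)
  \<comment> \<open>\<open>N 0\<close> contributes a factor 1/sqrt(2 pi) and the mass of the
    unnormalised Gaussian a factor sqrt(2 pi); together they account for the 2 pi in
    \<open>inv_fourier\<close>.\<close>
  moreover have "of_real (sqrt (2 * pi)) * of_real (sqrt (2 * pi)) = complex_of_real (2 * pi)"
    unfolding of_real_mult[symmetric] by simp
  ultimately show ?thesis
    unfolding inv_fourier_def by (simp add: field_simps)
qed

section \<open>Convolution of test functions and a nonnegative kernel\<close>

definition conv :: "real \<Rightarrow> (real \<Rightarrow> complex) \<Rightarrow> (real \<Rightarrow> complex) \<Rightarrow> real \<Rightarrow> complex" where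
  "conv l \<psi> \<eta> t = integral (cbox (- l) l) (\<lambda>u. \<psi> u * \<eta> (t - u))"

text \<open>All derivatives fall on \<open>\<eta>\<close>, so continuity of \<open>\<psi>\<close>
  suffices; the integral in \<open>conv\<close> runs over a fixed compact interval so that Leibniz's
  rule applies.\<close>

lemma smooth_fun_conv:
  assumes \<psi>: "continuous_on UNIV \<psi>" and \<eta>: "smooth_fun \<eta>"
  shows "smooth_fun (conv l \<psi> \<eta>)"
proof (rule smooth_fun_coinduct[where S = "conv l \<psi> ` Collect smooth_fun"])
  fix g assume "g \<in> conv l \<psi> ` Collect smooth_fun"
  then obtain f where f: "smooth_fun f" "g = conv l \<psi> f" by blast
  obtain f' where f': "smooth_fun f'" "\<And>x. (f has_vector_derivative f' x) (at x)"
    using smooth_funE[OF f(1)] by blast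
  have c: "continuous_on UNIV f" "continuous_on UNIV f'"
    using f f' smooth_fun_continuous by blast+
  have "(g has_vector_derivative integral (cbox (- l) l) (\<lambda>u. \<psi> u * f' (t - u))) (at t within UNIV)" for t
    unfolding f(2) conv_def
  proof (rule leibniz_rule_vector_derivative)
    fix x u :: real
    have "((\<lambda>x. x - u) has_vector_derivative 1) (at x)"
      by (auto intro!: derivative_eq_intros)
    from vector_diff_chain_at[OF this f'(2)]
    have "((\<lambda>x. f (x - u)) has_vector_derivative f' (x - u)) (at x)"
      by (simp add: o_def)
    then show "((\<lambda>x. \<psi> u * f (x - u)) has_vector_derivative \<psi> u * f' (x - u)) (at x within UNIV)"
      by (rule has_vector_derivative_mult_right)
  next
    fix x :: real
    show "(\<lambda>u. \<psi> u * f (x - u)) integrable_on cbox (- l) l"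
      by (intro integrable_continuous continuous_intros continuous_on_subset[OF \<psi>]
          continuous_on_compose2[OF c(1)]) auto
    show "continuous_on (UNIV \<times> cbox (- l) l) (\<lambda>(x, u). \<psi> u * f' (x - u))"
      unfolding split_def
      by (intro continuous_intros continuous_on_compose2[OF \<psi>] continuous_on_compose2[OF c(2)]) auto
  qed auto
  then show "\<exists>g'\<in>conv l \<psi> ` Collect smooth_fun. \<forall>x. (g has_vector_derivative g' x) (at x)"
    using f' by (intro bexI[where x = "conv l \<psi> f'"]) (auto simp: conv_def)
qed (use \<eta> in blast)

lemma fourier_conv:
  assumes \<psi>: "continuous_on UNIV \<psi>" "\<And>x. x \<notin> {-l..l} \<Longrightarrow> \<psi> x = 0"
    and \<eta>: "continuous_on UNIV \<eta>" "\<And>x. x \<notin> {-l..l} \<Longrightarrow> \<eta> x = 0"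
  shows "fourier (conv l \<psi> \<eta>) x = fourier \<psi> x * fourier \<eta> x"
    and "t \<notin> {-(2*l)..2*l} \<Longrightarrow> conv l \<psi> \<eta> t = 0"
proof -
  have conv_eq: "conv l \<psi> \<eta> t = (LINT u|lborel. \<psi> u * \<eta> (t - u))" for t
  proof -
    have c: "continuous_on {-l..l} (\<lambda>u. \<psi> u * \<eta> (t - u))"
      by (intro continuous_intros continuous_on_compose2[OF \<psi>(1)] continuous_on_compose2[OF \<eta>(1)]) auto
    have "conv l \<psi> \<eta> t = (LINT u:{-l..l}|lborel. \<psi> u * \<eta> (t - u))"
      unfolding conv_def cbox_interval
      by (rule set_borel_integral_eq_integral(2)[symmetric, OF borel_integrable_atLeastAtMost'[OF c]])
    also have "\<dots> = (LINT u|lborel. \<psi> u * \<eta> (t - u))"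
      unfolding set_lebesgue_integral_def
      by (rule Bochner_Integration.integral_cong) (use \<psi>(2) in \<open>auto simp: indicator_def\<close>)
    finally show ?thesis .
  qed
  have prod0: "\<psi> u * \<eta> (t - u) = 0" if "t \<notin> {-(2*l)..2*l}" for t u
    using \<psi>(2)[of u] \<eta>(2)[of "t - u"] that by (cases "u \<in> {-l..l}") auto
  show "conv l \<psi> \<eta> t = 0" if "t \<notin> {-(2*l)..2*l}"
    unfolding conv_eq prod0[OF that] by simp
  \<comment> \<open>The indicator of an interval that carries the convolution. As an integrable
    outer factor it makes \<open>fubini_bounded_kernel\<close> applicable with the bounded kernel
    \<open>\<eta> (t - u) * exp (- \<i> * of_real (x * t))\<close>.\<close>
  define b :: "real \<Rightarrow> complex" where "b = indicator {-(2*l)..2*l}"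
  have b_int: "integrable lborel b"
  proof -
    have "integrable lborel (\<lambda>x. complex_of_real (indicator {-(2*l)..2*l} x))"
      unfolding complex_of_real_integrable_eq by (simp add: emeasure_lborel_Icc_eq)
    moreover have "(\<lambda>x. complex_of_real (indicator {-(2*l)..2*l} x)) = b"
      by (auto simp: b_def indicator_def)
    ultimately show ?thesis by simp
  qed
  have \<psi>_int: "integrable lborel \<psi>"
    using integrable_compact_support[OF \<psi>] .
  have "bounded (\<eta> ` {-l..l})"
    by (intro compact_imp_bounded compact_continuous_image continuous_on_subset[OF \<eta>(1)]) auto
  then obtain B where B: "B > 0" "\<forall>y\<in>\<eta> ` {-l..l}. norm y \<le> B"
    unfolding bounded_pos by blast
  then have B': "norm (\<eta> x) \<le> B" for x
    using \<eta>(2)[of x] by (cases "x \<in> {-l..l}") (auto simp del: atLeastAtMost_iff)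
  have [measurable]: "\<eta> \<in> borel_measurable borel"
    using borel_measurable_continuous_onI[OF \<eta>(1)] .
  have "fourier (conv l \<psi> \<eta>) x = (LINT t|lborel. b t * (LINT u|lborel. \<psi> u * (\<eta> (t - u) * exp (- \<i> * of_real (x * t)))))"
    unfolding fourier_def conv_eq
  proof (intro Bochner_Integration.integral_cong refl)
    fix t
    have "(LINT u|lborel. \<psi> u * (\<eta> (t - u) * exp (- \<i> * of_real (x * t)))) =
        (LINT u|lborel. (\<psi> u * \<eta> (t - u)) * exp (- \<i> * of_real (x * t)))"
      by (simp add: mult.assoc)
    also have "\<dots> = (LINT u|lborel. \<psi> u * \<eta> (t - u)) * exp (- \<i> * of_real (x * t))"
      by (rule integral_mult_left_zero)
    finally show "exp (- \<i> * of_real (x * t)) * (LINT u|lborel. \<psi> u * \<eta> (t - u)) =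
      b t * (LINT u|lborel. \<psi> u * (\<eta> (t - u) * exp (- \<i> * of_real (x * t))))"
    proof (cases "t \<in> {-(2*l)..2*l}")
      case False
      then have "(\<lambda>u. \<psi> u * \<eta> (t - u)) = (\<lambda>u. 0)"
        using prod0 by (intro ext) blast
      then show ?thesis
        using False by (simp add: b_def del: atLeastAtMost_iff)
    qed (simp add: b_def del: atLeastAtMost_iff)
  qed
  also have "\<dots> = (LINT u|lborel. \<psi> u * (LINT t|lborel. b t * (\<eta> (t - u) * exp (- \<i> * of_real (x * t)))))"
    by (rule fubini_bounded_kernel[OF b_int \<psi>_int, where B = B]) (use B' in \<open>auto simp: norm_mult\<close>)
  also have "\<dots> = (LINT u|lborel. (exp (- \<i> * of_real (x * u)) * \<psi> u) * fourier \<eta> x)"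
  proof (intro Bochner_Integration.integral_cong refl)
    fix u
    have "\<psi> u * (LINT t|lborel. b t * (\<eta> (t - u) * exp (- \<i> * of_real (x * t)))) =
      (LINT t|lborel. \<psi> u * (b t * (\<eta> (t - u) * exp (- \<i> * of_real (x * t)))))"
      by (rule integral_mult_right_zero[symmetric])
    also have "\<dots> = (LINT t|lborel. \<psi> u * (\<eta> (t - u) * exp (- \<i> * of_real (x * t))))"
    proof (intro Bochner_Integration.integral_cong refl)
      fix t show "\<psi> u * (b t * (\<eta> (t - u) * exp (- \<i> * of_real (x * t)))) = \<psi> u * (\<eta> (t - u) * exp (- \<i> * of_real (x * t)))"
        using prod0[of t u] by (cases "t \<in> {-(2*l)..2*l}") (auto simp add: b_def simp del: atLeastAtMost_iff)
    qed
    also have "\<dots> = \<psi> u * (LINT t|lborel. \<eta> (t - u) * exp (- \<i> * of_real (x * t)))"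
      by (rule integral_mult_right_zero)
    also have "(LINT t|lborel. \<eta> (t - u) * exp (- \<i> * of_real (x * t))) =
        (LINT t|lborel. \<eta> t * exp (- \<i> * of_real (x * (u + t))))"
      using lborel_integral_real_affine[of 1 "\<lambda>t. \<eta> (t - u) * exp (- \<i> * of_real (x * t))" u] by simp
    also have "\<dots> = (LINT t|lborel. exp (- \<i> * of_real (x * u)) * (exp (- \<i> * of_real (x * t)) * \<eta> t))"
      by (intro Bochner_Integration.integral_cong refl)
         (simp add: distrib_left distrib_right exp_add[symmetric] exp_diff exp_minus field_simps)
    also have "\<dots> = exp (- \<i> * of_real (x * u)) * fourier \<eta> x"
      unfolding fourier_def by (rule integral_mult_right_zero)
    finally show "\<psi> u * (LINT t|lborel. b t * (\<eta> (t - u) * exp (- \<i> * of_real (x * t)))) =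
      (exp (- \<i> * of_real (x * u)) * \<psi> u) * fourier \<eta> x"
      by (simp add: mult_ac)
  qed
  also have "\<dots> = fourier \<psi> x * fourier \<eta> x"
    unfolding fourier_def[of \<psi>] by (rule integral_mult_left_zero)
  finally show "fourier (conv l \<psi> \<eta>) x = fourier \<psi> x * fourier \<eta> x" .
qed

text \<open>The self-convolution of an even bump has the square of a real function as Fourier transform.\<close>

lemma ex_positive_kernel:
  fixes l :: real
  assumes "l > 0"
  obtains \<phi> K D c r where "test_fun {-l<..<l} \<phi>" "\<And>x. fourier \<phi> x = of_real (K x)" "\<And>x. K x \<ge> 0"
    "continuous_on UNIV K" "\<And>x. K x \<le> D / (1 + x\<^sup>2)\<^sup>2" "D > 0" "c > 0" "r > 0" "r \<le> 1"
    "\<And>x. \<bar>x\<bar> \<le> r \<Longrightarrow> c \<le> K x"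
proof -
  \<comment> \<open>Convolution doubles the support; \<open>2 * m < l\<close> keeps the doubled
    interval inside the open one.\<close>
  define m where "m = l / 3"
  have m: "m > 0" "2 * m < l" using assms by (auto simp: m_def)
  obtain \<psi>0 :: "real \<Rightarrow> real" where \<psi>0: "smooth_fun (\<lambda>x. of_real (\<psi>0 x))" "\<And>x. \<psi>0 x \<ge> 0"
    "\<And>x. \<psi>0 (- x) = \<psi>0 x" "\<And>x. x \<in> {-m<..<m} \<Longrightarrow> \<psi>0 x > 0" "\<And>x. x \<notin> {-m..m} \<Longrightarrow> \<psi>0 x = 0"
    using ex_bump[OF m(1)] by blast
  define \<psi> where "\<psi> = (\<lambda>x. complex_of_real (\<psi>0 x))"
  have \<psi>: "smooth_fun \<psi>" "\<And>x. x \<notin> {-m..m} \<Longrightarrow> \<psi> x = 0"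
    using \<psi>0 by (auto simp: \<psi>_def)
  have test: "test_fun UNIV \<psi>"
    by (rule test_funI[OF \<psi>]) auto
  have \<psi>_cont: "continuous_on UNIV \<psi>"
    using smooth_fun_continuous[OF \<psi>(1)] .
  define \<phi> where "\<phi> = conv m \<psi> \<psi>"
  define k where "k = (\<lambda>x. Re (fourier \<psi> x))"
  \<comment> \<open>Conjugation reverses the sign of the frequency; since the bump is real and even,
    the substitution of \<open>- t\<close> restores it, so the transform is real.\<close>
  have k: "fourier \<psi> x = of_real (k x)" for x
  proof -
    have "cnj (fourier \<psi> x) = (LINT t|lborel. cnj (exp (- \<i> * of_real (x * t)) * \<psi> t))"
      unfolding fourier_def by (subst Bochner_Integration.integral_cnj) simp
    also have "\<dots> = (LINT t|lborel. exp (- \<i> * of_real (x * - t)) * \<psi> (- t))"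
      by (intro Bochner_Integration.integral_cong refl) (simp add: \<psi>_def \<psi>0(3) exp_cnj)
    also have "\<dots> = fourier \<psi> x"
      unfolding fourier_def by (rule lborel_integral_reflect)
    finally show ?thesis
      by (simp add: k_def complex_eq_iff)
  qed
  obtain D where D: "D > 0" "\<And>x. norm (fourier \<psi> x) \<le> D / (1 + x\<^sup>2)"
    using fourier_test_fun_decay[OF test] by blast
  have k_cont: "continuous_on UNIV k"
    unfolding k_def by (intro continuous_intros continuous_fourier test_fun_integrable[OF test])
  have "k 0 > 0"
  proof -
    have int: "integrable lborel \<psi>0"
      using test_fun_integrable[OF test] unfolding \<psi>_def complex_of_real_integrable_eq .
    have "(LINT x|lborel. \<psi>0 x) > 0"
    proof (rule ccontr)
      assume "\<not> ?thesis"
      then have "(LINT x|lborel. \<psi>0 x) = 0"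
        using Bochner_Integration.integral_nonneg[of lborel \<psi>0, OF \<psi>0(2)] by linarith
      then have "AE x in lborel. \<psi>0 x = 0"
        using integral_nonneg_eq_0_iff_AE[OF int] \<psi>0(2) by simp
      then have "AE x in lborel. x \<notin> {-m<..<m}"
        by eventually_elim (use \<psi>0(4) in force)
      then have "emeasure lborel {-m<..<m} = 0"
        by (subst (asm) AE_iff_measurable[of "{-m<..<m}"]) auto
      then show False using m(1) by simp
    qed
    moreover have "fourier \<psi> 0 = of_real (LINT x|lborel. \<psi>0 x)"
      unfolding fourier_def \<psi>_def by (simp add: integral_complex_of_real)
    ultimately show ?thesis by (simp add: k_def)
  qed
  have "isCont k 0"
    using k_cont continuous_on_eq_continuous_at by blast
  with \<open>k 0 > 0\<close> obtain d where d: "d > 0" "\<And>x. \<bar>x\<bar> < d \<Longrightarrow> \<bar>k x - k 0\<bar> < k 0 / 2"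
    unfolding continuous_at_eps_delta by (metis dist_real_def diff_zero half_gt_zero)
  \<comment> \<open>Halving \<open>d\<close> gives the strict inequality \<open>r < d\<close>; the
    bound 1 keeps the windows \<open>[h, h + r]\<close> no longer than the unit step of the growth
    estimate.\<close>
  define r where "r = min 1 (d / 2)"
  have r: "r > 0" "r \<le> 1" "r < d" using d(1) by (auto simp: r_def)
  show ?thesis
  proof (rule that)
    show "test_fun {-l<..<l} \<phi>"
    proof (rule test_funI)
      show "smooth_fun \<phi>" unfolding \<phi>_def by (rule smooth_fun_conv[OF \<psi>_cont \<psi>(1)])
      show "\<phi> x = 0" if "x \<notin> {-(2*m)..2*m}" for x
        unfolding \<phi>_def by (rule fourier_conv(2)[OF \<psi>_cont \<psi>(2) \<psi>_cont \<psi>(2) that])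
      show "{-(2*m)..2*m} \<subseteq> {-l<..<l}" using m by auto
    qed
    show "fourier \<phi> x = of_real ((k x)\<^sup>2)" for x
      unfolding \<phi>_def by (subst fourier_conv(1)[OF \<psi>_cont \<psi>(2) \<psi>_cont \<psi>(2)])
        (simp_all add: k power2_eq_square del: atLeastAtMost_iff)
    show "(k x)\<^sup>2 \<le> D\<^sup>2 / (1 + x\<^sup>2)\<^sup>2" for x
    proof -
      have "\<bar>k x\<bar> \<le> D / (1 + x\<^sup>2)"
        using D(2)[of x] by (simp add: k)
      then have "\<bar>k x\<bar>\<^sup>2 \<le> (D / (1 + x\<^sup>2))\<^sup>2"
        by (intro power_mono) auto
      then show ?thesis by (simp add: power_divide)
    qed
    show "(k 0 / 2)\<^sup>2 \<le> (k x)\<^sup>2" if "\<bar>x\<bar> \<le> r" for x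
    proof (rule power_mono)
      have "\<bar>k x - k 0\<bar> < k 0 / 2"
        using d(2)[of x] that r(3) by simp
      then show "k 0 / 2 \<le> k x" by arith
    qed (use \<open>k 0 > 0\<close> in simp)
    show "continuous_on UNIV (\<lambda>x. (k x)\<^sup>2)"
      by (intro continuous_intros k_cont)
  qed (use D(1) r \<open>k 0 > 0\<close> in auto)
qed

section \<open>A Tauberian theorem for averages against a positive kernel\<close>

text \<open>Fourth-order decay gives a finite second moment and a tail bound uniform in
  translations; nonnegativity and the lower bound \<open>c\<close> on \<open>[-r, r]\<close> let an
  average against \<open>K\<close> dominate an integral over a short window. The link of
  \<open>K\<close> with a test function appears as a hypothesis only where boundary values are
  used.\<close>

locale decaying_kernel =
  fixes K :: "real \<Rightarrow> real" and D c r :: real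
  assumes K_cont: "continuous_on UNIV K"
    and K_nonneg: "\<And>x. 0 \<le> K x"
    and K_decay: "\<And>x. K x \<le> D / (1 + x\<^sup>2)\<^sup>2"
    and D_pos: "0 < D" and c_pos: "0 < c" and r_pos: "0 < r" and r_le: "r \<le> 1"
    and K_ge: "\<And>x. \<bar>x\<bar> \<le> r \<Longrightarrow> c \<le> K x"
begin

lemma K_measurable [measurable]: "K \<in> borel_measurable borel"
  by (rule borel_measurable_continuous_onI[OF K_cont])

lemma K_le_D: "K x \<le> D"
proof -
  have "0 < 1 + x\<^sup>2" by (simp add: add_pos_nonneg)
  then have "D / (1 + x\<^sup>2)\<^sup>2 \<le> D / 1"
    using D_pos by (intro divide_left_mono) (auto simp: one_le_power)
  then show ?thesis using K_decay[of x] by simp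
qed

lemma integrable_smoothed:
  fixes u :: "real \<Rightarrow> real"
  assumes [measurable]: "u \<in> borel_measurable borel"
    and int: "integrable lborel (\<lambda>x. u x * exp (- s * x))"
  shows "integrable lborel (\<lambda>x. u x * (exp (- s * (x - h)) * K (x - h)))"
proof (rule Bochner_Integration.integrable_bound)
  show "integrable lborel (\<lambda>x. (D * exp (s * h)) * (u x * exp (- s * x)))"
    using int by (intro integrable_mult_right)
  have "\<bar>u x\<bar> * (exp (- s * (x - h)) * K (x - h)) \<le> \<bar>u x\<bar> * (exp (- s * (x - h)) * D)" for x
    using K_le_D by (intro mult_left_mono) auto
  moreover have "\<bar>u x\<bar> * (exp (- s * (x - h)) * D) = (D * exp (s * h)) * (\<bar>u x\<bar> * exp (- s * x))" for x
    by (simp add: exp_add[symmetric] algebra_simps)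
  ultimately have "\<bar>u x\<bar> * (exp (- s * (x - h)) * K (x - h)) \<le> (D * exp (s * h)) * (\<bar>u x\<bar> * exp (- s * x))" for x
    by (simp only:)
  then show "AE x in lborel. norm (u x * (exp (- s * (x - h)) * K (x - h)))
      \<le> norm ((D * exp (s * h)) * (u x * exp (- s * x)))"
    using K_nonneg D_pos by (intro AE_I2) (simp add: abs_mult)
qed measurable

text \<open>For \<open>x \<ge> 0\<close> and \<open>\<sigma> n \<le> 1\<close> the damping factor is
  at most \<open>exp h\<close>, a constant because \<open>h\<close> stays fixed; this dominates the
  integrands.\<close>

lemma smoothed_limit:
  fixes u :: "real \<Rightarrow> real"
  assumes [measurable]: "u \<in> borel_measurable borel" and u0: "\<And>x. x < 0 \<Longrightarrow> u x = 0"
    and int: "integrable lborel (\<lambda>x. u x * K (x - h))" and h: "0 \<le> h"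
    and \<sigma>: "\<And>n. 0 < \<sigma> n" "\<And>n. \<sigma> n \<le> 1" "\<sigma> \<longlonglongrightarrow> 0"
  shows "(\<lambda>n. LINT x|lborel. u x * (exp (- \<sigma> n * (x - h)) * K (x - h))) \<longlonglongrightarrow> (LINT x|lborel. u x * K (x - h))"
proof (rule integral_dominated_convergence[where w = "\<lambda>x. exp h * \<bar>u x * K (x - h)\<bar>"])
  show "integrable lborel (\<lambda>x. exp h * \<bar>u x * K (x - h)\<bar>)"
    using int by (intro integrable_mult_right integrable_abs)
  show "AE x in lborel. (\<lambda>n. u x * (exp (- \<sigma> n * (x - h)) * K (x - h))) \<longlonglongrightarrow> u x * K (x - h)"
  proof (intro AE_I2)
    fix x
    have "(\<lambda>n. u x * (exp (- \<sigma> n * (x - h)) * K (x - h))) \<longlonglongrightarrow> u x * (exp (- 0 * (x - h)) * K (x - h))"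
      by (intro tendsto_intros \<sigma>(3))
    then show "(\<lambda>n. u x * (exp (- \<sigma> n * (x - h)) * K (x - h))) \<longlonglongrightarrow> u x * K (x - h)" by simp
  qed
  fix n
  show "AE x in lborel. norm (u x * (exp (- \<sigma> n * (x - h)) * K (x - h))) \<le> exp h * \<bar>u x * K (x - h)\<bar>"
  proof (intro AE_I2)
    fix x
    show "norm (u x * (exp (- \<sigma> n * (x - h)) * K (x - h))) \<le> exp h * \<bar>u x * K (x - h)\<bar>"
    proof (cases "x < 0")
      case False
      have "0 \<le> \<sigma> n * x" using False \<sigma>(1)[of n] by simp
      moreover have "\<sigma> n * h \<le> 1 * h" using h \<sigma>(2) by (intro mult_right_mono)
      ultimately have "- \<sigma> n * (x - h) \<le> h" by (simp add: algebra_simps)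
      then have "exp (- \<sigma> n * (x - h)) \<le> exp h" by (subst exp_le_cancel_iff)
      then show ?thesis
        using mult_right_mono[of "exp (- \<sigma> n * (x - h))" "exp h" "\<bar>u x * K (x - h)\<bar>"]
        by (simp add: abs_mult mult_ac)
    qed (use u0 in simp)
  qed
qed measurable

lemma moment_integrable: "integrable lborel (\<lambda>v. (1 + v\<^sup>2) * K v)"
proof (rule Bochner_Integration.integrable_bound)
  show "integrable lborel (\<lambda>v. D * (1 / (1 + v\<^sup>2)))"
    by (intro integrable_mult_right integrable_inverse_1_plus_square)
  have "(1 + v\<^sup>2) * K v \<le> D * (1 / (1 + v\<^sup>2))" for v
  proof -
    have p: "0 < 1 + v\<^sup>2" by (simp add: add_pos_nonneg)
    have "(1 + v\<^sup>2) * K v \<le> (1 + v\<^sup>2) * (D / (1 + v\<^sup>2)\<^sup>2)"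
      using p by (intro mult_left_mono K_decay) simp
    also have "\<dots> = D * (1 / (1 + v\<^sup>2))"
      using p by (simp add: power2_eq_square)
    finally show ?thesis .
  qed
  moreover have "0 \<le> (1 + v\<^sup>2) * K v" for v
    using K_nonneg by simp
  ultimately show "AE v in lborel. norm ((1 + v\<^sup>2) * K v) \<le> norm (D * (1 / (1 + v\<^sup>2)))"
    by (intro AE_I2) (metis abs_le_iff abs_of_nonneg order_trans real_norm_def)
qed measurable

lemma integrable_growth:
  fixes u :: "real \<Rightarrow> real"
  assumes [measurable]: "u \<in> borel_measurable borel"
    and A: "\<And>x. \<bar>u x\<bar> \<le> A * (1 + \<bar>x\<bar>)"
  shows "integrable lborel (\<lambda>v. u (h + v) * K v)"
proof (rule Bochner_Integration.integrable_bound)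
  show "integrable lborel (\<lambda>v. (A * (1 + \<bar>h\<bar>) * 2) * ((1 + v\<^sup>2) * K v))"
    by (intro integrable_mult_right moment_integrable)
  have A0: "0 \<le> A" using A[of 0] by simp
  have "\<bar>u (h + v)\<bar> \<le> (A * (1 + \<bar>h\<bar>) * 2) * (1 + v\<^sup>2)" for v
  proof -
    have "1 + \<bar>h + v\<bar> \<le> (1 + \<bar>h\<bar>) * (1 + \<bar>v\<bar>)"
    proof -
      have "(1 + \<bar>h\<bar>) * (1 + \<bar>v\<bar>) = 1 + \<bar>h\<bar> + \<bar>v\<bar> + \<bar>h\<bar> * \<bar>v\<bar>" by (simp add: algebra_simps)
      moreover have "0 \<le> \<bar>h\<bar> * \<bar>v\<bar>" by simp
      ultimately show ?thesis using abs_triangle_ineq[of h v] by linarith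
    qed
    also have "\<dots> \<le> (1 + \<bar>h\<bar>) * (2 * (1 + v\<^sup>2))"
    proof (rule mult_left_mono)
      have "0 \<le> \<bar>v\<bar>\<^sup>2 - 2 * \<bar>v\<bar> + 1"
        using zero_le_power2[of "\<bar>v\<bar> - 1"] by (simp add: power2_diff)
      then show "1 + \<bar>v\<bar> \<le> 2 * (1 + v\<^sup>2)"
        using zero_le_power2[of v] unfolding power2_abs by (smt (verit))
    qed simp
    finally have "A * (1 + \<bar>h + v\<bar>) \<le> A * ((1 + \<bar>h\<bar>) * (2 * (1 + v\<^sup>2)))"
      using A0 by (rule mult_left_mono)
    then show ?thesis
    proof -
      have "A * ((1 + \<bar>h\<bar>) * (2 * (1 + v\<^sup>2))) = (A * (1 + \<bar>h\<bar>) * 2) * (1 + v\<^sup>2)"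
        by (simp only: mult.assoc)
      then show ?thesis
        using order_trans[OF A[of "h + v"] \<open>A * (1 + \<bar>h + v\<bar>) \<le> A * ((1 + \<bar>h\<bar>) * (2 * (1 + v\<^sup>2)))\<close>]
        by (simp only:)
    qed
  qed
  then show "AE v in lborel. norm (u (h + v) * K v) \<le> norm ((A * (1 + \<bar>h\<bar>) * 2) * ((1 + v\<^sup>2) * K v))"
    using A0 K_nonneg
    by (intro AE_I2) (simp add: abs_mult mult.assoc[symmetric] mult_right_mono)
qed measurable

lemma K_integrable: "integrable lborel K"
  using integrable_growth[of "\<lambda>x. 1" 1 0] by simp

lemma K_integral_pos: "0 < (LINT v|lborel. K v)"
proof -
  have "(LINT v|lborel. c * indicator {0..r} v) \<le> (LINT v|lborel. K v)"
  proof (intro integral_mono K_integrable integrable_mult_right)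
    show "c * indicator {0..r} v \<le> K v" for v
      using K_ge[of v] K_nonneg[of v] by (auto simp: indicator_def)
  qed (auto simp: emeasure_lborel_Icc_eq)
  moreover have "(LINT v|lborel. c * indicator {0..r} v) = c * r"
    using r_pos by simp
  ultimately show ?thesis
    using c_pos r_pos by (metis less_le_trans mult_pos_pos)
qed

text \<open>Taking the supremum of \<open>\<bar>u x\<bar> / (1 + \<epsilon> \<bar>x\<bar>)\<close> localises the problem at a near-maximal
  point \<open>h\<close>, and letting \<open>\<epsilon>\<close> tend to 0 removes the weight. By the one-sided condition the size
  \<open>a\<close> at \<open>h\<close> persists on an interval of length comparable to \<open>a\<close>, whose midpoint is where the
  average is taken.\<close>

lemma bounded_of_bounded_average:
  fixes u :: "real \<Rightarrow> real"
  assumes u_meas [measurable]: "u \<in> borel_measurable borel"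
    and u0: "\<And>x. x < X \<Longrightarrow> u x = 0" and X: "0 \<le> X" and C: "1 \<le> C"
    and slow: "\<And>x y. X \<le> x \<Longrightarrow> x \<le> y \<Longrightarrow> - C * (y - x + 1) \<le> u y - u x"
    and A: "\<And>x. \<bar>u x\<bar> \<le> A * (1 + \<bar>x\<bar>)"
    and M: "\<And>h. 0 \<le> h \<Longrightarrow> \<bar>LINT v|lborel. u (h + v) * K v\<bar> \<le> M"
  shows "\<exists>B. \<forall>x. \<bar>u x\<bar> \<le> B"
proof -
  define \<kappa> where "\<kappa> = (LINT v|lborel. K v)"
  define m where "m = (LINT v|lborel. (1 + v\<^sup>2) * K v)"
  have \<kappa>: "0 < \<kappa>" unfolding \<kappa>_def by (rule K_integral_pos)
  \<comment> \<open>The solution \<open>a\<close> of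
    \<open>a / 4 * \<kappa> - 25 * C * m = M\<close>: a profile above
    \<open>a / 4 - 25 * C * (1 + v\<^sup>2)\<close> with average at most \<open>M\<close> has
    \<open>a \<le> A1\<close>.\<close>
  define A1 where "A1 = 4 * (M + 25 * C * m) / \<kappa>"
  \<comment> \<open>A value below \<open>- A0\<close> can only occur far to the right of
    \<open>X\<close>, by the second bound; the interval to its left then stays in the range of the
    one-sided condition.\<close>
  define A0 where "A0 = max A1 (2 * \<bar>u X\<bar> + 2 * C)"
  have A0_pos: "0 < A0" using C abs_ge_zero[of "u X"] unfolding A0_def less_max_iff_disj by linarith
  have average: "a \<le> A1"
    if h: "0 \<le> h'" and s: "s = 1 \<or> s = -1"
      and le: "\<And>v. a / 4 - 25 * C * (1 + v\<^sup>2) \<le> s * u (h' + v)" for a h' s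
  proof -
    have "(LINT v|lborel. a / 4 * K v - 25 * C * ((1 + v\<^sup>2) * K v)) \<le> (LINT v|lborel. s * (u (h' + v) * K v))"
    proof (intro integral_mono Bochner_Integration.integrable_diff integrable_mult_right
        K_integrable moment_integrable integrable_growth[OF u_meas A])
      fix v
      show "a / 4 * K v - 25 * C * ((1 + v\<^sup>2) * K v) \<le> s * (u (h' + v) * K v)"
        using mult_right_mono[OF le[of v] K_nonneg[of v]] by (simp add: algebra_simps)
    qed
    also have "\<dots> = s * (LINT v|lborel. u (h' + v) * K v)" by simp
    also have "\<dots> \<le> M" using M[OF h] s by auto
    also have "(LINT v|lborel. a / 4 * K v - 25 * C * ((1 + v\<^sup>2) * K v)) = a / 4 * \<kappa> - 25 * C * m"
      unfolding \<kappa>_def m_def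
      by (subst Bochner_Integration.integral_diff) (auto intro!: K_integrable moment_integrable)
    finally have "a * \<kappa> \<le> 4 * (M + 25 * C * m)" by (simp add: algebra_simps)
    then show ?thesis unfolding A1_def using \<kappa> by (simp add: pos_le_divide_eq)
  qed
  have near_max: "\<bar>u h\<bar> \<le> A0"
    if h: "X \<le> h" and pos: "u h \<noteq> 0" and near: "\<And>y. \<bar>u y\<bar> \<le> 2 * \<bar>u h\<bar> * (1 + \<bar>y - h\<bar>)" for h
  proof (rule ccontr)
    assume "\<not> \<bar>u h\<bar> \<le> A0"
    define a where "a = \<bar>u h\<bar>"
    have a: "A0 < a" "0 < a" using \<open>\<not> \<bar>u h\<bar> \<le> A0\<close> pos by (auto simp: a_def)
    \<comment> \<open>Over a distance \<open>2 * R\<close> the one-sided condition loses at most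
      \<open>C * (2 * R + 1) = a / 2 + C\<close>, so a value of size \<open>a\<close> stays at least
      \<open>a / 2 - C\<close>.\<close>
    define R where "R = a / (4 * C)"
    have R: "0 < R" "a = 4 * C * R" using a C by (auto simp: R_def)
    \<comment> \<open>Beyond \<open>R\<close> the sign is lost, but
      \<open>a < 4 * C * \<bar>v\<bar>\<close> makes the growth bound quadratic: the growth
      contributes \<open>8 * \<bar>v\<bar> + 16 * v\<^sup>2\<close> and \<open>a / 4\<close>
      contributes \<open>\<bar>v\<bar>\<close>, all times \<open>C\<close>, and the sum stays below
      \<open>25 * C * (1 + v\<^sup>2)\<close>.\<close>
    have far: "a / 4 - 25 * C * (1 + v\<^sup>2) \<le> - \<bar>u y\<bar>" if "R < \<bar>v\<bar>" "\<bar>y - h\<bar> \<le> R + \<bar>v\<bar>" for v y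
    proof -
      have "\<bar>u y\<bar> \<le> 2 * a * (1 + \<bar>y - h\<bar>)" using near by (simp add: a_def)
      also have "\<dots> \<le> 2 * a * (1 + 2 * \<bar>v\<bar>)" using that a by (intro mult_left_mono) auto
      also have "\<dots> \<le> 8 * C * \<bar>v\<bar> * (1 + 2 * \<bar>v\<bar>)"
        using that C unfolding R(2) by (intro mult_right_mono) auto
      finally have 1: "\<bar>u y\<bar> \<le> C * (8 * \<bar>v\<bar> + 16 * v\<^sup>2)"
        by (simp add: algebra_simps power2_eq_square)
      have 2: "a / 4 \<le> C * \<bar>v\<bar>" using that C unfolding R(2) by simp
      have "C * (9 * \<bar>v\<bar> + 16 * v\<^sup>2) \<le> C * (25 * (1 + v\<^sup>2))"
      proof (rule mult_left_mono)
        have "0 \<le> \<bar>v\<bar>\<^sup>2 - 2 * \<bar>v\<bar> + 1"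
          using zero_le_power2[of "\<bar>v\<bar> - 1"] by (simp add: power2_diff)
        then show "9 * \<bar>v\<bar> + 16 * v\<^sup>2 \<le> 25 * (1 + v\<^sup>2)"
          using zero_le_power2[of v] by (simp add: field_simps)
      qed (use C in simp)
      with 1 2 show ?thesis by (simp add: algebra_simps)
    qed
    have mid: "a / 4 - 25 * C * (1 + v\<^sup>2) \<le> w" if "a / 2 - C \<le> w" for v w
    proof -
      have "C * 1 \<le> C * (25 * (1 + v\<^sup>2))" using C by (intro mult_left_mono) auto
      then show ?thesis using that a(2) by (simp add: algebra_simps)
    qed
    show False
    \<comment> \<open>A positive value persists to the right, so the average is centred at
      \<open>h + R\<close>; a negative one persists to the left and is centred at
      \<open>h - R\<close>.\<close>
    proof (cases "0 < u h")
      case True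
      have "a \<le> A1"
      proof (rule average[of "h + R" 1])
        fix v
        show "a / 4 - 25 * C * (1 + v\<^sup>2) \<le> 1 * u (h + R + v)"
        proof (cases "\<bar>v\<bar> \<le> R")
          case inner: True
          have "- C * ((h + R + v) - h + 1) \<le> u (h + R + v) - u h"
            using inner h by (intro slow) auto
          moreover have "C * ((h + R + v) - h + 1) \<le> C * (2 * R + 1)"
            using inner C by (intro mult_left_mono) auto
          ultimately have "a / 2 - C \<le> u (h + R + v)"
            using True R(2) unfolding a_def by (simp add: algebra_simps)
          then show ?thesis by (simp add: mid)
        next
          case False
          then have "a / 4 - 25 * C * (1 + v\<^sup>2) \<le> - \<bar>u (h + R + v)\<bar>"
            using R(1) by (intro far) auto
          then show ?thesis by linarith
        qed
      qed (use h X R(1) in auto)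
      then show False using a by (simp add: A0_def)
    next
      case False
      then have uh: "u h = - a" using pos by (simp add: a_def)
      have "- C * (h - X + 1) \<le> u h - u X" using h by (intro slow) auto
      \<comment> \<open>The drop from \<open>u X\<close> to \<open>- a\<close> has slope at most
        \<open>C\<close>, and \<open>a > 2 * \<bar>u X\<bar> + 2 * C\<close> makes the distance it
        takes at least \<open>a / (2 * C) = 2 * R\<close>.\<close>
      then have "2 * R * C \<le> (h - X) * C"
      proof -
        have "2 * \<bar>u X\<bar> + 2 * C < a" using a(1) by (simp add: A0_def)
        moreover have "- \<bar>u X\<bar> \<le> u X" by simp
        moreover have "a - C * (h - X) - C \<le> - u X"
          using \<open>- C * (h - X + 1) \<le> u h - u X\<close> uh by (simp add: algebra_simps)
        ultimately have "a / 2 \<le> C * (h - X)" by linarith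
        then show ?thesis using R(2) by (simp add: mult_ac)
      qed
      then have hX: "2 * R \<le> h - X" using C by simp
      have "a \<le> A1"
      proof (rule average[of "h - R" "-1"])
        fix v
        show "a / 4 - 25 * C * (1 + v\<^sup>2) \<le> - 1 * u (h - R + v)"
        proof (cases "\<bar>v\<bar> \<le> R")
          case inner: True
          have "- C * (h - (h - R + v) + 1) \<le> u h - u (h - R + v)"
            using inner h hX by (intro slow) auto
          moreover have "C * (h - (h - R + v) + 1) \<le> C * (2 * R + 1)"
            using inner C by (intro mult_left_mono) auto
          ultimately have "a / 2 - C \<le> - u (h - R + v)"
            using uh R(2) by (simp add: algebra_simps)
          then show ?thesis by (simp add: mid)
        next
          case False
          then have "a / 4 - 25 * C * (1 + v\<^sup>2) \<le> - \<bar>u (h - R + v)\<bar>"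
            using R(1) by (intro far) auto
          then show ?thesis by linarith
        qed
      qed (use hX X R(1) in auto)
      then show False using a by (simp add: A0_def)
    qed
  qed
  have weighted: "\<bar>u x\<bar> \<le> 2 * A0 * (1 + \<epsilon> * \<bar>x\<bar>)" if \<epsilon>: "0 < \<epsilon>" "\<epsilon> \<le> 1" for \<epsilon> x
  proof -
    have w: "0 < 1 + \<epsilon> * \<bar>x\<bar>" for x using \<epsilon> by (simp add: add_pos_nonneg)
    define q where "q = (\<lambda>x. \<bar>u x\<bar> / (1 + \<epsilon> * \<bar>x\<bar>))"
    have A_nonneg: "0 \<le> A" using A[of 0] by simp
    have "q x \<le> A / \<epsilon>" for x
    proof -
      have "\<epsilon> * (1 + \<bar>x\<bar>) \<le> 1 + \<epsilon> * \<bar>x\<bar>" using \<epsilon> by (simp add: algebra_simps)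
      then have "A * (\<epsilon> * (1 + \<bar>x\<bar>)) \<le> A * (1 + \<epsilon> * \<bar>x\<bar>)" using A_nonneg by (rule mult_left_mono)
      then have "\<epsilon> * \<bar>u x\<bar> \<le> A * (1 + \<epsilon> * \<bar>x\<bar>)"
      proof -
        have "\<epsilon> * \<bar>u x\<bar> \<le> \<epsilon> * (A * (1 + \<bar>x\<bar>))" using \<epsilon> A by (intro mult_left_mono) auto
        also have "\<dots> = A * (\<epsilon> * (1 + \<bar>x\<bar>))" by (rule mult.left_commute)
        finally show ?thesis using \<open>A * (\<epsilon> * (1 + \<bar>x\<bar>)) \<le> A * (1 + \<epsilon> * \<bar>x\<bar>)\<close> by (rule order_trans)
      qed
      then show ?thesis using w[of x] \<epsilon> by (simp add: q_def field_simps)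
    qed
    then have bdd: "bdd_above (range q)" by (intro bdd_aboveI2)
    define S where "S = (SUP x. q x)"
    have qS: "q x \<le> S" for x unfolding S_def by (rule cSUP_upper[OF _ bdd]) simp
    have "S \<le> 2 * A0"
    proof (cases "0 < S")
      case True
      then have "S / 2 < (SUP x. q x)" unfolding S_def[symmetric] by simp
      then have "\<exists>h\<in>UNIV. S / 2 < q h" by (subst (asm) less_cSUP_iff[OF _ bdd]) auto
      then obtain h where h: "S / 2 < q h" by blast
      then have ne: "u h \<noteq> 0" using True by (auto simp: q_def)
      then have "X \<le> h" using u0 not_le by blast
      moreover have "\<bar>u y\<bar> \<le> 2 * \<bar>u h\<bar> * (1 + \<bar>y - h\<bar>)" for y
      proof -
        have "q y \<le> 2 * q h" using qS[of y] h by simp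
        then have "\<bar>u y\<bar> \<le> 2 * q h * (1 + \<epsilon> * \<bar>y\<bar>)"
          using w[of y] by (simp add: q_def[of ] divide_le_eq)
        \<comment> \<open>For \<open>\<epsilon> \<le> 1\<close> the weight is submultiplicative, so
          near-maximality of \<open>q\<close> at \<open>h\<close> becomes a growth bound around
          \<open>h\<close> that is free of \<open>\<epsilon>\<close>.\<close>
        also have "\<dots> \<le> 2 * q h * ((1 + \<epsilon> * \<bar>h\<bar>) * (1 + \<bar>y - h\<bar>))"
        proof (rule mult_left_mono)
          have "\<epsilon> * \<bar>y\<bar> \<le> \<epsilon> * (\<bar>h\<bar> + \<bar>y - h\<bar>)" using \<epsilon> by (intro mult_left_mono) auto
          moreover have "\<epsilon> * \<bar>y - h\<bar> \<le> 1 * \<bar>y - h\<bar>" using \<epsilon> by (intro mult_right_mono) auto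
          moreover have "0 \<le> \<epsilon> * \<bar>h\<bar> * \<bar>y - h\<bar>" using \<epsilon> by simp
          ultimately show "1 + \<epsilon> * \<bar>y\<bar> \<le> (1 + \<epsilon> * \<bar>h\<bar>) * (1 + \<bar>y - h\<bar>)"
            by (simp add: algebra_simps)
          show "0 \<le> 2 * q h" using h True by simp
        qed
        also have "2 * q h * ((1 + \<epsilon> * \<bar>h\<bar>) * (1 + \<bar>y - h\<bar>)) = 2 * \<bar>u h\<bar> * (1 + \<bar>y - h\<bar>)"
          using w[of h] by (simp add: q_def)
        finally show ?thesis .
      qed
      ultimately have "\<bar>u h\<bar> \<le> A0" using near_max ne by blast
      moreover have "q h \<le> \<bar>u h\<bar>"
        using w[of h] \<epsilon> by (simp add: q_def divide_le_eq mult_le_cancel_left1)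
      ultimately show ?thesis using h by simp
    qed (use A0_pos in simp)
    then have "q x \<le> 2 * A0" using qS[of x] by simp
    then show ?thesis using w[of x] by (simp add: q_def divide_le_eq)
  qed
  have "\<bar>u x\<bar> \<le> 2 * A0" for x
  proof (rule tendsto_lowerbound)
    show "((\<lambda>\<epsilon>. 2 * A0 * (1 + \<epsilon> * \<bar>x\<bar>)) \<longlongrightarrow> 2 * A0) (at_right 0)"
      by (auto intro!: tendsto_eq_intros)
    show "\<forall>\<^sub>F \<epsilon> in at_right 0. \<bar>u x\<bar> \<le> 2 * A0 * (1 + \<epsilon> * \<bar>x\<bar>)"
      using eventually_at_right_real[OF zero_less_one] by eventually_elim (rule weighted; simp)
  qed simp
  then show ?thesis by blast
qed

end

section \<open>Growth of a function whose damped averages have bounded limits\<close>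

lemma set_integrable_of_laplace:
  fixes u :: "real \<Rightarrow> real"
  assumes [measurable]: "u \<in> borel_measurable borel"
    and int: "integrable lborel (\<lambda>x. u x * exp (- x))"
  shows "set_integrable lborel {a..b} u"
  unfolding set_integrable_def
proof (rule Bochner_Integration.integrable_bound)
  show "integrable lborel (\<lambda>x. exp b * (u x * exp (- x)))"
    using int by simp
  show "AE x in lborel. norm (indicator {a..b} x *\<^sub>R u x) \<le> norm (exp b * (u x * exp (- x)))"
  proof (intro AE_I2)
    fix x
    have "\<bar>u x\<bar> \<le> exp b * (\<bar>u x\<bar> * exp (- x))" if "x \<le> b"
    proof -
      have "1 \<le> exp (b - x)" using that by simp
      from mult_left_mono[OF this, of "\<bar>u x\<bar>"] show ?thesis
        by (simp add: exp_diff exp_minus field_simps)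
    qed
    then show "norm (indicator {a..b} x *\<^sub>R u x) \<le> norm (exp b * (u x * exp (- x)))"
      by (auto simp: indicator_def abs_mult)
  qed
qed measurable

context decaying_kernel
begin

text \<open>Convergence is assumed along one sequence and only for differences with the average at
  0: as long as the growth of \<open>u\<close> is not under control, nothing is known about the
  single averages without damping.\<close>

context
  fixes u :: "real \<Rightarrow> real" and X C B :: real and \<sigma> :: "nat \<Rightarrow> real" and L :: "real \<Rightarrow> real"
  assumes u_meas [measurable]: "u \<in> borel_measurable borel"
    and u0: "\<And>x. x < X \<Longrightarrow> u x = 0" and X: "0 \<le> X" and C: "1 \<le> C"
    and slow: "\<And>x y. X \<le> x \<Longrightarrow> x \<le> y \<Longrightarrow> - C * (y - x + 1) \<le> u y - u x"
    and int: "\<And>s. 0 < s \<Longrightarrow> integrable lborel (\<lambda>x. u x * exp (- s * x))"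
    and \<sigma>: "\<And>n. 0 < \<sigma> n" "\<And>n. \<sigma> n \<le> 1" "\<sigma> \<longlonglongrightarrow> 0"
    and lim: "\<And>h. 0 \<le> h \<Longrightarrow> (\<lambda>n. (LINT x|lborel. u x * (exp (- \<sigma> n * (x - h)) * K (x - h)))
        - (LINT x|lborel. u x * (exp (- \<sigma> n * x) * K x))) \<longlonglongrightarrow> L h"
    and L_le: "\<And>h. 0 \<le> h \<Longrightarrow> \<bar>L h\<bar> \<le> B"
begin

lemma set_integrable_u: "set_integrable lborel {a..b} u"
  using int[of 1] by (intro set_integrable_of_laplace) auto

text \<open>Unit increments of \<open>u\<close> are bounded below, so after adding \<open>E\<close>
  they are nonnegative and their integral over \<open>[h, h + r]\<close> is dominated by a damped
  average against \<open>K\<close>. The average of the increments tends to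
  \<open>L h - L (h - 1)\<close>, and one index \<open>n\<close>, depending on \<open>h\<close>,
  already comes close enough.\<close>

lemma difference_le: "\<exists>B3\<ge>0. \<forall>h\<ge>max X 1. (LINT x:{h..h+r}|lborel. u x - u (x - 1)) \<le> B3"
proof -
  define \<kappa> where "\<kappa> = (LINT v|lborel. K v)"
  have \<kappa>: "0 < \<kappa>" unfolding \<kappa>_def by (rule K_integral_pos)
  \<comment> \<open>On \<open>[X, X + 1)\<close> the shifted value is 0 and \<open>u x\<close> may
    be as low as \<open>u X - 2 * C\<close>; further right a unit increment loses at most
    \<open>2 * C\<close>.\<close>
  define E where "E = \<bar>u X\<bar> + 2 * C"
  have E: "0 \<le> E" using C by (simp add: E_def)
  have B: "0 \<le> B" using L_le[of 0] by simp
  define d where "d = (\<lambda>x. u x - u (x - 1) + E * indicator {X..} x)"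
  have d0: "0 \<le> d x" for x
  proof -
    consider "x < X" | "X \<le> x" "x < X + 1" | "X + 1 \<le> x" by linarith
    then show ?thesis
    proof cases
      case 1 then show ?thesis using u0 by (simp add: d_def)
    next
      case 2
      have "- C * (x - X + 1) \<le> u x - u X" using 2 by (intro slow) auto
      moreover have "C * (x - X + 1) \<le> C * 2" using 2 C by (intro mult_left_mono) auto
      ultimately show ?thesis using 2 u0[of "x - 1"] by (simp add: d_def E_def)
    next
      case 3
      have "- C * (x - (x - 1) + 1) \<le> u x - u (x - 1)" using 3 by (intro slow) auto
      then show ?thesis using 3 by (simp add: d_def E_def)
    qed
  qed
  define B3 where "B3 = 2 * (2 * B + 1 + 2 * E * \<kappa>) / c"
  have "(LINT x:{h..h+r}|lborel. u x - u (x - 1)) \<le> B3" if h: "max X 1 \<le> h" for h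
  proof -
    define w where "w = (\<lambda>n x. exp (- \<sigma> n * (x - h)) * K (x - h))"
    have w0: "0 \<le> w n x" for n x using K_nonneg by (simp add: w_def)
    have [measurable]: "w n \<in> borel_measurable borel" for n unfolding w_def by measurable
    have iw: "integrable lborel (\<lambda>x. u x * w n x)" for n
      unfolding w_def by (rule integrable_smoothed[OF u_meas int[OF \<sigma>(1)]])
    have shift: "(LINT x|lborel. u x * (exp (- \<sigma> n * (x - (h - 1))) * K (x - (h - 1)))) =
        (LINT x|lborel. u (x - 1) * w n x)" for n
      by (subst lborel_integral_real_affine[of 1 _ "-1"]) (auto simp: w_def algebra_simps)
    have iw1: "integrable lborel (\<lambda>x. u (x - 1) * w n x)" for n
      using lborel_integrable_real_affine[OF integrable_smoothed[OF u_meas int[OF \<sigma>(1)], of n "h - 1"], of 1 "-1"]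
      by (simp add: w_def algebra_simps)
    have "(\<lambda>n. (LINT x|lborel. u x * w n x) - (LINT x|lborel. u (x - 1) * w n x)) \<longlonglongrightarrow> L h - L (h - 1)"
      using tendsto_diff[OF lim[of h] lim[of "h - 1"]] h unfolding shift by (simp add: w_def)
    moreover have "L h - L (h - 1) < 2 * B + 1"
      using L_le[of h] L_le[of "h - 1"] h by simp
    ultimately have ev1: "\<forall>\<^sub>F n in sequentially.
        (LINT x|lborel. u x * w n x) - (LINT x|lborel. u (x - 1) * w n x) < 2 * B + 1"
      by (rule order_tendstoD(2))
    \<comment> \<open>The aim is \<open>\<sigma> n * h < ln 2\<close>: then the damping factor
      relative to \<open>h\<close> is at most 2 for \<open>x \<ge> X\<close> and at least 1/2 on
      \<open>[h, h + r]\<close>, the latter because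
      \<open>x - h \<le> r \<le> 1 \<le> h\<close>.\<close>
    have "(\<lambda>n. \<sigma> n * h) \<longlonglongrightarrow> 0" using tendsto_mult_left_zero[OF \<sigma>(3)] .
    then have "\<forall>\<^sub>F n in sequentially. \<sigma> n * h < ln 2" by (rule order_tendstoD(2)) simp
    with ev1 have "\<forall>\<^sub>F n in sequentially.
        (LINT x|lborel. u x * w n x) - (LINT x|lborel. u (x - 1) * w n x) < 2 * B + 1 \<and> \<sigma> n * h < ln 2"
      by (rule eventually_conj)
    then obtain n where n: "(LINT x|lborel. u x * w n x) - (LINT x|lborel. u (x - 1) * w n x) < 2 * B + 1"
      "\<sigma> n * h < ln 2"
      using eventually_happens by force
    have w_le: "indicator {X..} x * w n x \<le> 2 * K (x - h)" for x
    proof (cases "X \<le> x")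
      case True
      then have "0 \<le> \<sigma> n * x" using X \<sigma>(1)[of n] by simp
      then have "- \<sigma> n * (x - h) \<le> ln 2"
        using n(2) by (simp add: algebra_simps)
      then have "exp (- \<sigma> n * (x - h)) \<le> exp (ln 2)" by (subst exp_le_cancel_iff)
      then have "exp (- \<sigma> n * (x - h)) \<le> 2" by simp
      then show ?thesis using True K_nonneg[of "x - h"] unfolding w_def by (simp add: mult_right_mono)
    qed (use K_nonneg in simp)
    have w_ge: "c / 2 \<le> w n x" if "x \<in> {h..h+r}" for x
    proof -
      have "\<sigma> n * (x - h) \<le> \<sigma> n * h" using that h r_le \<sigma>(1)[of n] by (intro mult_left_mono) auto
      then have "- ln 2 \<le> - \<sigma> n * (x - h)" using n(2) by simp
      then have "exp (- ln 2) \<le> exp (- \<sigma> n * (x - h))" by (subst exp_le_cancel_iff)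
      then have "1 / 2 \<le> exp (- \<sigma> n * (x - h))" by (simp add: exp_minus inverse_eq_divide)
      moreover have "c \<le> K (x - h)" using that by (intro K_ge) auto
      ultimately have "1 / 2 * c \<le> w n x" unfolding w_def using c_pos by (intro mult_mono) auto
      then show ?thesis by simp
    qed
    have Kh: "integrable lborel (\<lambda>x. K (x - h))"
      using lborel_integrable_real_affine[OF K_integrable, of 1 "-h"] by simp
    have iX: "integrable lborel (\<lambda>x. indicator {X..} x * w n x)"
      by (rule Bochner_Integration.integrable_bound[OF integrable_mult_right[OF Kh, of 2]])
         (use w_le w0 K_nonneg in \<open>auto simp: abs_mult\<close>)
    have "(LINT x|lborel. indicator {X..} x * w n x) \<le> (LINT x|lborel. 2 * K (x - h))"
      by (intro integral_mono iX integrable_mult_right Kh w_le)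
    also have "\<dots> = 2 * \<kappa>"
      unfolding \<kappa>_def using lborel_integral_real_affine[of 1 "\<lambda>x. K (x - h)" h] by simp
    finally have X_le: "E * (LINT x|lborel. indicator {X..} x * w n x) \<le> E * (2 * \<kappa>)"
      using E by (rule mult_left_mono)
    have dw: "(\<lambda>x. d x * w n x) = (\<lambda>x. u x * w n x - u (x - 1) * w n x + E * (indicator {X..} x * w n x))"
      by (auto simp: d_def algebra_simps)
    have id: "integrable lborel (\<lambda>x. d x * w n x)"
      unfolding dw by (intro Bochner_Integration.integrable_add Bochner_Integration.integrable_diff
          iw iw1 integrable_mult_right iX)
    have "(LINT x|lborel. d x * w n x) =
      (LINT x|lborel. u x * w n x) - (LINT x|lborel. u (x - 1) * w n x) + E * (LINT x|lborel. indicator {X..} x * w n x)"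
      unfolding dw
      by (simp add: Bochner_Integration.integral_add Bochner_Integration.integral_diff
          Bochner_Integration.integrable_diff iw iw1 iX)
    then have upper: "(LINT x|lborel. d x * w n x) \<le> 2 * B + 1 + 2 * E * \<kappa>"
      using n(1) X_le by simp
    have iu: "set_integrable lborel {h..h+r} u" by (rule set_integrable_u)
    have "integrable lborel (\<lambda>x. indicator {h-1..h-1+r} x *\<^sub>R u x)"
      using set_integrable_u by (simp add: set_integrable_def)
    from lborel_integrable_real_affine[OF this, of 1 "-1"]
    have iu1: "set_integrable lborel {h..h+r} (\<lambda>x. u (x - 1))"
      unfolding set_integrable_def by (rule back_subst[where P = "integrable lborel"])
         (auto simp: indicator_def fun_eq_iff)
    have "(LINT x:{h..h+r}|lborel. u x - u (x - 1)) * (c / 2) =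
        (LINT x|lborel. indicator {h..h+r} x *\<^sub>R (u x - u (x - 1)) * (c / 2))"
      unfolding set_lebesgue_integral_def by simp
    also have "\<dots> \<le> (LINT x|lborel. d x * w n x)"
    proof (intro integral_mono id)
      show "integrable lborel (\<lambda>x. indicator {h..h+r} x *\<^sub>R (u x - u (x - 1)) * (c / 2))"
        using set_integral_diff(1)[OF iu iu1] unfolding set_integrable_def by (rule integrable_mult_left)
      fix x
      show "indicator {h..h+r} x *\<^sub>R (u x - u (x - 1)) * (c / 2) \<le> d x * w n x"
      proof (cases "x \<in> {h..h+r}")
        case True
        have "(u x - u (x - 1)) * (c / 2) \<le> d x * (c / 2)"
          using c_pos E by (intro mult_right_mono) (auto simp: d_def)
        also have "\<dots> \<le> d x * w n x" by (rule mult_left_mono[OF w_ge[OF True] d0])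
        finally show ?thesis using True by simp
      qed (use d0 w0 in simp)
    qed
    finally show ?thesis
      using upper c_pos unfolding B3_def by (simp add: field_simps)
  qed
  moreover have "0 \<le> B3" unfolding B3_def using B E \<kappa> c_pos by simp
  ultimately show ?thesis by blast
qed

text \<open>Window integrals grow by at most a constant per unit step, hence linearly, and the
  one-sided condition bounds \<open>u x\<close> by its mean over \<open>[x, x + r]\<close> plus
  \<open>2 * C\<close>. From below the one-sided condition starting at \<open>X\<close> is itself a
  linear bound.\<close>

lemma linear_growth: "\<exists>A. \<forall>x. \<bar>u x\<bar> \<le> A * (1 + \<bar>x\<bar>)"
proof -
  define H where "H = max X 1"
  have H: "X \<le> H" "1 \<le> H" by (auto simp: H_def)
  obtain B3 where B3: "0 \<le> B3" "\<And>h. H \<le> h \<Longrightarrow> (LINT x:{h..h+r}|lborel. u x - u (x - 1)) \<le> B3"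
    using difference_le unfolding H_def by blast
  define U where "U = (\<lambda>h. LINT x:{h..h+r}|lborel. u x)"
  have step: "U (h + 1) \<le> U h + B3" if h: "H \<le> h" for h
  proof -
    have "(LINT x:{h+1..h+1+r}|lborel. u (x - 1)) = U h"
      unfolding U_def set_lebesgue_integral_def
      by (subst lborel_integral_real_affine[of 1 _ 1])
         (auto intro!: Bochner_Integration.integral_cong simp: indicator_def)
    moreover have "set_integrable lborel {h+1..h+1+r} (\<lambda>x. u (x - 1))"
    proof -
      have "integrable lborel (\<lambda>x. indicator {h..h+r} x *\<^sub>R u x)"
        using set_integrable_u by (simp add: set_integrable_def)
      from lborel_integrable_real_affine[OF this, of 1 "-1"] show ?thesis
        unfolding set_integrable_def by (rule back_subst[where P = "integrable lborel"])
           (auto simp: indicator_def fun_eq_iff)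
    qed
    ultimately show ?thesis
      using B3(2)[of "h + 1"] h set_integral_diff(2)[OF set_integrable_u[of "h+1" "h+1+r"]]
      by (simp add: U_def)
  qed
  have steps: "U (h + real n) \<le> U h + real n * B3" if h: "H \<le> h" for h n
  proof (induction n)
    case (Suc n)
    have "U (h + real n + 1) \<le> U (h + real n) + B3" using h by (intro step) auto
    with Suc show ?case by (simp add: algebra_simps)
  qed simp
  \<comment> \<open>A common bound for all starting windows: \<open>h\<close> ranges over
    \<open>[H, H + 1]\<close> and \<open>r \<le> 1\<close>.\<close>
  define U0 where "U0 = (LINT x:{H..H+2}|lborel. \<bar>u x\<bar>)"
  have U0: "U h \<le> U0" if "H \<le> h" "h \<le> H + 1" for h
    unfolding U_def U0_def set_lebesgue_integral_def
  proof (rule integral_mono)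
    show "integrable lborel (\<lambda>x. indicator {h..h+r} x *\<^sub>R u x)"
      using set_integrable_u by (simp add: set_integrable_def)
    show "integrable lborel (\<lambda>x. indicator {H..H+2} x *\<^sub>R \<bar>u x\<bar>)"
      using set_integrable_abs[OF set_integrable_u] by (simp add: set_integrable_def)
    show "indicator {h..h+r} x *\<^sub>R u x \<le> indicator {H..H+2} x *\<^sub>R \<bar>u x\<bar>" for x
      using that r_le by (auto simp: indicator_def)
  qed
  have U0_nonneg: "0 \<le> U0"
    unfolding U0_def set_lebesgue_integral_def by (intro Bochner_Integration.integral_nonneg) auto
  have upper: "r * u x \<le> U0 + x * B3 + 2 * C * r" if x: "H \<le> x" for x
  proof -
    define n where "n = nat \<lfloor>x - H\<rfloor>"
    have n: "real n \<le> x - H" "x - H \<le> real n + 1" using x unfolding n_def by linarith+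
    have "U x \<le> U (x - real n) + real n * B3" using steps[of "x - real n" n] n by simp
    also have "\<dots> \<le> U0 + x * B3"
      using n H B3(1) by (intro add_mono U0 mult_right_mono) auto
    finally have 1: "U x \<le> U0 + x * B3" .
    have "r * (u x - 2 * C) = (LINT y|lborel. indicator {x..x+r} y *\<^sub>R (u x - 2 * C))"
      using r_pos by simp
    also have "\<dots> \<le> U x"
      unfolding U_def set_lebesgue_integral_def
    proof (rule integral_mono)
      show "integrable lborel (\<lambda>y. indicator {x..x+r} y *\<^sub>R u y)"
        using set_integrable_u by (simp add: set_integrable_def)
      show "integrable lborel (\<lambda>y. indicator {x..x+r} y *\<^sub>R (u x - 2 * C))"
        by (rule integrable_indicator) (auto simp: emeasure_lborel_Icc_eq)
      fix y
      have "u x - 2 * C \<le> u y" if "y \<in> {x..x+r}"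
      proof -
        have "- C * (y - x + 1) \<le> u y - u x" using that x H by (intro slow) auto
        moreover have "C * (y - x + 1) \<le> C * 2" using that r_le C by (intro mult_left_mono) auto
        ultimately show ?thesis by simp
      qed
      then show "indicator {x..x+r} y *\<^sub>R (u x - 2 * C) \<le> indicator {x..x+r} y *\<^sub>R u y"
        by (auto simp: indicator_def)
    qed
    finally show ?thesis using 1 by (simp add: algebra_simps)
  qed
  \<comment> \<open>One group of terms for each estimate: the quotient for \<open>x \<ge> H\<close>,
    the terms in \<open>H\<close> for the upper bound on \<open>[X, H]\<close>, and
    \<open>\<bar>u X\<bar> + C\<close> for the lower bound.\<close>
  define A where "A = (U0 + B3 + 2 * C * r) / r + \<bar>u H\<bar> + C * (H + 1) + \<bar>u X\<bar> + C"
  have P: "0 \<le> (U0 + B3 + 2 * C * r) / r" using U0_nonneg B3 C r_pos by simp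
  have Q: "0 \<le> C * (H + 1)" using C H by simp
  have "\<bar>u x\<bar> \<le> A * (1 + \<bar>x\<bar>)" for x
  proof (cases "X \<le> x")
    case True
    then have x0: "0 \<le> x" using X by simp
    have "- C * (x - X + 1) \<le> u x - u X" using True by (intro slow) auto
    moreover have "C * (x - X + 1) \<le> C * (1 + x)" using X C by (intro mult_left_mono) auto
    moreover have "\<bar>u X\<bar> * 1 \<le> \<bar>u X\<bar> * (1 + x)" using x0 by (intro mult_left_mono) auto
    ultimately have "- ((\<bar>u X\<bar> + C) * (1 + x)) \<le> u x" by (simp add: algebra_simps)
    moreover have "(\<bar>u X\<bar> + C) * (1 + x) \<le> A * (1 + x)"
      unfolding A_def using P Q x0 by (intro mult_right_mono) auto
    moreover have "u x \<le> A * (1 + x)"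
    proof (cases "H \<le> x")
      case True
      have "r * u x \<le> (U0 + B3 + 2 * C * r) * (1 + x)"
      proof -
        have "U0 * 1 \<le> U0 * (1 + x)"
          using x0 U0_nonneg by (intro mult_left_mono) auto
        moreover have "2 * C * r * 1 \<le> 2 * C * r * (1 + x)"
          using x0 C r_pos by (intro mult_left_mono) auto
        ultimately
        show ?thesis using upper[OF True] B3(1) by (simp add: algebra_simps)
      qed
      then have "u x \<le> (U0 + B3 + 2 * C * r) / r * (1 + x)"
        using r_pos by (simp add: pos_le_divide_eq mult.commute)
      also have "\<dots> \<le> A * (1 + x)"
        unfolding A_def using Q C x0 by (intro mult_right_mono) auto
      finally show ?thesis .
    next
      case False
      then have "- C * (H - x + 1) \<le> u H - u x" using True by (intro slow) auto
      moreover have "C * (H - x + 1) \<le> C * (H + 1)" using x0 C by (intro mult_left_mono) auto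
      ultimately have "u x \<le> A" unfolding A_def using P C by linarith
      also have "A * 1 \<le> A * (1 + x)"
        using x0 P Q C unfolding A_def by (intro mult_left_mono) auto
      finally show ?thesis by simp
    qed
    ultimately have "u x \<le> A * (1 + x)" "- u x \<le> A * (1 + x)" by linarith+
    then show ?thesis using x0 by (simp add: abs_le_iff)
  next
    case False
    have "0 \<le> A" unfolding A_def using P Q C by simp
    then show ?thesis using False u0[of x] by simp
  qed
  then show ?thesis by blast
qed

text \<open>Linear growth makes \<open>u\<close> integrable against all translates of
  \<open>K\<close>, so dominated convergence removes the damping and identifies \<open>L h\<close>
  as a difference of undamped averages, to which \<open>bounded_of_bounded_average\<close>
  applies.\<close>

lemma bounded_of_bounded_limit: "\<exists>B. \<forall>x. \<bar>u x\<bar> \<le> B"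
proof -
  obtain A where A: "\<And>x. \<bar>u x\<bar> \<le> A * (1 + \<bar>x\<bar>)" using linear_growth by blast
  define \<Psi> where "\<Psi> = (\<lambda>h. LINT v|lborel. u (h + v) * K v)"
  have conv: "(\<lambda>n. LINT x|lborel. u x * (exp (- \<sigma> n * (x - h)) * K (x - h))) \<longlonglongrightarrow> \<Psi> h" if h: "0 \<le> h" for h
  proof -
    have "(LINT x|lborel. u x * K (x - h)) = \<Psi> h"
      unfolding \<Psi>_def by (subst lborel_integral_real_affine[of 1 _ h]) auto
    moreover have i: "integrable lborel (\<lambda>x. u x * K (x - h))"
      using lborel_integrable_real_affine[OF integrable_growth[OF u_meas A, of h], of 1 "-h"] by simp
    have "(\<lambda>n. LINT x|lborel. u x * (exp (- \<sigma> n * (x - h)) * K (x - h))) \<longlonglongrightarrow> (LINT x|lborel. u x * K (x - h))"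
      by (rule smoothed_limit[OF u_meas _ i h \<sigma>]) (use u0 X in simp)
    ultimately show ?thesis by simp
  qed
  have "\<bar>\<Psi> h\<bar> \<le> \<bar>\<Psi> 0\<bar> + B" if h: "0 \<le> h" for h
  proof -
    have "(\<lambda>n. (LINT x|lborel. u x * (exp (- \<sigma> n * (x - h)) * K (x - h)))
        - (LINT x|lborel. u x * (exp (- \<sigma> n * x) * K x))) \<longlonglongrightarrow> \<Psi> h - \<Psi> 0"
      using tendsto_diff[OF conv[OF h] conv[of 0]] by simp
    then have "\<Psi> h - \<Psi> 0 = L h" using lim[OF h] LIMSEQ_unique by blast
    then show ?thesis using L_le[OF h] by linarith
  qed
  then show ?thesis
    unfolding \<Psi>_def by (intro bounded_of_bounded_average[OF u_meas u0 X C slow A])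
qed

end

end

section \<open>Uniform boundedness of exponential moments\<close>

text \<open>The Banach-Steinhaus theorem for a sequence: the closed sets \<open>E k\<close> cover
  the space, so by Baire's theorem one of them contains a ball, and linearity carries the bound on
  that ball to all vectors.\<close>

lemma uniform_boundedness:
  fixes f :: "nat \<Rightarrow> 'a::{real_normed_vector, complete_space} \<Rightarrow> 'b::real_normed_vector"
  assumes lin: "\<And>n. bounded_linear (f n)"
    and bdd: "\<And>x. \<exists>k. \<forall>n. norm (f n x) \<le> k"
  shows "\<exists>B. \<forall>n x. norm (f n x) \<le> B * norm x"
proof -
  define E where "E = (\<lambda>k::nat. {x. \<forall>n. norm (f n x) \<le> real k})"
  have closed_E: "closed (E k)" for k
    unfolding E_def Collect_all_eq
    by (intro closed_INT ballI closed_Collect_le continuous_intros linear_continuous_on lin)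
  have "\<exists>k. interior (E k) \<noteq> {}"
  proof (rule ccontr)
    assume "\<not> ?thesis"
    then have empty: "interior (E k) = {}" for k by blast
    have "Met_TC.mtopology interior_of \<Union>(range E) = {}"
    proof (rule Met_TC.metric_Baire_category_alt)
      show "Met_TC.mcomplete TYPE('a)" by (simp add: complete_UNIV)
      fix T assume "T \<in> range E"
      then show "closedin Met_TC.mtopology T \<and> Met_TC.mtopology interior_of T = {}"
        using closed_E empty by (auto simp: interior_of_def interior_def)
    qed simp
    moreover have "\<Union>(range E) = UNIV"
    proof (intro equalityI subset_UNIV subsetI)
      fix x
      obtain b where b: "\<And>n. norm (f n x) \<le> b" using bdd by blast
      then have "norm (f n x) \<le> real (nat \<lceil>b\<rceil>)" for n by (meson order_trans real_nat_ceiling_ge)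
      then show "x \<in> \<Union>(range E)" unfolding E_def by blast
    qed
    ultimately show False by (simp add: interior_of_def) blast
  qed
  then obtain k x0 where "x0 \<in> interior (E k)" by blast
  then obtain e where e: "e > 0" "ball x0 e \<subseteq> E k" unfolding mem_interior by blast
  \<comment> \<open>The vector \<open>y\<close> has norm \<open>e / 2\<close> and is a difference of
    two points of the ball, so its image has norm at most \<open>2 * k\<close>; rescaling by
    \<open>2 / e\<close> gives the factor 4.\<close>
  have "norm (f n x) \<le> (4 * real k / e) * norm x" for n x
  proof (cases "x = 0")
    case True
    then show ?thesis using linear_simps(3)[OF lin] by simp
  next
    case False
    interpret bounded_linear "f n" by (rule lin)
    define y where "y = (e / (2 * norm x)) *\<^sub>R x"
    have "norm y < e" using False e(1) by (simp add: y_def)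
    then have "x0 \<in> E k" "x0 + y \<in> E k" using e by (auto simp: dist_norm)
    then have "norm (f n (x0 + y)) \<le> k" "norm (f n x0) \<le> k" by (auto simp: E_def)
    then have "norm (f n (x0 + y) - f n x0) \<le> 2 * real k" by norm
    then have "e / (2 * norm x) * norm (f n x) \<le> 2 * real k"
      using e(1) by (simp add: add y_def scaleR)
    then show ?thesis using e(1) False by (simp add: field_simps)
  qed
  then show ?thesis by blast
qed

text \<open>A superposition of characters with frequencies in \<open>[0, h]\<close>. The coefficient
  1 gives \<open>(exp(iht) - 1)/(it)\<close>, and \<open>exp (\<sigma> * y)\<close> gives
  \<open>(exp(hs) - 1)/s\<close> for \<open>s = \<sigma> + it\<close>. The fixed and the moving
  multiplier are thus values of one linear map, and the singularity at \<open>t = 0\<close> never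
  shows.\<close>

definition exp_moment :: "real \<Rightarrow> (real \<Rightarrow> complex) \<Rightarrow> real \<Rightarrow> complex" where
  "exp_moment h c t = integral {0..h} (\<lambda>y. c y * exp (\<i> * of_real (y * t)))"

lemma exp_moment_integrable:
  "continuous_on {0..h} c \<Longrightarrow> (\<lambda>y. c y * exp (\<i> * of_real (y * t))) integrable_on {0..h}"
  by (intro integrable_continuous_real continuous_intros)

lemma norm_exp_moment_le:
  assumes "continuous_on {0..h} c" "\<And>y. y \<in> {0..h} \<Longrightarrow> norm (c y) \<le> B" "0 \<le> h"
  shows "norm (exp_moment h c t) \<le> h * B"
proof -
  have "norm (exp_moment h c t) \<le> B * (h - 0)"
    unfolding exp_moment_def
    by (rule integral_bound) (use assms in \<open>auto intro!: continuous_intros simp: norm_mult\<close>)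
  then show ?thesis by (simp add: mult.commute)
qed

lemma exp_moment_exp:
  assumes "s \<noteq> 0" "s = of_real \<sigma> + \<i> * of_real t" "0 \<le> h"
  shows "exp_moment h (\<lambda>y. of_real (exp (\<sigma> * y))) t = (exp (of_real h * s) - 1) / s"
proof -
  have "((\<lambda>y. exp (of_real y * s)) has_integral (exp (of_real h * s) / s - exp (of_real 0 * s) / s)) {0..h}"
  proof (rule fundamental_theorem_of_calculus[OF assms(3)])
    fix y
    have "((\<lambda>y. exp (y * s) / s) has_field_derivative exp (of_real y * s)) (at (of_real y))"
      using assms(1) by (auto intro!: derivative_eq_intros)
    then show "((\<lambda>y. exp (of_real y * s) / s) has_vector_derivative exp (of_real y * s)) (at y within {0..h})"
      by (rule has_vector_derivative_real_field)
  qed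
  moreover have "exp (of_real y * s) = of_real (exp (\<sigma> * y)) * exp (\<i> * of_real (y * t))" for y
    by (simp add: assms(2) exp_of_real[symmetric] exp_add[symmetric] algebra_simps)
  ultimately show ?thesis
    unfolding exp_moment_def by (simp add: integral_unique diff_divide_distrib)
qed

text \<open>The functionals \<open>c \<mapsto> \<integral> w\<^sub>n m\<^sub>c\<close> on bounded continuous functions are pointwise
  bounded, hence uniformly bounded, so a uniformly convergent sequence \<open>exp (\<sigma>\<^sub>n y) \<rightarrow> 1\<close> may be
  inserted for \<open>c\<close>.\<close>

lemma exp_moment_limit:
  fixes w :: "nat \<Rightarrow> real \<Rightarrow> complex"
  assumes w: "\<And>n. integrable lborel (w n)" and h: "0 \<le> h" and \<sigma>: "\<And>n. 0 \<le> \<sigma> n" "\<sigma> \<longlonglongrightarrow> 0"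
    and conv: "\<And>c. continuous_on {0..h} c \<Longrightarrow> convergent (\<lambda>n. LINT t|lborel. w n t * exp_moment h c t)"
    and lim: "(\<lambda>n. LINT t|lborel. w n t * exp_moment h (\<lambda>y. 1) t) \<longlonglongrightarrow> l"
  shows "(\<lambda>n. LINT t|lborel. w n t * exp_moment h (\<lambda>y. of_real (exp (\<sigma> n * y))) t) \<longlonglongrightarrow> l"
proof -
  have meas: "exp_moment h c \<in> borel_measurable borel" if "continuous_on {0..h} c" for c
    using smooth_fun_measurable[OF smooth_fun_integral_exp[OF that]] by (simp add: exp_moment_def[abs_def])
  have int: "integrable lborel (\<lambda>t. w n t * exp_moment h c t)" if c: "continuous_on {0..h} c" for n c
  proof -
    obtain B where "\<forall>z\<in>c ` {0..h}. norm z \<le> B"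
      using compact_imp_bounded[OF compact_continuous_image[OF c compact_Icc]] unfolding bounded_iff by blast
    then have B: "norm (exp_moment h c t) \<le> h * B" for t
      by (intro norm_exp_moment_le[OF c _ h]) blast
    show ?thesis
    proof (rule Bochner_Integration.integrable_bound[OF integrable_mult_left[OF w[of n], of "of_real (h * B)"]])
      show "(\<lambda>t. w n t * exp_moment h c t) \<in> borel_measurable lborel"
        using meas[OF c] borel_measurable_integrable[OF w] by simp
      show "AE t in lborel. norm (w n t * exp_moment h c t) \<le> norm (w n t * of_real (h * B))"
        using order_trans[OF B abs_ge_self] by (intro AE_I2) (simp add: norm_mult mult_left_mono flip: abs_mult)
    qed
  qed
  have add: "exp_moment h (\<lambda>y. c y + d y) t = exp_moment h c t + exp_moment h d t"
    if "continuous_on {0..h} c" "continuous_on {0..h} d" for c d t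
    unfolding exp_moment_def distrib_right
    by (intro Henstock_Kurzweil_Integration.integral_add exp_moment_integrable that)
  \<comment> \<open>The functionals are placed on the bounded continuous functions on the whole
    line, a complete space, although the integral sees only \<open>[0, h]\<close>.\<close>
  define f where "f = (\<lambda>n (c::real \<Rightarrow>\<^sub>C complex). LINT t|lborel. w n t * exp_moment h c t)"
  have "bounded_linear (f n)" for n
  proof (rule bounded_linear_intro[where K = "h * (LINT t|lborel. norm (w n t))"])
    fix c d :: "real \<Rightarrow>\<^sub>C complex" and r :: real
    show "f n (c + d) = f n c + f n d"
      by (simp add: f_def add distrib_left Bochner_Integration.integral_add int)
    show "f n (r *\<^sub>R c) = r *\<^sub>R f n c"
      by (simp add: f_def exp_moment_def)
    have "norm (f n c) \<le> (LINT t|lborel. norm (w n t) * (h * norm c))"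
      unfolding f_def
    proof (rule order_trans[OF integral_norm_bound integral_mono])
      show "norm (w n t * exp_moment h c t) \<le> norm (w n t) * (h * norm c)" for t
        using norm_exp_moment_le[of h c "norm c" t] h norm_bounded[of c]
        by (auto simp: norm_mult intro!: mult_left_mono)
    qed (use int w in auto)
    then show "norm (f n c) \<le> norm c * (h * (LINT t|lborel. norm (w n t)))"
      by (simp add: mult_ac)
  qed
  moreover have "\<exists>k. \<forall>n. norm (f n c) \<le> k" for c
  proof -
    obtain L where "(\<lambda>n. f n c) \<longlonglongrightarrow> L"
      using conv[OF continuous_on_apply_bcontfun] unfolding f_def convergent_def by blast
    from convergent_imp_bounded[OF this] show ?thesis unfolding bounded_iff by blast
  qed
  ultimately obtain B where B: "\<And>n c. norm (f n c) \<le> B * norm c"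
    using uniform_boundedness[of f] by blast
  define e where "e = (\<lambda>n y. complex_of_real (exp (\<sigma> n * y)) - 1)"
  have e_cont: "continuous_on S (e n)" for n S unfolding e_def by (intro continuous_intros)
  have e_le: "norm (LINT t|lborel. w n t * exp_moment h (e n) t) \<le> \<bar>B\<bar> * (exp (\<sigma> n * h) - 1)" for n
  proof -
    \<comment> \<open>Clamping extends \<open>e n\<close> from \<open>[0, h]\<close> to the line
      without enlarging its supremum, which is at most \<open>exp (\<sigma> n * h) - 1\<close> and
      so tends to 0.\<close>
    obtain g :: "real \<Rightarrow>\<^sub>C complex" where g: "\<And>x. x \<in> cbox 0 h \<Longrightarrow> g x = e n x"
      "\<And>x. g x = e n (clamp 0 h x)"
      using continuous_on_cbox_bcontfunE[OF e_cont] by blast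
    have "norm (g x) \<le> exp (\<sigma> n * h) - 1" for x
    proof -
      have "clamp 0 h x \<in> cbox 0 h" using h by (intro clamp_in_interval) auto
      then have y: "0 \<le> clamp 0 h x" "clamp 0 h x \<le> h" by auto
      have "norm (g x) = \<bar>exp (\<sigma> n * clamp 0 h x) - 1\<bar>"
        unfolding g(2) e_def by (metis norm_of_real of_real_1 of_real_diff)
      also have "\<dots> = exp (\<sigma> n * clamp 0 h x) - 1" using y \<sigma>(1)[of n] by simp
      also have "\<dots> \<le> exp (\<sigma> n * h) - 1" using y \<sigma>(1)[of n] by (simp add: mult_left_mono)
      finally show ?thesis .
    qed
    then have "norm g \<le> exp (\<sigma> n * h) - 1" by (rule norm_bound)
    then have "B * norm g \<le> \<bar>B\<bar> * (exp (\<sigma> n * h) - 1)"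
      by (intro mult_mono) auto
    moreover have "exp_moment h g = exp_moment h (e n)"
      unfolding exp_moment_def using g(1) by (intro ext Henstock_Kurzweil_Integration.integral_cong) simp
    ultimately show ?thesis using B[of n g] unfolding f_def by simp
  qed
  have "(\<lambda>n. \<bar>B\<bar> * (exp (\<sigma> n * h) - 1)) \<longlonglongrightarrow> \<bar>B\<bar> * (exp (0 * h) - 1)"
    by (intro tendsto_intros \<sigma>(2))
  then have "(\<lambda>n. \<bar>B\<bar> * (exp (\<sigma> n * h) - 1)) \<longlonglongrightarrow> 0" by simp
  from Lim_null_comparison[OF always_eventually[OF allI[OF e_le]] this]
  have e_lim: "(\<lambda>n. LINT t|lborel. w n t * exp_moment h (e n) t) \<longlonglongrightarrow> 0" .
  have "(LINT t|lborel. w n t * exp_moment h (\<lambda>y. of_real (exp (\<sigma> n * y))) t) =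
      (LINT t|lborel. w n t * exp_moment h (\<lambda>y. 1) t) + (LINT t|lborel. w n t * exp_moment h (e n) t)" for n
  proof -
    have "exp_moment h (\<lambda>y. 1 + e n y) t = exp_moment h (\<lambda>y. 1) t + exp_moment h (e n) t" for t
      by (rule add) (intro continuous_intros e_cont)+
    then show ?thesis
      by (subst Bochner_Integration.integral_add[symmetric])
         (auto intro!: int continuous_intros simp: e_def distrib_left)
  qed
  then show ?thesis using tendsto_add[OF lim e_lim] by simp
qed

section \<open>Laplace transforms and their boundary values\<close>

text \<open>The absolutely convergent Laplace transform; for functions vanishing on the negative
  half-line it agrees with the improper one.\<close>

definition lap :: "(real \<Rightarrow> complex) \<Rightarrow> complex \<Rightarrow> complex" where
  "lap p s = (LINT x|lborel. p x * exp (- s * of_real x))"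

text \<open>The Laplace transform of \<open>p\<close> on the vertical line with real part
  \<open>\<sigma>\<close> is the Fourier transform of this function.\<close>

definition lap_line :: "(real \<Rightarrow> complex) \<Rightarrow> real \<Rightarrow> real \<Rightarrow> complex" where
  "lap_line p \<sigma> x = p x * of_real (exp (- \<sigma> * x))"

lemma lap_eq_fourier: "lap p (of_real \<sigma> + \<i> * of_real t) = fourier (lap_line p \<sigma>) t"
  unfolding lap_def fourier_def lap_line_def
  by (intro Bochner_Integration.integral_cong refl)
     (simp add: exp_of_real[symmetric] exp_add[symmetric] exp_minus exp_diff field_simps)

lemma integrable_lap_integrand:
  assumes "integrable lborel (lap_line p (Re s))"
  shows "integrable lborel (\<lambda>x. p x * exp (- s * of_real x))"
proof -
  have "(\<lambda>x. p x * exp (- s * of_real x)) = (\<lambda>x. exp (- \<i> * of_real (Im s * x)) * lap_line p (Re s) x)"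
  proof
    fix x
    have "- s * of_real x = - \<i> * of_real (Im s * x) + of_real (- Re s * x)"
      by (simp add: complex_eq_iff)
    then have "exp (- s * of_real x) = exp (- \<i> * of_real (Im s * x)) * of_real (exp (- Re s * x))"
      by (simp only: exp_add exp_of_real)
    then show "p x * exp (- s * of_real x) = exp (- \<i> * of_real (Im s * x)) * lap_line p (Re s) x"
      by (simp add: lap_line_def)
  qed
  then show ?thesis
    using integrable_fourier_integrand[OF assms, of "Im s"] by simp
qed

text \<open>The exchange moves the Fourier transform onto the test function, so that the limit in
  \<open>\<sigma>\<close> can be taken under an integral in \<open>x\<close>.\<close>

lemma lap_fubini:
  assumes p: "integrable lborel (lap_line p \<sigma>)" and \<phi>: "integrable lborel \<phi>"
  shows "(LINT t|lborel. lap p (of_real \<sigma> + \<i> * of_real t) * \<phi> t) =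
    (LINT x|lborel. lap_line p \<sigma> x * fourier \<phi> x)"
proof -
  have "(LINT t|lborel. lap p (of_real \<sigma> + \<i> * of_real t) * \<phi> t) =
      (LINT t|lborel. \<phi> t * (LINT x|lborel. lap_line p \<sigma> x * exp (- \<i> * of_real (t * x))))"
    unfolding lap_eq_fourier fourier_def
    by (intro Bochner_Integration.integral_cong refl) (simp add: mult.commute)
  also have "\<dots> = (LINT x|lborel. lap_line p \<sigma> x * (LINT t|lborel. \<phi> t * exp (- \<i> * of_real (t * x))))"
    by (rule fubini_bounded_kernel[OF \<phi> p, where B = 1]) auto
  also have "\<dots> = (LINT x|lborel. lap_line p \<sigma> x * fourier \<phi> x)"
    unfolding fourier_def by (simp add: mult.commute)
  finally show ?thesis .
qed

lemma continuous_lap_line: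
  assumes "integrable lborel (lap_line p \<sigma>)"
  shows "continuous_on S (\<lambda>t. lap p (of_real \<sigma> + \<i> * of_real t))"
  unfolding lap_eq_fourier using continuous_on_subset[OF continuous_fourier[OF assms]] by blast

lemma fourier_modulate: "fourier (\<lambda>t. exp (\<i> * of_real (h * t)) * \<phi> t) x = fourier \<phi> (x - h)"
  unfolding fourier_def
  by (intro Bochner_Integration.integral_cong refl)
     (simp add: exp_add[symmetric] exp_diff exp_minus field_simps left_diff_distrib)

lemma integrable_linear_exp:
  fixes \<sigma> :: real assumes "0 < \<sigma>"
  shows "integrable lborel (\<lambda>x. indicator {0..} x * ((1 + x) * exp (- \<sigma> * x)) :: real)"
proof -
  have 1: "integrable lborel (\<lambda>x. exp (- x) * x ^ k * indicator {0..} x :: real)" for k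
    using has_bochner_integral_I0i_power_exp_m'[of k] by (simp add: has_bochner_integral_iff mult_ac)
  have "integrable lborel (\<lambda>x. exp (- (0 + \<sigma> * x)) * (0 + \<sigma> * x) ^ 0 * indicator {0..} (0 + \<sigma> * x) :: real)"
    "integrable lborel (\<lambda>x. exp (- (0 + \<sigma> * x)) * (0 + \<sigma> * x) ^ 1 * indicator {0..} (0 + \<sigma> * x) :: real)"
    using assms by (intro lborel_integrable_real_affine 1; simp)+
  from Bochner_Integration.integrable_add[OF this(1) integrable_mult_right[OF this(2), of "1 / \<sigma>"]]
  show ?thesis
    by (rule back_subst[where P = "integrable lborel"])
       (use assms in \<open>auto simp: fun_eq_iff indicator_def field_simps zero_le_mult_iff\<close>)
qed

lemma integrable_lap_line_growth:
  assumes [measurable]: "p \<in> borel_measurable borel" and "\<And>x. x < 0 \<Longrightarrow> p x = 0"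
    and B: "\<And>x. 0 \<le> x \<Longrightarrow> norm (p x) \<le> B * (1 + x)" and \<sigma>: "0 < \<sigma>"
  shows "integrable lborel (lap_line p \<sigma>)"
proof (rule Bochner_Integration.integrable_bound)
  show "integrable lborel (\<lambda>x. B * (indicator {0..} x * ((1 + x) * exp (- \<sigma> * x))))"
    by (intro integrable_mult_right integrable_linear_exp \<sigma>)
  show "AE x in lborel. norm (lap_line p \<sigma> x) \<le> norm (B * (indicator {0..} x * ((1 + x) * exp (- \<sigma> * x))))"
  proof (intro AE_I2)
    fix x
    show "norm (lap_line p \<sigma> x) \<le> norm (B * (indicator {0..} x * ((1 + x) * exp (- \<sigma> * x))))"
    proof (cases "x < 0")
      case False
      have "norm (p x) * exp (- \<sigma> * x) \<le> \<bar>B * (1 + x)\<bar> * exp (- \<sigma> * x)"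
        using B[of x] False by (intro mult_right_mono) auto
      then show ?thesis
        using False by (simp add: lap_line_def norm_mult abs_mult mult.assoc)
    qed (use assms(2) in \<open>simp add: lap_line_def\<close>)
  qed
  show "lap_line p \<sigma> \<in> borel_measurable lborel" unfolding lap_line_def by measurable
qed

lemma laplace_eq_lap:
  assumes van: "\<And>x. x < 0 \<Longrightarrow> p x = 0" and p: "integrable lborel (lap_line p (Re s))"
  shows "laplace p s = lap p s"
proof -
  have "((\<lambda>T. LINT x|lborel. indicator {..T} x *\<^sub>R (p x * exp (- s * of_real x))) \<longlongrightarrow> lap p s) at_top"
    unfolding lap_def by (rule tendsto_integral_at_top[OF _ integrable_lap_integrand[OF p]]) simp
  moreover have "(LINT x|lborel. indicator {..T} x *\<^sub>R (p x * exp (- s * of_real x))) = laplace_partial p s T" for T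
    unfolding laplace_partial_def set_lebesgue_integral_def
    by (intro Bochner_Integration.integral_cong refl) (use van in \<open>auto simp: indicator_def not_le\<close>)
  ultimately show ?thesis
    unfolding laplace_def by (intro tendsto_Lim) auto
qed

abbreviation boundary_value :: "(complex \<Rightarrow> complex) \<Rightarrow> (real \<Rightarrow> complex) \<Rightarrow> complex \<Rightarrow> bool" where
  "boundary_value F \<phi> l \<equiv>
    ((\<lambda>\<sigma>. LINT t|lborel. F (of_real \<sigma> + \<i> * of_real t) * \<phi> t) \<longlongrightarrow> l) (at_right 0)"

text \<open>On the half-line the damping factor is at most 1, so the undamped integrand
  dominates.\<close>

lemma lap_boundary:
  assumes [measurable]: "p \<in> borel_measurable borel" and van: "\<And>x. x < 0 \<Longrightarrow> p x = 0"
    and p: "\<And>\<sigma>. 0 < \<sigma> \<Longrightarrow> integrable lborel (lap_line p \<sigma>)"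
    and \<phi>: "integrable lborel \<phi>" and p\<phi>: "integrable lborel (\<lambda>x. p x * fourier \<phi> x)"
  shows "boundary_value (lap p) \<phi> (LINT x|lborel. p x * fourier \<phi> x)"
  unfolding tendsto_at_iff_sequentially
proof (intro allI impI)
  fix X :: "nat \<Rightarrow> real" assume X: "\<forall>i. X i \<in> {0<..} - {0}" "X \<longlonglongrightarrow> 0"
  have [measurable]: "fourier \<phi> \<in> borel_measurable borel"
    by (rule borel_measurable_continuous_onI[OF continuous_fourier[OF \<phi>]])
  have "(\<lambda>n. LINT x|lborel. lap_line p (X n) x * fourier \<phi> x) \<longlonglongrightarrow> (LINT x|lborel. p x * fourier \<phi> x)"
  proof (rule integral_dominated_convergence[where w = "\<lambda>x. norm (p x * fourier \<phi> x)"])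
    show "AE x in lborel. (\<lambda>n. lap_line p (X n) x * fourier \<phi> x) \<longlonglongrightarrow> p x * fourier \<phi> x"
    proof (intro AE_I2)
      fix x
      have "(\<lambda>n. p x * of_real (exp (- X n * x)) * fourier \<phi> x) \<longlonglongrightarrow> p x * of_real (exp (- 0 * x)) * fourier \<phi> x"
        by (intro tendsto_intros X(2))
      then show "(\<lambda>n. lap_line p (X n) x * fourier \<phi> x) \<longlonglongrightarrow> p x * fourier \<phi> x"
        by (simp add: lap_line_def)
    qed
    show "AE x in lborel. norm (lap_line p (X n) x * fourier \<phi> x) \<le> norm (p x * fourier \<phi> x)" for n
    proof (intro AE_I2)
      fix x
      show "norm (lap_line p (X n) x * fourier \<phi> x) \<le> norm (p x * fourier \<phi> x)"
      proof (cases "x < 0")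
        case False
        then have "exp (- X n * x) \<le> 1" using X(1) by (simp add: less_imp_le)
        then have "norm (p x) * exp (- X n * x) \<le> norm (p x) * 1" by (intro mult_left_mono) auto
        then show ?thesis by (simp add: lap_line_def norm_mult mult_right_mono)
      qed (use van in \<open>simp add: lap_line_def\<close>)
    qed
    show "(\<lambda>x. lap_line p (X n) x * fourier \<phi> x) \<in> borel_measurable lborel" for n
      unfolding lap_line_def by measurable
  qed (use p\<phi> in auto)
  moreover have "(LINT t|lborel. lap p (of_real (X n) + \<i> * of_real t) * \<phi> t) =
      (LINT x|lborel. lap_line p (X n) x * fourier \<phi> x)" for n
    using X(1) by (intro lap_fubini p \<phi>) auto
  ultimately show "((\<lambda>\<sigma>. LINT t|lborel. lap p (of_real \<sigma> + \<i> * of_real t) * \<phi> t) \<circ> X) \<longlonglongrightarrow>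
      (LINT x|lborel. p x * fourier \<phi> x)"
    by (simp add: o_def)
qed

section \<open>Laplace transforms of primitives of bounded functions\<close>

definition primitive :: "(real \<Rightarrow> complex) \<Rightarrow> real \<Rightarrow> complex" where
  "primitive g x = (LINT y:{0..x}|lborel. g y)"

context
  fixes g :: "real \<Rightarrow> complex" and B :: real
  assumes g_meas [measurable]: "g \<in> borel_measurable borel" and g_le: "\<And>x. norm (g x) \<le> B"
begin

lemma set_integrable_bounded: "set_integrable lborel {a..b} g"
  unfolding set_integrable_def
proof (rule Bochner_Integration.integrable_bound)
  show "integrable lborel (\<lambda>x. B * indicator {a..b} x)"
    by (intro integrable_mult_right) (simp add: emeasure_lborel_Icc_eq)
  show "AE x in lborel. norm (indicator {a..b} x *\<^sub>R g x) \<le> norm (B * indicator {a..b} x)"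
    by (intro AE_I2) (auto simp: indicator_def intro: order_trans[OF g_le abs_ge_self])
qed measurable

lemma norm_set_integral_le:
  assumes "a \<le> b"
  shows "norm (LINT y:{a..b}|lborel. g y) \<le> B * (b - a)"
proof -
  have "norm (LINT y:{a..b}|lborel. g y) \<le> (LINT y|lborel. B * indicator {a..b} y)"
    unfolding set_lebesgue_integral_def
  proof (rule order_trans[OF integral_norm_bound integral_mono])
    show "integrable lborel (\<lambda>y. norm (indicator {a..b} y *\<^sub>R g y))"
      using set_integrable_bounded unfolding set_integrable_def by (rule integrable_norm)
    show "integrable lborel (\<lambda>x. B * indicator {a..b} x)"
      by (intro integrable_mult_right) (simp add: emeasure_lborel_Icc_eq)
  qed (use g_le in \<open>auto simp: indicator_def\<close>)
  then show ?thesis using assms by simp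
qed

lemma primitive_diff:
  assumes "0 \<le> x" "x \<le> y"
  shows "primitive g y - primitive g x = (LINT z:{x..y}|lborel. g z)"
proof -
  have "primitive g y = (LINT z:{0..x} \<union> {x<..y}|lborel. g z)"
    unfolding primitive_def using assms by (simp add: ivl_disj_un_two(8))
  also have "\<dots> = primitive g x + (LINT z:{x<..y}|lborel. g z)"
    unfolding primitive_def
    by (rule set_integral_Un)
       (auto intro: set_integrable_subset[OF set_integrable_bounded[of x y]] set_integrable_bounded)
  also have "(LINT z:{x<..y}|lborel. g z) = (LINT z:{x..y}|lborel. g z)"
    unfolding set_lebesgue_integral_def
    by (rule integral_cong_AE)
       (use AE_lborel_singleton[of x] in \<open>auto simp: indicator_def elim!: eventually_mono\<close>)
  finally show ?thesis by simp
qed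

lemma norm_primitive_diff_le:
  "0 \<le> x \<Longrightarrow> x \<le> y \<Longrightarrow> norm (primitive g y - primitive g x) \<le> B * (y - x)"
  using norm_set_integral_le primitive_diff by simp

lemma primitive_neg: "x < 0 \<Longrightarrow> primitive g x = 0"
  by (simp add: primitive_def set_lebesgue_integral_def)

lemma norm_primitive_le: "0 \<le> x \<Longrightarrow> norm (primitive g x) \<le> B * x"
  using norm_set_integral_le[of 0 x] by (simp add: primitive_def)

lemma primitive_measurable [measurable]: "primitive g \<in> borel_measurable borel"
proof -
  have "(\<lambda>x. LINT y|lborel. (if 0 \<le> y \<and> y \<le> x then g y else 0)) \<in> borel_measurable borel"
    by measurable
  also have "(\<lambda>x. LINT y|lborel. (if 0 \<le> y \<and> y \<le> x then g y else 0)) = primitive g"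
    unfolding primitive_def set_lebesgue_integral_def
    by (intro ext Bochner_Integration.integral_cong refl) (simp add: indicator_def)
  finally show ?thesis .
qed

lemma B_nonneg: "0 \<le> B"
  using order_trans[OF norm_ge_zero g_le] .

lemma integrable_lap_line_primitive: "0 < \<sigma> \<Longrightarrow> integrable lborel (lap_line (primitive g) \<sigma>)"
proof (rule integrable_lap_line_growth[where B = B])
  show "norm (primitive g x) \<le> B * (1 + x)" if "0 \<le> x" for x
    using norm_primitive_le[OF that] B_nonneg by (simp add: algebra_simps)
qed (auto simp: primitive_neg)

text \<open>Fubini on the region \<open>0 \<le> y \<le> x\<close>: the integral of
  \<open>exp (- s * of_real x)\<close> over \<open>x \<ge> y\<close> is
  \<open>exp (- s * of_real y) / s\<close>. The primitive sees only the values of \<open>g\<close>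
  on the half-line, hence the indicator.\<close>

lemma lap_primitive:
  assumes s: "0 < Re s"
  shows "lap (primitive g) s = lap (\<lambda>x. indicator {0..} x * g x) s / s"
proof -
  define \<sigma> where "\<sigma> = Re s"
  have [simp]: "s \<noteq> 0" using s by auto
  define F where "F = (\<lambda>x y. (if 0 \<le> y \<and> y \<le> x then g y * exp (- s * of_real x) else 0))"
  have [measurable]: "(\<lambda>(x, y). F x y) \<in> borel_measurable (lborel \<Otimes>\<^sub>M lborel)"
    unfolding F_def by measurable
  have sec: "F x = (\<lambda>y. (indicator {0..x} y *\<^sub>R g y) * exp (- s * of_real x))" for x
    by (auto simp: F_def indicator_def)
  have sec_int: "integrable lborel (F x)" for x
    unfolding sec using set_integrable_bounded by (intro integrable_mult_left) (simp add: set_integrable_def)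
  have int: "integrable (lborel \<Otimes>\<^sub>M lborel) (\<lambda>(x, y). F x y)"
  proof (rule lborel_pair.Fubini_integrable)
    show "integrable lborel (\<lambda>x. LINT y|lborel. norm (case (x, y) of (x, y) \<Rightarrow> F x y))"
    proof (rule Bochner_Integration.integrable_bound)
      show "integrable lborel (\<lambda>x. B * (indicator {0..} x * ((1 + x) * exp (- \<sigma> * x))))"
        by (intro integrable_mult_right integrable_linear_exp) (use s in \<open>simp add: \<sigma>_def\<close>)
      show "AE x in lborel. norm (LINT y|lborel. norm (case (x, y) of (x, y) \<Rightarrow> F x y)) \<le>
          norm (B * (indicator {0..} x * ((1 + x) * exp (- \<sigma> * x))))"
      proof (intro AE_I2)
        fix x :: real
        have "(LINT y|lborel. norm (F x y)) \<le> (LINT y|lborel. indicator {0..x} y * (B * exp (- \<sigma> * x)))"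
        proof (rule integral_mono)
          show "integrable lborel (\<lambda>y. norm (F x y))" by (rule integrable_norm[OF sec_int])
          show "integrable lborel (\<lambda>y. indicator {0..x} y * (B * exp (- \<sigma> * x)))"
            by (intro integrable_mult_left) (simp add: emeasure_lborel_Icc_eq)
          show "norm (F x y) \<le> indicator {0..x} y * (B * exp (- \<sigma> * x))" for y
            using g_le[of y] by (auto simp: F_def norm_mult \<sigma>_def intro!: mult_right_mono)
        qed
        also have "\<dots> \<le> B * (indicator {0..} x * ((1 + x) * exp (- \<sigma> * x)))"
          using B_nonneg by (cases "0 \<le> x") (auto simp: mult_ac intro!: mult_left_mono)
        finally have "(LINT y|lborel. norm (F x y)) \<le> B * (indicator {0..} x * ((1 + x) * exp (- \<sigma> * x)))" .
        moreover have "0 \<le> (LINT y|lborel. norm (F x y))"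
          by (intro Bochner_Integration.integral_nonneg) auto
        ultimately show "norm (LINT y|lborel. norm (case (x, y) of (x, y) \<Rightarrow> F x y)) \<le>
          norm (B * (indicator {0..} x * ((1 + x) * exp (- \<sigma> * x))))" by simp
      qed
    qed measurable
  qed (use sec_int in auto)
  have "lap (primitive g) s = (LINT x|lborel. LINT y|lborel. F x y)"
    unfolding lap_def sec integral_mult_left_zero by (simp add: primitive_def set_lebesgue_integral_def)
  also have "\<dots> = (LINT y|lborel. LINT x|lborel. F x y)"
    using lborel_pair.Fubini_integral[OF int] by simp
  also have "\<dots> = (LINT y|lborel. (indicator {0..} y * g y * exp (- s * of_real y)) * (1 / s))"
  proof (intro Bochner_Integration.integral_cong refl)
    fix y :: real
    show "(LINT x|lborel. F x y) = (indicator {0..} y * g y * exp (- s * of_real y)) * (1 / s)"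
    proof (cases "0 \<le> y")
      case True
      define E where "E = (\<lambda>x. indicator {y..} x *\<^sub>R exp (- s * of_real x))"
      have E_int: "integrable lborel E"
        unfolding E_def
      proof (rule Bochner_Integration.integrable_bound)
        show "integrable lborel (\<lambda>x. indicator {0..} x * ((1 + x) * exp (- \<sigma> * x)) :: real)"
          by (intro integrable_linear_exp) (use s in \<open>simp add: \<sigma>_def\<close>)
        show "AE x in lborel. norm (indicator {y..} x *\<^sub>R exp (- s * of_real x)) \<le>
            norm (indicator {0..} x * ((1 + x) * exp (- \<sigma> * x)))"
          using True by (intro AE_I2) (auto simp: indicator_def \<sigma>_def abs_mult)
      qed measurable
      have "((\<lambda>T. LINT x|lborel. indicator {..T} x *\<^sub>R E x) \<longlongrightarrow> (LINT x|lborel. E x)) at_top"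
        by (rule tendsto_integral_at_top[OF _ E_int]) simp
      moreover have "\<forall>\<^sub>F T in at_top. (exp (- s * of_real y) - exp (- s * of_real T)) / s =
          (LINT x|lborel. indicator {..T} x *\<^sub>R E x)"
        using eventually_ge_at_top[of y]
      proof eventually_elim
        case (elim T)
        have "has_bochner_integral lborel (\<lambda>x. indicator {y..T} x *\<^sub>R exp (- s * of_real x))
            (- exp (- s * of_real T) / s - - exp (- s * of_real y) / s)"
        proof (rule has_bochner_integral_FTC_Icc[OF elim])
          fix x
          have "((\<lambda>z. - exp (- s * z) / s) has_field_derivative exp (- s * of_real x)) (at (of_real x))"
            by (auto intro!: derivative_eq_intros)
          then show "((\<lambda>x. - exp (- s * of_real x) / s) has_vector_derivative exp (- s * of_real x)) (at x within {y..T})"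
            by (rule has_vector_derivative_real_field)
        qed (intro continuous_intros)
        moreover have "(\<lambda>x. indicator {y..T} x *\<^sub>R exp (- s * of_real x)) = (\<lambda>x. indicator {..T} x *\<^sub>R E x)"
          by (auto simp: E_def indicator_def)
        ultimately show ?case
          by (simp add: has_bochner_integral_iff diff_divide_distrib)
      qed
      then have "((\<lambda>T. LINT x|lborel. indicator {..T} x *\<^sub>R E x) \<longlongrightarrow> (exp (- s * of_real y) - 0) / s) at_top"
      proof (rule Lim_transform_eventually[rotated])
        have "((\<lambda>T. exp (- s * of_real T)) \<longlongrightarrow> 0) at_top"
        proof (rule tendsto_norm_zero_cancel)
          have "filterlim (\<lambda>T. - Re s * T) at_bot at_top"
            using s by (intro filterlim_tendsto_neg_mult_at_bot[OF tendsto_const _ filterlim_ident]) auto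
          from filterlim_compose[OF exp_at_bot this]
          show "((\<lambda>T. norm (exp (- s * of_real T))) \<longlongrightarrow> 0) at_top" by simp
        qed
        then show "((\<lambda>T. (exp (- s * of_real y) - exp (- s * of_real T)) / s) \<longlongrightarrow> (exp (- s * of_real y) - 0) / s) at_top"
          by (intro tendsto_intros) auto
      qed
      ultimately have "(LINT x|lborel. E x) = exp (- s * of_real y) / s"
        using tendsto_unique[OF trivial_limit_at_top_linorder] by fastforce
      moreover have "(\<lambda>x. F x y) = (\<lambda>x. g y * E x)"
        using True by (auto simp: F_def E_def indicator_def)
      ultimately show ?thesis using True by simp
    qed (simp add: F_def)
  qed
  also have "\<dots> = lap (\<lambda>x. indicator {0..} x * g x) s / s"
    unfolding integral_mult_left_zero lap_def by simp
  finally show ?thesis .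
qed

end

section \<open>Consequences of the one-sided condition\<close>

lemma bdd_decreasing_realD:
  assumes "bdd_decreasing_real f"
  obtains X C where "0 \<le> X" "1 \<le> C" "\<And>x y. X \<le> x \<Longrightarrow> x \<le> y \<Longrightarrow> - C * (y - x + 1) \<le> f y - f x"
proof -
  obtain \<delta> where \<delta>: "0 < \<delta>" and
    L: "- \<infinity> < Liminf at_top (\<lambda>x. INF h\<in>{0..\<delta>}. ereal (f (x + h) - f x))"
    using assms unfolding bdd_decreasing_real_def by blast
  obtain m where "ereal m < Liminf at_top (\<lambda>x. INF h\<in>{0..\<delta>}. ereal (f (x + h) - f x))"
    using ereal_dense2[OF L] by blast
  from less_LiminfD[OF this] obtain X0 where
    X0: "\<And>x. X0 \<le> x \<Longrightarrow> ereal m < (INF h\<in>{0..\<delta>}. ereal (f (x + h) - f x))"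
    unfolding eventually_at_top_linorder by blast
  have short: "- \<bar>m\<bar> \<le> f (x + h) - f x" if "X0 \<le> x" "0 \<le> h" "h \<le> \<delta>" for x h
  proof -
    have "(INF h\<in>{0..\<delta>}. ereal (f (x + h) - f x)) \<le> ereal (f (x + h) - f x)"
      using that by (intro INF_lower) auto
    with X0[OF that(1)] have "ereal m < ereal (f (x + h) - f x)" by (rule less_le_trans)
    then show ?thesis by simp
  qed
  \<comment> \<open>Chains \<open>n\<close> steps of length \<open>\<delta>\<close> and a shorter
    last one. Bounding a step by \<open>- \<bar>m\<bar>\<close> instead of \<open>m\<close> makes
    the accumulated bound decrease with the number of steps.\<close>
  have long: "- \<bar>m\<bar> * (real n + 1) \<le> f (x + real n * \<delta> + h) - f x" if "X0 \<le> x" "0 \<le> h" "h \<le> \<delta>" for x n h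
  proof (induction n)
    case 0
    then show ?case using short[OF that] by simp
  next
    case (Suc n)
    have "- \<bar>m\<bar> \<le> f ((x + real n * \<delta> + h) + \<delta>) - f (x + real n * \<delta> + h)"
      using that \<delta> by (intro short) (auto intro!: add_increasing2)
    moreover have "x + real (Suc n) * \<delta> + h = (x + real n * \<delta> + h) + \<delta>"
      by (simp add: algebra_simps)
    ultimately show ?case
      using Suc by (simp only:) (simp add: algebra_simps)
  qed
  \<comment> \<open>A distance \<open>y - x\<close> takes at most
    \<open>(y - x) / \<delta> + 1\<close> steps, which is below
    \<open>(1 / \<delta> + 1) * (y - x + 1)\<close>; the summand 1 secures
    \<open>1 \<le> C\<close>.\<close>
  define C where "C = 1 + \<bar>m\<bar> * (1 / \<delta> + 1)"
  show ?thesis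
  proof (rule that[of "max 0 X0" C])
    show "1 \<le> C" using \<delta> by (simp add: C_def)
    fix x y assume xy: "max 0 X0 \<le> x" "x \<le> y"
    define n where "n = nat \<lfloor>(y - x) / \<delta>\<rfloor>"
    have n: "real n \<le> (y - x) / \<delta>" "(y - x) / \<delta> \<le> real n + 1"
    proof -
      have "0 \<le> (y - x) / \<delta>" using xy \<delta> by simp
      then have "real n = of_int \<lfloor>(y - x) / \<delta>\<rfloor>" by (simp add: n_def)
      then show "real n \<le> (y - x) / \<delta>" "(y - x) / \<delta> \<le> real n + 1" by linarith+
    qed
    then have "real n * \<delta> \<le> y - x" "y - x \<le> real n * \<delta> + \<delta>"
      using \<delta> by (auto simp: field_simps)
    then have "- \<bar>m\<bar> * (real n + 1) \<le> f (x + real n * \<delta> + (y - x - real n * \<delta>)) - f x"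
      using xy by (intro long) auto
    then have 1: "- \<bar>m\<bar> * (real n + 1) \<le> f y - f x" by simp
    have "\<bar>m\<bar> * (real n + 1) \<le> \<bar>m\<bar> * ((1 / \<delta> + 1) * (y - x + 1))"
    proof (rule mult_left_mono)
      have "real n + 1 \<le> (y - x) / \<delta> + 1" using n by simp
      also have "\<dots> \<le> (y - x) / \<delta> + 1 + (1 / \<delta> + (y - x))" using xy \<delta> by simp
      also have "\<dots> = (1 / \<delta> + 1) * (y - x + 1)"
        by (simp add: algebra_simps add_divide_distrib diff_divide_distrib)
      finally show "real n + 1 \<le> (1 / \<delta> + 1) * (y - x + 1)" .
    qed simp
    also have "\<dots> \<le> C * (y - x + 1)"
      unfolding C_def using xy by (subst mult.assoc[symmetric], intro mult_right_mono) auto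
    finally show "- C * (y - x + 1) \<le> f y - f x" using 1 by simp
  qed simp
qed

text \<open>Convergence of an improper integral does not by itself give absolute integrability. Here
  \<open>u x + C' * (1 + x)\<close> is nonnegative from \<open>X\<close> on and
  \<open>(1 + x) * exp (- \<sigma> * x)\<close> is integrable; with this added, the truncated
  integrals increase to a finite limit and monotone convergence applies.\<close>

lemma integrable_exp_of_slow:
  fixes u :: "real \<Rightarrow> real"
  assumes [measurable]: "u \<in> borel_measurable borel" and loc: "\<And>a b. set_integrable lborel {a..b} u"
    and van: "\<And>x. x < 0 \<Longrightarrow> u x = 0" and X: "0 \<le> X" and C: "1 \<le> C"
    and slow: "\<And>x y. X \<le> x \<Longrightarrow> x \<le> y \<Longrightarrow> - C * (y - x + 1) \<le> u y - u x"
    and \<sigma>: "0 < \<sigma>" and conv: "((\<lambda>T. LINT x:{0..T}|lborel. u x * exp (- \<sigma> * x)) \<longlongrightarrow> L) at_top"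
  shows "integrable lborel (\<lambda>x. u x * exp (- \<sigma> * x))"
proof -
  define C' where "C' = \<bar>u X\<bar> + C"
  define e where "e = (\<lambda>x. indicator {X..} x * ((1 + x) * exp (- \<sigma> * x)) :: real)"
  have e_int: "integrable lborel e"
    by (rule Bochner_Integration.integrable_bound[OF integrable_linear_exp[OF \<sigma>]])
       (use X in \<open>auto simp: e_def indicator_def\<close>)
  have loc_exp: "set_integrable lborel {0..b} (\<lambda>x. u x * exp (- \<sigma> * x))" for b
    unfolding set_integrable_def
  proof (rule Bochner_Integration.integrable_bound)
    show "integrable lborel (\<lambda>x. indicator {0..b} x *\<^sub>R u x)" using loc by (simp add: set_integrable_def)
    show "AE x in lborel. norm (indicator {0..b} x *\<^sub>R (u x * exp (- \<sigma> * x))) \<le> norm (indicator {0..b} x *\<^sub>R u x)"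
      using \<sigma> by (intro AE_I2) (auto simp: indicator_def abs_mult intro!: mult_left_le)
  qed measurable
  define v where "v = (\<lambda>x. u x * exp (- \<sigma> * x))"
  have v_loc: "integrable lborel (\<lambda>x. indicator {0..b} x * v x)" for b
    using loc_exp unfolding set_integrable_def v_def by simp
  \<comment> \<open>The part on \<open>[0, X)\<close>, where the one-sided condition is silent; it
    is integrable by local integrability.\<close>
  define v0 where "v0 = (\<lambda>x. indicator {..<X} x * (indicator {0..X} x * v x))"
  have v0_int: "integrable lborel v0"
    by (rule Bochner_Integration.integrable_bound[OF v_loc[of X]])
       (auto simp: v0_def indicator_def v_def)
  define w where "w = (\<lambda>x. indicator {X..} x * v x + C' * e x)"
  have w_eq: "w x = v x - v0 x + C' * e x" for x
    using van[of x] by (auto simp: w_def v0_def indicator_def v_def)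
  have w0: "0 \<le> w x" for x
  proof (cases "X \<le> x")
    case True
    have "- C * (x - X + 1) \<le> u x - u X" using True by (intro slow) auto
    moreover have "C * (x - X + 1) \<le> C * (1 + x)" using X C by (intro mult_left_mono) auto
    moreover have "\<bar>u X\<bar> * 1 \<le> \<bar>u X\<bar> * (1 + x)" using True X by (intro mult_left_mono) auto
    ultimately have "0 \<le> u x + C' * (1 + x)" by (simp add: C'_def algebra_simps)
    then have "0 \<le> (u x + C' * (1 + x)) * exp (- \<sigma> * x)" by simp
    then show ?thesis using True by (simp add: w_def e_def v_def algebra_simps)
  qed (simp add: w_def e_def)
  have [measurable]: "w \<in> borel_measurable borel" unfolding w_def e_def v_def by measurable
  have w_cut: "w x * indicator {..T} x = indicator {0..T} x * v x - indicator {..T} x *\<^sub>R v0 x + C' * (indicator {..T} x *\<^sub>R e x)" for x T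
    unfolding w_eq using van[of x] by (auto simp: indicator_def v_def v0_def)
  have cut_int: "integrable lborel (\<lambda>x. indicator {..T} x *\<^sub>R p x)" if "integrable lborel p" for p :: "real \<Rightarrow> real" and T
    using integrable_mult_indicator[OF _ that, of "{..T}"] by simp
  have w_int: "integrable lborel w"
  proof (rule integrable_monotone_convergence_at_top)
    show "integrable lborel (\<lambda>x. w x * indicator {..T} x)" for T
      unfolding w_cut
      by (intro Bochner_Integration.integrable_add Bochner_Integration.integrable_diff
          integrable_mult_right cut_int v_loc v0_int e_int)
    have "(LINT x|lborel. w x * indicator {..T} x) = (LINT x:{0..T}|lborel. u x * exp (- \<sigma> * x))
        - (LINT x|lborel. indicator {..T} x *\<^sub>R v0 x) + C' * (LINT x|lborel. indicator {..T} x *\<^sub>R e x)" for T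
      unfolding w_cut set_lebesgue_integral_def
      by (subst Bochner_Integration.integral_add Bochner_Integration.integral_diff,
          (intro Bochner_Integration.integrable_diff integrable_mult_right cut_int v_loc v0_int e_int)+)+
         (simp add: v_def)
    then show "((\<lambda>T. LINT x|lborel. w x * indicator {..T} x) \<longlongrightarrow>
        L - (LINT x|lborel. v0 x) + C' * (LINT x|lborel. e x)) at_top"
      by (simp only:) (intro tendsto_intros conv tendsto_integral_at_top v0_int e_int; simp)
  qed (use w0 in auto)
  have "integrable lborel (\<lambda>x. w x + v0 x - C' * e x)"
    by (intro Bochner_Integration.integrable_add Bochner_Integration.integrable_diff
        integrable_mult_right w_int v0_int e_int)
  then show ?thesis by (simp add: w_eq v_def)
qed

section \<open>Boundary values as Fourier transforms of bounded functions\<close>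

lemma Linf_bounded_representative:
  assumes "Linf h"
  obtains h' B where "h' \<in> borel_measurable borel" "\<And>x. norm (h' x) \<le> B"
    "\<And>\<phi> U. test_fun U \<phi> \<Longrightarrow> pseudomeasure_action h \<phi> = pseudomeasure_action h' \<phi>"
proof -
  from assms obtain C where [measurable]: "h \<in> borel_measurable borel" and C: "AE x in lborel. norm (h x) \<le> C"
    unfolding Linf_def by auto
  define h' where "h' = (\<lambda>x. if norm (h x) \<le> C then h x else 0)"
  show ?thesis
  proof (rule that[of h' "\<bar>C\<bar>"])
    show [measurable]: "h' \<in> borel_measurable borel" unfolding h'_def by measurable
    show "norm (h' x) \<le> \<bar>C\<bar>" for x by (auto simp: h'_def)
    fix \<phi> U assume \<phi>: "test_fun U \<phi>"
    have [measurable]: "fourier \<phi> \<in> borel_measurable borel"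
      by (rule borel_measurable_continuous_onI[OF continuous_fourier[OF test_fun_integrable[OF \<phi>]]])
    show "pseudomeasure_action h \<phi> = pseudomeasure_action h' \<phi>"
      unfolding pseudomeasure_action_def inv_fourier_eq
      by (rule integral_cong_AE) (use C in \<open>auto simp: h'_def elim!: eventually_mono\<close>)
  qed
qed

text \<open>Reflection and division by 2 pi turn the action into the pairing of a bounded function
  with \<open>fourier \<phi>\<close>, which exhibits the distribution as the Fourier transform of
  that function. Boundary values are written in this form from here on.\<close>

lemma pseudomeasure_action_reflect:
  "pseudomeasure_action h \<phi> = (LINT x|lborel. h (- x) / of_real (2 * pi) * fourier \<phi> x)"
  unfolding pseudomeasure_action_def inv_fourier_eq
  by (subst lborel_integral_reflect[symmetric]) simp

lemma pseudomeasure_boundaryD: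
  assumes "pseudomeasure_boundary F"
  obtains d h B where "0 < d" "h \<in> borel_measurable borel" "\<And>x. norm (h x) \<le> B"
    "\<And>\<phi>. test_fun {-d<..<d} \<phi> \<Longrightarrow>
      boundary_value F \<phi> (LINT x|lborel. h x * fourier \<phi> x)"
proof -
  from assms obtain a b T where ab: "a < 0" "0 < b" and T: "dist_boundary_limit F {a<..<b} T"
    and loc: "\<forall>t0\<in>{a<..<b}. \<exists>W. open W \<and> t0 \<in> W \<and> W \<subseteq> {a<..<b} \<and>
        (\<exists>h. Linf h \<and> (\<forall>\<phi>. test_fun W \<phi> \<longrightarrow> T \<phi> = pseudomeasure_action h \<phi>))"
    unfolding pseudomeasure_boundary_def by blast
  from loc ab have "\<exists>W. open W \<and> 0 \<in> W \<and> W \<subseteq> {a<..<b} \<and>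
        (\<exists>h. Linf h \<and> (\<forall>\<phi>. test_fun W \<phi> \<longrightarrow> T \<phi> = pseudomeasure_action h \<phi>))"
    by (rule_tac bspec) auto
  then obtain W h where W: "open W" "0 \<in> W" "W \<subseteq> {a<..<b}" and h: "Linf h"
    "\<And>\<phi>. test_fun W \<phi> \<Longrightarrow> T \<phi> = pseudomeasure_action h \<phi>"
    by blast
  obtain d where d: "0 < d" "ball 0 d \<subseteq> W"
    using W(1,2) openE by blast
  have dW: "{-d<..<d} \<subseteq> W"
    using d(2) by (auto simp: subset_eq dist_real_def)
  obtain h' B where h': "h' \<in> borel_measurable borel" "\<And>x. norm (h' x) \<le> B"
    "\<And>\<phi> U. test_fun U \<phi> \<Longrightarrow> pseudomeasure_action h \<phi> = pseudomeasure_action h' \<phi>"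
    using Linf_bounded_representative[OF h(1)] by blast
  note [measurable] = h'(1)
  show ?thesis
  proof (rule that[OF d(1), of "\<lambda>x. h' (- x) / of_real (2 * pi)" "B / (2 * pi)"])
    show "norm (h' (- x) / of_real (2 * pi)) \<le> B / (2 * pi)" for x
      using h'(2)[of "- x"] by (simp add: norm_divide divide_right_mono)
    fix \<phi> assume \<phi>: "test_fun {-d<..<d} \<phi>"
    have W\<phi>: "test_fun W \<phi>" using \<phi> dW test_fun_mono by blast
    have "T \<phi> = (LINT x|lborel. h' (- x) / of_real (2 * pi) * fourier \<phi> x)"
      unfolding h(2)[OF W\<phi>] h'(3)[OF W\<phi>] by (rule pseudomeasure_action_reflect)
    moreover have "test_fun {a<..<b} \<phi>" using W\<phi> W(3) test_fun_mono by blast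
    ultimately show "boundary_value F \<phi> (LINT x|lborel. h' (- x) / of_real (2 * pi) * fourier \<phi> x)"
      using T[unfolded dist_boundary_limit_def, rule_format, of \<phi>] by simp
  qed measurable
qed

lemma pseudomeasure_boundaryI:
  assumes [measurable]: "h \<in> borel_measurable borel" and B: "\<And>x. norm (h x) \<le> B" and d: "0 < d"
    and lim: "\<And>\<phi>. test_fun {-d<..<d} \<phi> \<Longrightarrow>
      boundary_value F \<phi> (LINT x|lborel. h x * fourier \<phi> x)"
  shows "pseudomeasure_boundary F"
proof -
  define h' where "h' = (\<lambda>x. of_real (2 * pi) * h (- x))"
  have act: "pseudomeasure_action h' \<phi> = (LINT x|lborel. h x * fourier \<phi> x)" for \<phi>
    unfolding pseudomeasure_action_reflect h'_def by simp
  have "Linf h'"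
    unfolding Linf_def
  proof
    show "h' \<in> borel_measurable lborel" unfolding h'_def by measurable
    show "\<exists>C. AE x in lborel. norm (h' x) \<le> C"
      by (rule exI[of _ "2 * pi * B"], rule AE_I2) (simp add: h'_def norm_mult B)
  qed
  then show ?thesis
    unfolding pseudomeasure_boundary_def dist_boundary_limit_def
    using d lim act
    by (intro exI[of _ "-d"] exI[of _ d] exI[of _ "pseudomeasure_action h'"] conjI ballI
        exI[of _ "{-d<..<d}"] exI[of _ h']) (auto simp del: greaterThanLessThan_iff)
qed

context decaying_kernel
begin

text \<open>Below \<open>X\<close> the function is merely integrable. Its averages there are at most
  \<open>D\<close> times its integral norm, uniformly in \<open>h\<close>, and they converge as the
  damping disappears; subtracting them leaves a function that vanishes before \<open>X\<close> and
  still has bounded limits.\<close>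

lemma bounded_above_cutoff:
  fixes v :: "real \<Rightarrow> real" and L :: "real \<Rightarrow> real"
  assumes v_meas [measurable]: "v \<in> borel_measurable borel"
    and v0: "\<And>x. x < 0 \<Longrightarrow> v x = 0" and X: "0 \<le> X" and C: "1 \<le> C"
    and slow: "\<And>x y. X \<le> x \<Longrightarrow> x \<le> y \<Longrightarrow> - C * (y - x + 1) \<le> v y - v x"
    and int: "\<And>s. 0 < s \<Longrightarrow> integrable lborel (\<lambda>x. v x * exp (- s * x))"
    and \<sigma>: "\<And>n. 0 < \<sigma> n" "\<And>n. \<sigma> n \<le> 1" "\<sigma> \<longlonglongrightarrow> 0"
    and lim: "\<And>h. 0 \<le> h \<Longrightarrow> (\<lambda>n. (LINT x|lborel. v x * (exp (- \<sigma> n * (x - h)) * K (x - h)))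
        - (LINT x|lborel. v x * (exp (- \<sigma> n * x) * K x))) \<longlonglongrightarrow> L h"
    and L_le: "\<And>h. 0 \<le> h \<Longrightarrow> \<bar>L h\<bar> \<le> B"
  shows "\<exists>B. \<forall>x\<ge>X. \<bar>v x\<bar> \<le> B"
proof -
  define p where "p = (\<lambda>x. indicator {..<X} x * v x)"
  define u where "u = (\<lambda>x. indicator {X..} x * v x)"
  have v_split: "v x = u x + p x" for x by (simp add: u_def p_def indicator_def)
  have [measurable]: "u \<in> borel_measurable borel" "p \<in> borel_measurable borel"
    unfolding u_def p_def by measurable
  have u_int: "integrable lborel (\<lambda>x. u x * exp (- s * x))" if "0 < s" for s
    by (rule Bochner_Integration.integrable_bound[OF int[OF that]]) (auto simp: u_def indicator_def)
  have p_int: "integrable lborel p"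
  proof (rule Bochner_Integration.integrable_bound)
    show "integrable lborel (\<lambda>x. exp X * (v x * exp (- 1 * x)))" using int[of 1] by simp
    show "AE x in lborel. norm (p x) \<le> norm (exp X * (v x * exp (- 1 * x)))"
    proof (intro AE_I2)
      fix x
      have "\<bar>v x\<bar> * 1 \<le> \<bar>v x\<bar> * exp (X - x)" if "x < X" using that by (intro mult_left_mono) auto
      then show "norm (p x) \<le> norm (exp X * (v x * exp (- 1 * x)))"
        by (auto simp: p_def indicator_def abs_mult exp_diff exp_minus field_simps)
    qed
  qed measurable
  define P where "P = (\<lambda>h. LINT x|lborel. p x * K (x - h))"
  have pK: "integrable lborel (\<lambda>x. p x * K (x - h))" for h
    by (rule Bochner_Integration.integrable_bound[OF integrable_mult_left[OF p_int, of D]])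
       (use K_le_D K_nonneg D_pos in \<open>auto simp: abs_mult intro!: mult_left_mono\<close>)
  have P_le: "\<bar>P h\<bar> \<le> (LINT x|lborel. \<bar>p x\<bar> * D)" for h
    unfolding P_def
  proof (rule order_trans[OF integral_abs_bound integral_mono])
    show "integrable lborel (\<lambda>x. \<bar>p x * K (x - h)\<bar>)" by (intro integrable_abs pK)
    show "integrable lborel (\<lambda>x. \<bar>p x\<bar> * D)" using p_int by (intro integrable_mult_left integrable_abs)
    show "\<bar>p x * K (x - h)\<bar> \<le> \<bar>p x\<bar> * D" for x
      using K_le_D K_nonneg by (simp add: abs_mult mult_left_mono)
  qed
  have p_exp: "integrable lborel (\<lambda>x. p x * exp (- s * x))" if "0 < s" for s
    by (rule Bochner_Integration.integrable_bound[OF int[OF that]]) (auto simp: p_def indicator_def)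
  have p_meas: "p \<in> borel_measurable borel" by measurable
  have P_lim: "(\<lambda>n. LINT x|lborel. p x * (exp (- \<sigma> n * (x - h)) * K (x - h))) \<longlonglongrightarrow> P h" if h: "0 \<le> h" for h
    unfolding P_def by (rule smoothed_limit[OF p_meas _ pK h \<sigma>]) (simp add: p_def v0)
  have u0: "\<And>x. x < X \<Longrightarrow> u x = 0" by (simp add: u_def)
  have u_slow: "\<And>x y. X \<le> x \<Longrightarrow> x \<le> y \<Longrightarrow> - C * (y - x + 1) \<le> u y - u x"
    using slow by (simp add: u_def)
  have u_meas: "u \<in> borel_measurable borel" by measurable
  have split: "(LINT x|lborel. v x * (exp (- \<sigma> n * (x - h)) * K (x - h))) =
      (LINT x|lborel. u x * (exp (- \<sigma> n * (x - h)) * K (x - h))) +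
      (LINT x|lborel. p x * (exp (- \<sigma> n * (x - h)) * K (x - h)))" for n h
    unfolding v_split distrib_right
    by (intro Bochner_Integration.integral_add integrable_smoothed u_meas p_meas u_int p_exp \<sigma>(1))
  have u_lim: "(\<lambda>n. (LINT x|lborel. u x * (exp (- \<sigma> n * (x - h)) * K (x - h)))
        - (LINT x|lborel. u x * (exp (- \<sigma> n * x) * K x))) \<longlonglongrightarrow> L h - (P h - P 0)" if h: "0 \<le> h" for h
  proof -
    have "(\<lambda>n. ((LINT x|lborel. v x * (exp (- \<sigma> n * (x - h)) * K (x - h)))
        - (LINT x|lborel. v x * (exp (- \<sigma> n * x) * K x)))
        - ((LINT x|lborel. p x * (exp (- \<sigma> n * (x - h)) * K (x - h))) -
           (LINT x|lborel. p x * (exp (- \<sigma> n * (x - 0)) * K (x - 0))))) \<longlonglongrightarrow> L h - (P h - P 0)"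
      by (intro tendsto_diff lim[OF h] P_lim h) simp
    then show ?thesis using split[of _ h] split[of _ 0] by simp
  qed
  have "\<bar>L h - (P h - P 0)\<bar> \<le> B + 2 * (LINT x|lborel. \<bar>p x\<bar> * D)" if "0 \<le> h" for h
    using L_le[OF that] P_le[of h] P_le[of 0] by linarith
  from bounded_of_bounded_limit[OF u_meas u0 X C u_slow u_int \<sigma> u_lim this]
  obtain B' where "\<And>x. \<bar>u x\<bar> \<le> B'" by blast
  then show ?thesis
    by (intro exI[of _ B']) (simp add: u_def, metis atLeast_iff indicator_simps(1) mult_1)
qed

end

section \<open>The remainder is bounded\<close>

lemma integrable_continuous_mult_test_fun:
  assumes F: "continuous_on U F" and \<eta>: "test_fun U \<eta>"
  shows "integrable lborel (\<lambda>t. F t * \<eta> t)"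
proof -
  have S: "compact (tsupport \<eta>)" "tsupport \<eta> \<subseteq> U" using \<eta> by (auto simp: test_fun_def)
  have "integrable lborel (\<lambda>t. indicator (tsupport \<eta>) t *\<^sub>R (F t * \<eta> t))"
    by (intro borel_integrable_compact S continuous_intros continuous_on_subset[OF F]
        smooth_fun_continuous test_fun_smooth[OF \<eta>])
  moreover have "(\<lambda>t. indicator (tsupport \<eta>) t *\<^sub>R (F t * \<eta> t)) = (\<lambda>t. F t * \<eta> t)"
    by (auto simp: indicator_def tsupport_eq_0 fun_eq_iff)
  ultimately show ?thesis by simp
qed

lemma exp_moment_1:
  assumes "0 \<le> h"
  shows "\<i> * of_real t * exp_moment h (\<lambda>y. 1) t = exp (\<i> * of_real (h * t)) - 1"
proof (cases "t = 0")
  case False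
  then have "exp_moment h (\<lambda>y. of_real (exp (0 * y))) t = (exp (of_real h * (\<i> * of_real t)) - 1) / (\<i> * of_real t)"
    using assms by (intro exp_moment_exp) auto
  then show ?thesis using False by (simp add: mult_ac)
qed simp

text \<open>Multiplication by \<open>exp (\<i> * of_real (y * t))\<close> translates the transform
  by \<open>y\<close>; Fubini then integrates the translates over \<open>[0, h]\<close>.\<close>

lemma fourier_exp_moment_1:
  assumes \<phi>: "integrable lborel \<phi>" and h: "0 \<le> h"
  shows "fourier (\<lambda>t. exp_moment h (\<lambda>y. 1) t * \<phi> t) x = (LINT y|lborel. indicator {0..h} y * fourier \<phi> (x - y))"
proof -
  define b where "b = (\<lambda>y. complex_of_real (indicator {0..h} y))"
  have b_int: "integrable lborel b"
    unfolding b_def complex_of_real_integrable_eq by (simp add: emeasure_lborel_Icc_eq)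
  have moment: "exp_moment h (\<lambda>y. 1) t = (LINT y|lborel. b y * exp (\<i> * of_real (y * t)))" for t
  proof -
    have "set_integrable lborel {0..h} (\<lambda>y. exp (\<i> * of_real (y * t)))"
      by (intro borel_integrable_atLeastAtMost' continuous_intros)
    from set_borel_integral_eq_integral(2)[OF this]
    show ?thesis
      by (simp add: exp_moment_def set_lebesgue_integral_def b_def scaleR_conv_of_real)
  qed
  have "fourier (\<lambda>t. exp_moment h (\<lambda>y. 1) t * \<phi> t) x =
      (LINT t|lborel. \<phi> t * (LINT y|lborel. b y * (exp (\<i> * of_real (y * t)) * exp (- \<i> * of_real (x * t)))))"
    unfolding fourier_def moment
  proof (intro Bochner_Integration.integral_cong refl)
    fix t
    have "(LINT y|lborel. b y * (exp (\<i> * of_real (y * t)) * exp (- \<i> * of_real (x * t)))) =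
      (LINT y|lborel. b y * exp (\<i> * of_real (y * t))) * exp (- \<i> * of_real (x * t))"
      unfolding mult.assoc[symmetric] by (rule integral_mult_left_zero)
    then show "exp (- \<i> * of_real (x * t)) * ((LINT y|lborel. b y * exp (\<i> * of_real (y * t))) * \<phi> t) =
      \<phi> t * (LINT y|lborel. b y * (exp (\<i> * of_real (y * t)) * exp (- \<i> * of_real (x * t))))"
      by (simp add: mult_ac)
  qed
  also have "\<dots> = (LINT y|lborel. b y * (LINT t|lborel. \<phi> t * (exp (\<i> * of_real (y * t)) * exp (- \<i> * of_real (x * t)))))"
    by (rule fubini_bounded_kernel[OF \<phi> b_int, where B = 1]) (auto simp: norm_mult)
  also have "\<dots> = (LINT y|lborel. indicator {0..h} y * fourier \<phi> (x - y))"
  proof (intro Bochner_Integration.integral_cong refl)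
    fix y
    have "(LINT t|lborel. \<phi> t * (exp (\<i> * of_real (y * t)) * exp (- \<i> * of_real (x * t)))) = fourier \<phi> (x - y)"
      unfolding fourier_def
      by (intro Bochner_Integration.integral_cong refl)
         (simp add: exp_add[symmetric] left_diff_distrib right_diff_distrib mult.commute)
    then show "b y * (LINT t|lborel. \<phi> t * (exp (\<i> * of_real (y * t)) * exp (- \<i> * of_real (x * t)))) =
      indicator {0..h} y * fourier \<phi> (x - y)"
      by (simp add: b_def indicator_def)
  qed
  finally show ?thesis .
qed

lemma fourier_diff:
  assumes "integrable lborel f" "integrable lborel g"
  shows "fourier (\<lambda>t. f t - g t) x = fourier f x - fourier g x"
  unfolding fourier_def right_diff_distrib
  by (intro Bochner_Integration.integral_diff integrable_fourier_integrand assms)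

context decaying_kernel
begin

definition poisson_mass :: real where
  "poisson_mass = (LINT x|lborel. 1 / (1 + x\<^sup>2))"

text \<open>For \<open>x \<le> 0 \<le> y\<close> the distance \<open>\<bar>x - y\<bar>\<close> is at
  least \<open>\<bar>x\<bar>\<close> and at least \<open>\<bar>y\<bar>\<close>, so the fourth-order
  decay splits into a factor in \<open>x\<close> and one in \<open>y\<close>. The latter is
  integrated over the whole line, which makes the bound independent of \<open>h\<close>.\<close>

lemma kernel_tail:
  assumes "x \<le> 0" "0 \<le> h"
  shows "(LINT y|lborel. indicator {0..h} y * K (x - y)) \<le> D * poisson_mass / (1 + x\<^sup>2)"
proof -
  have "(LINT y|lborel. indicator {0..h} y * K (x - y)) \<le> (LINT y|lborel. D / (1 + x\<^sup>2) * (1 / (1 + y\<^sup>2)))"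
  proof (rule integral_mono)
    have "integrable lborel (\<lambda>y. K (x - y))"
      using lborel_integrable_real_affine[OF K_integrable, of "-1" x] by simp
    then show "integrable lborel (\<lambda>y. indicator {0..h} y * K (x - y))"
      by (rule Bochner_Integration.integrable_bound) (auto simp: indicator_def)
    show "integrable lborel (\<lambda>y. D / (1 + x\<^sup>2) * (1 / (1 + y\<^sup>2)))"
      by (intro integrable_mult_right integrable_inverse_1_plus_square)
    fix y :: real
    have pos: "0 < 1 + x\<^sup>2" "0 < 1 + y\<^sup>2" by (simp_all add: add_pos_nonneg)
    show "indicator {0..h} y * K (x - y) \<le> D / (1 + x\<^sup>2) * (1 / (1 + y\<^sup>2))"
    proof (cases "y \<in> {0..h}")
      case True
      have sq: "x\<^sup>2 \<le> (x - y)\<^sup>2" "y\<^sup>2 \<le> (x - y)\<^sup>2"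
        using assms True by (auto intro!: abs_le_square_iff[THEN iffD1])
      have "(1 + x\<^sup>2) * (1 + y\<^sup>2) \<le> (1 + (x - y)\<^sup>2) * (1 + (x - y)\<^sup>2)"
        using sq by (intro mult_mono) auto
      then have "D / (1 + (x - y)\<^sup>2)\<^sup>2 \<le> D / ((1 + x\<^sup>2) * (1 + y\<^sup>2))"
        unfolding power2_eq_square[of "1 + (x - y)\<^sup>2"] using D_pos pos
        by (intro divide_left_mono mult_pos_pos) (auto simp: add_pos_nonneg)
      then show ?thesis using True K_decay[of "x - y"] by simp
    qed (use D_pos pos in simp)
  qed
  also have "\<dots> = D / (1 + x\<^sup>2) * poisson_mass"
    unfolding poisson_mass_def by (rule integral_mult_right_zero)
  finally show ?thesis by simp
qed

text \<open>In the proof, \<open>\<Lambda> \<eta> \<sigma>\<close> pairs \<open>s \<L>{f;s}\<close> on the line \<open>Re s = \<sigma>\<close> with \<open>\<eta>\<close>, and \<open>J n h\<close> is the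
  average around \<open>h\<close> with \<open>\<sigma> = \<sigma>\<^sub>n\<close>.\<close>

lemma norm_remainder_bounded:
  fixes \<tau> g h1 :: "real \<Rightarrow> complex" and \<phi> :: "real \<Rightarrow> complex"
  assumes \<tau>_meas [measurable]: "\<tau> \<in> borel_measurable borel" and van: "\<And>x. x < 0 \<Longrightarrow> \<tau> x = 0"
    and \<tau>_int: "\<And>\<sigma>. 0 < \<sigma> \<Longrightarrow> integrable lborel (lap_line \<tau> \<sigma>)"
    and X: "0 \<le> X" and C: "1 \<le> C"
    and slow_Re: "\<And>x y. X \<le> x \<Longrightarrow> x \<le> y \<Longrightarrow> - C * (y - x + 1) \<le> Re (\<tau> y) - Re (\<tau> x)"
    and slow_Im: "\<And>x y. X \<le> x \<Longrightarrow> x \<le> y \<Longrightarrow> - C * (y - x + 1) \<le> Im (\<tau> y) - Im (\<tau> x)"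
    and g_meas [measurable]: "g \<in> borel_measurable borel" and g_le: "\<And>x. norm (g x) \<le> B2"
    and h1_meas [measurable]: "h1 \<in> borel_measurable borel" and h1_le: "\<And>x. norm (h1 x) \<le> B1"
    and \<phi>: "test_fun {-d<..<d} \<phi>" and \<phi>_K: "\<And>x. fourier \<phi> x = of_real (K x)"
    and \<rho>: "0 < \<rho>" and G_cont: "\<And>\<sigma>. 0 < \<sigma> \<Longrightarrow> \<sigma> < \<rho> \<Longrightarrow>
      continuous_on {-d<..<d} (\<lambda>t. G (of_real \<sigma> + \<i> * of_real t))"
    and lim1: "\<And>\<eta>. test_fun {-d<..<d} \<eta> \<Longrightarrow>
      boundary_value (\<lambda>s. laplace \<tau> s - G s / s) \<eta> (LINT x|lborel. h1 x * fourier \<eta> x)"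
    and lim2: "\<And>\<eta>. test_fun {-d<..<d} \<eta> \<Longrightarrow>
      boundary_value G \<eta> (LINT x|lborel. g x * fourier \<eta> x)"
  shows "\<exists>B. \<forall>x\<ge>X. norm (\<tau> x - primitive g x) \<le> B"
proof -
  note prim_meas [measurable] = primitive_measurable[OF g_meas g_le]
  note prim_int = integrable_lap_line_primitive[OF g_meas g_le]
  define s where "s = (\<lambda>\<sigma> t. complex_of_real \<sigma> + \<i> * of_real t)"
  have Re_s [simp]: "Re (s \<sigma> t) = \<sigma>" for \<sigma> t by (simp add: s_def)
  have s0: "s \<sigma> t \<noteq> 0" if "0 < \<sigma>" for \<sigma> t using that by (auto simp: complex_eq_iff s_def)
  define f where "f = (\<lambda>x. \<tau> x - primitive g x)"
  have [measurable]: "f \<in> borel_measurable borel" unfolding f_def by measurable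
  have f_neg: "f x = 0" if "x < 0" for x
    using van[OF that] primitive_neg[OF g_meas g_le that] by (simp add: f_def)
  have f_line: "lap_line f \<sigma> = (\<lambda>x. lap_line \<tau> \<sigma> x - lap_line (primitive g) \<sigma> x)" for \<sigma>
    by (auto simp: lap_line_def f_def left_diff_distrib)
  have f_int: "integrable lborel (lap_line f \<sigma>)" if "0 < \<sigma>" for \<sigma>
    unfolding f_line by (intro Bochner_Integration.integrable_diff \<tau>_int prim_int that)
  \<comment> \<open>Only \<open>g0\<close> enters the Laplace transform of
    \<open>primitive g\<close>; the discrepancy \<open>g x - g0 x\<close> is carried along in
    \<open>T\<close>.\<close>
  define g0 where "g0 = (\<lambda>x. indicator {0..} x * g x)"
  have [measurable]: "g0 \<in> borel_measurable borel" unfolding g0_def by measurable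
  have g0_le: "norm (g0 x) \<le> B2" for x
    using g_le[of x] order_trans[OF norm_ge_zero g_le] by (auto simp: g0_def indicator_def)
  have B2: "0 \<le> B2" using order_trans[OF norm_ge_zero g_le] .
  have B1: "0 \<le> B1" using order_trans[OF norm_ge_zero h1_le] .
  have g0_int: "integrable lborel (lap_line g0 \<sigma>)" if "0 < \<sigma>" for \<sigma>
  proof (rule integrable_lap_line_growth[OF _ _ _ that])
    show "norm (g0 x) \<le> B2 * (1 + x)" if "0 \<le> x" for x
      using order_trans[OF g0_le, of "B2 * (1 + x)"] B2 that by (simp add: algebra_simps)
  qed (auto simp: g0_def)
  have lap_f: "s \<sigma> t * lap f (s \<sigma> t) = s \<sigma> t * lap \<tau> (s \<sigma> t) - lap g0 (s \<sigma> t)" if "0 < \<sigma>" for \<sigma> t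
  proof -
    have "lap f (s \<sigma> t) = lap \<tau> (s \<sigma> t) - lap (primitive g) (s \<sigma> t)"
      unfolding lap_def f_def left_diff_distrib
      by (rule Bochner_Integration.integral_diff; rule integrable_lap_integrand) (use that \<tau>_int prim_int in auto)
    also have "lap (primitive g) (s \<sigma> t) = lap g0 (s \<sigma> t) / s \<sigma> t"
      unfolding g0_def by (rule lap_primitive[OF g_meas g_le]) (use that in simp)
    finally show ?thesis using s0[OF that] by (simp add: right_diff_distrib)
  qed
  define \<Lambda> where "\<Lambda> = (\<lambda>\<eta> \<sigma>. LINT t|lborel. s \<sigma> t * lap f (s \<sigma> t) * \<eta> t)"
  \<comment> \<open>The boundary value of \<open>s * lap f s\<close>: the first pseudomeasure
    multiplied by \<open>\<i> * of_real t\<close>, plus the boundary value of \<open>G\<close> minus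
    that of \<open>lap g0\<close>.\<close>
  define T where "T = (\<lambda>\<eta>. (LINT x|lborel. h1 x * fourier (\<lambda>t. \<i> * of_real t * \<eta> t) x) + (LINT x|lborel. (g x - g0 x) * fourier \<eta> x))"
  have smooth_it: "smooth_fun (\<lambda>t. \<i> * of_real t)"
    by (intro smooth_fun_mult smooth_fun_const smooth_fun_of_real)
  have \<Lambda>_lim: "(\<Lambda> \<eta> \<longlongrightarrow> T \<eta>) (at_right 0)" if \<eta>: "test_fun {-d<..<d} \<eta>" for \<eta>
  proof -
    have it\<eta>: "test_fun {-d<..<d} (\<lambda>t. \<i> * of_real t * \<eta> t)"
      by (rule test_fun_mult[OF smooth_it \<eta>])
    define \<omega> where "\<omega> = (\<lambda>\<sigma> t. laplace \<tau> (s \<sigma> t) - G (s \<sigma> t) / s \<sigma> t)"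
    \<comment> \<open>Writing \<open>s\<close> as \<sigma> + it splits \<open>s\<close> times
      \<open>\<omega>\<close> into a pairing with the test function
      \<open>\<i> * of_real t * \<eta> t\<close> and a multiple of \<sigma>; the latter vanishes in
      the limit because the pairing that it multiplies converges.\<close>
    have eq: "(LINT t|lborel. \<omega> \<sigma> t * (\<i> * of_real t * \<eta> t)) + of_real \<sigma> * (LINT t|lborel. \<omega> \<sigma> t * \<eta> t)
        + (LINT t|lborel. G (s \<sigma> t) * \<eta> t) - (LINT t|lborel. lap g0 (s \<sigma> t) * \<eta> t) = \<Lambda> \<eta> \<sigma>"
      if \<sigma>: "0 < \<sigma>" "\<sigma> < \<rho>" for \<sigma>
    proof -
      have \<omega>_eq: "\<omega> \<sigma> t = lap \<tau> (s \<sigma> t) - G (s \<sigma> t) / s \<sigma> t" for t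
        unfolding \<omega>_def using \<sigma> by (subst laplace_eq_lap) (auto intro: van \<tau>_int)
      have cG: "continuous_on {-d<..<d} (\<lambda>t. G (s \<sigma> t))" using G_cont[OF \<sigma>] by (simp add: s_def)
      have c\<tau>: "continuous_on {-d<..<d} (\<lambda>t. lap \<tau> (s \<sigma> t))"
        unfolding s_def by (rule continuous_lap_line[OF \<tau>_int[OF \<sigma>(1)]])
      have cg: "continuous_on {-d<..<d} (\<lambda>t. lap g0 (s \<sigma> t))"
        unfolding s_def by (rule continuous_lap_line[OF g0_int[OF \<sigma>(1)]])
      have c\<omega>: "continuous_on {-d<..<d} (\<omega> \<sigma>)"
        unfolding \<omega>_eq[abs_def]
        by (intro continuous_intros cG c\<tau>) (use s0[OF \<sigma>(1)] in \<open>auto simp: s_def intro!: continuous_intros\<close>)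
      note i = integrable_continuous_mult_test_fun
      have "(LINT t|lborel. \<omega> \<sigma> t * (\<i> * of_real t * \<eta> t)) + of_real \<sigma> * (LINT t|lborel. \<omega> \<sigma> t * \<eta> t)
        + (LINT t|lborel. G (s \<sigma> t) * \<eta> t) - (LINT t|lborel. lap g0 (s \<sigma> t) * \<eta> t) =
        (LINT t|lborel. \<omega> \<sigma> t * (\<i> * of_real t * \<eta> t) + of_real \<sigma> * (\<omega> \<sigma> t * \<eta> t)
        + G (s \<sigma> t) * \<eta> t - lap g0 (s \<sigma> t) * \<eta> t)"
        using i[OF c\<omega> it\<eta>] i[OF c\<omega> \<eta>] i[OF cG \<eta>] i[OF cg \<eta>]
        by (simp add: Bochner_Integration.integral_add Bochner_Integration.integral_diff
            Bochner_Integration.integrable_add)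
      also have "\<dots> = \<Lambda> \<eta> \<sigma>"
        unfolding \<Lambda>_def
      proof (intro Bochner_Integration.integral_cong refl)
        fix t
        have "\<omega> \<sigma> t * (\<i> * of_real t * \<eta> t) + of_real \<sigma> * (\<omega> \<sigma> t * \<eta> t) + G (s \<sigma> t) * \<eta> t - lap g0 (s \<sigma> t) * \<eta> t =
          (s \<sigma> t * \<omega> \<sigma> t + G (s \<sigma> t) - lap g0 (s \<sigma> t)) * \<eta> t"
          by (simp add: s_def algebra_simps)
        also have "s \<sigma> t * \<omega> \<sigma> t + G (s \<sigma> t) - lap g0 (s \<sigma> t) = s \<sigma> t * lap f (s \<sigma> t)"
          unfolding lap_f[OF \<sigma>(1)] \<omega>_eq using s0[OF \<sigma>(1), of t] by (simp add: right_diff_distrib)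
        finally show "\<omega> \<sigma> t * (\<i> * of_real t * \<eta> t) + of_real \<sigma> * (\<omega> \<sigma> t * \<eta> t) + G (s \<sigma> t) * \<eta> t - lap g0 (s \<sigma> t) * \<eta> t =
          s \<sigma> t * lap f (s \<sigma> t) * \<eta> t" .
      qed
      finally show ?thesis .
    qed
    have "((\<lambda>\<sigma>. (LINT t|lborel. \<omega> \<sigma> t * (\<i> * of_real t * \<eta> t)) + of_real \<sigma> * (LINT t|lborel. \<omega> \<sigma> t * \<eta> t)
        + (LINT t|lborel. G (s \<sigma> t) * \<eta> t) - (LINT t|lborel. lap g0 (s \<sigma> t) * \<eta> t)) \<longlongrightarrow>
        (LINT x|lborel. h1 x * fourier (\<lambda>t. \<i> * of_real t * \<eta> t) x) + of_real 0 * (LINT x|lborel. h1 x * fourier \<eta> x)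
        + (LINT x|lborel. g x * fourier \<eta> x) - (LINT x|lborel. g0 x * fourier \<eta> x)) (at_right 0)"
      unfolding \<omega>_def s_def
    proof (intro tendsto_diff tendsto_add tendsto_mult tendsto_of_real lim1[OF it\<eta>] lim1[OF \<eta>] lim2[OF \<eta>])
      show "((\<lambda>x. x) \<longlongrightarrow> (0::real)) (at_right 0)" by (rule tendsto_ident_at)
      show "boundary_value (lap g0) \<eta> (LINT x|lborel. g0 x * fourier \<eta> x)"
      proof (rule lap_boundary[OF _ _ g0_int test_fun_integrable[OF \<eta>] integrable_bounded_mult_fourier[OF \<eta> _ g0_le]])
        show "g0 x = 0" if "x < 0" for x using that by (simp add: g0_def)
      qed measurable
    qed
    moreover have "(LINT x|lborel. g x * fourier \<eta> x) - (LINT x|lborel. g0 x * fourier \<eta> x) =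
        (LINT x|lborel. (g x - g0 x) * fourier \<eta> x)"
      unfolding left_diff_distrib
      by (rule Bochner_Integration.integral_diff[symmetric]; rule integrable_bounded_mult_fourier[OF \<eta>])
         (use g_le g0_le in auto)
    ultimately have "((\<lambda>\<sigma>. (LINT t|lborel. \<omega> \<sigma> t * (\<i> * of_real t * \<eta> t)) + of_real \<sigma> * (LINT t|lborel. \<omega> \<sigma> t * \<eta> t)
        + (LINT t|lborel. G (s \<sigma> t) * \<eta> t) - (LINT t|lborel. lap g0 (s \<sigma> t) * \<eta> t)) \<longlongrightarrow> T \<eta>) (at_right 0)"
      by (simp add: T_def algebra_simps)
    then show ?thesis
    proof (rule Lim_transform_eventually)
      show "\<forall>\<^sub>F \<sigma> in at_right 0. (LINT t|lborel. \<omega> \<sigma> t * (\<i> * of_real t * \<eta> t)) + of_real \<sigma> * (LINT t|lborel. \<omega> \<sigma> t * \<eta> t)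
        + (LINT t|lborel. G (s \<sigma> t) * \<eta> t) - (LINT t|lborel. lap g0 (s \<sigma> t) * \<eta> t) = \<Lambda> \<eta> \<sigma>"
        using eventually_at_right_real[OF \<rho>] by eventually_elim (rule eq; simp)
    qed
  qed
  define \<sigma> where "\<sigma> = (\<lambda>n. 1 / real (Suc n))"
  have \<sigma>: "\<And>n. 0 < \<sigma> n" "\<And>n. \<sigma> n \<le> 1" by (auto simp: \<sigma>_def)
  have \<sigma>_lim: "\<sigma> \<longlonglongrightarrow> 0"
    unfolding \<sigma>_def using LIMSEQ_inverse_real_of_nat by (simp add: inverse_eq_divide)
  have \<sigma>_right: "filterlim \<sigma> (at_right 0) sequentially"
    by (rule tendsto_imp_filterlim_at_right[OF \<sigma>_lim]) (simp add: \<sigma>(1))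
  define w where "w = (\<lambda>n t. s (\<sigma> n) t * lap f (s (\<sigma> n) t) * \<phi> t)"
  have w_int: "integrable lborel (w n)" for n
  proof -
    have "continuous_on {-d<..<d} (\<lambda>t. s (\<sigma> n) t * lap f (s (\<sigma> n) t))"
      unfolding s_def by (intro continuous_intros continuous_lap_line f_int \<sigma>)
    from integrable_continuous_mult_test_fun[OF this \<phi>] show ?thesis unfolding w_def .
  qed
  have m_test: "test_fun {-d<..<d} (\<lambda>t. exp_moment h c t * \<phi> t)" if "continuous_on {0..h} c" for h c
    using smooth_fun_integral_exp[OF that] by (intro test_fun_mult \<phi>) (simp add: exp_moment_def[abs_def])
  have w_moment: "(\<lambda>n. LINT t|lborel. w n t * exp_moment h c t) \<longlonglongrightarrow> T (\<lambda>t. exp_moment h c t * \<phi> t)"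
    if "continuous_on {0..h} c" for h c
    using filterlim_compose[OF \<Lambda>_lim[OF m_test[OF that]] \<sigma>_right]
    by (simp add: \<Lambda>_def w_def mult_ac)
  define J where "J = (\<lambda>n h. LINT x|lborel. f x * of_real (exp (- \<sigma> n * (x - h)) * K (x - h)))"
  have J_integrand: "f x * of_real (exp (- \<sigma> n * (x - h)) * K (x - h)) =
      of_real (exp (\<sigma> n * h)) * (lap_line f (\<sigma> n) x * of_real (K (x - h)))" for n h x
  proof -
    have "exp (- \<sigma> n * (x - h)) = exp (\<sigma> n * h) * exp (- \<sigma> n * x)"
      by (simp add: exp_add[symmetric] algebra_simps)
    then show ?thesis by (simp add: lap_line_def)
  qed
  have J_int: "integrable lborel (\<lambda>x. f x * of_real (exp (- \<sigma> n * (x - h)) * K (x - h)))" for n h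
    unfolding J_integrand
  proof (intro integrable_mult_right, rule Bochner_Integration.integrable_bound)
    show "integrable lborel (\<lambda>x. lap_line f (\<sigma> n) x * of_real D)" by (intro integrable_mult_left f_int \<sigma>)
    show "AE x in lborel. norm (lap_line f (\<sigma> n) x * of_real (K (x - h))) \<le> norm (lap_line f (\<sigma> n) x * of_real D)"
      using K_le_D K_nonneg D_pos by (intro AE_I2) (simp add: norm_mult mult_left_mono)
    show "(\<lambda>x. lap_line f (\<sigma> n) x * of_real (K (x - h))) \<in> borel_measurable lborel"
      unfolding lap_line_def by measurable
  qed
  have J_eq: "J n h = of_real (exp (\<sigma> n * h)) * (LINT t|lborel. lap f (s (\<sigma> n) t) * (exp (\<i> * of_real (h * t)) * \<phi> t))" for n h
  proof -
    have test: "test_fun {-d<..<d} (\<lambda>t. exp (\<i> * of_real (h * t)) * \<phi> t)"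
      by (rule test_fun_mult[OF smooth_fun_cis \<phi>])
    show ?thesis
      unfolding J_def J_integrand s_def lap_fubini[OF f_int[OF \<sigma>(1)] test_fun_integrable[OF test]]
        fourier_modulate \<phi>_K
      by (rule integral_mult_right_zero)
  qed
  \<comment> \<open>The increment of the damped averages pairs \<open>\<phi>\<close> with
    \<open>lap f s\<close> times \<open>exp(hs) - 1\<close>, which is \<open>s * lap f s\<close>
    times the moment with coefficient \<open>exp (\<sigma> n * y)\<close>. The factor
    \<open>exp (\<sigma> n * h)\<close> of \<open>J_eq\<close> supplies the real part of the
    exponent.\<close>
  have J_lim: "(\<lambda>n. J n h - J n 0) \<longlonglongrightarrow> T (\<lambda>t. exp_moment h (\<lambda>y. 1) t * \<phi> t)" if h: "0 \<le> h" for h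
  proof -
    have "(\<lambda>n. LINT t|lborel. w n t * exp_moment h (\<lambda>y. of_real (exp (\<sigma> n * y))) t) \<longlonglongrightarrow>
        T (\<lambda>t. exp_moment h (\<lambda>y. 1) t * \<phi> t)"
      by (rule exp_moment_limit[OF w_int h less_imp_le[OF \<sigma>(1)] \<sigma>_lim])
         (auto intro!: w_moment continuous_intros convergentI)
    moreover have "(LINT t|lborel. w n t * exp_moment h (\<lambda>y. of_real (exp (\<sigma> n * y))) t) = J n h - J n 0" for n
    proof -
      have c: "continuous_on {-d<..<d} (\<lambda>t. lap f (s (\<sigma> n) t))"
        unfolding s_def by (intro continuous_lap_line f_int \<sigma>)
      have i: "integrable lborel (\<lambda>t. lap f (s (\<sigma> n) t) * (exp (\<i> * of_real (k * t)) * \<phi> t))" for k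
        by (rule integrable_continuous_mult_test_fun[OF c test_fun_mult[OF smooth_fun_cis \<phi>]])
      have "(LINT t|lborel. w n t * exp_moment h (\<lambda>y. of_real (exp (\<sigma> n * y))) t) =
        (LINT t|lborel. of_real (exp (\<sigma> n * h)) * (lap f (s (\<sigma> n) t) * (exp (\<i> * of_real (h * t)) * \<phi> t))
          - lap f (s (\<sigma> n) t) * (exp (\<i> * of_real (0 * t)) * \<phi> t))"
      proof (intro Bochner_Integration.integral_cong refl)
        fix t
        have "exp_moment h (\<lambda>y. of_real (exp (\<sigma> n * y))) t = (exp (of_real h * s (\<sigma> n) t) - 1) / s (\<sigma> n) t"
          by (rule exp_moment_exp[OF s0[OF \<sigma>(1)] _ h]) (simp add: s_def)
        moreover have "exp (of_real h * s (\<sigma> n) t) = of_real (exp (\<sigma> n * h)) * exp (\<i> * of_real (h * t))"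
          by (simp add: s_def exp_of_real[symmetric] exp_add[symmetric] algebra_simps)
        ultimately have "w n t * exp_moment h (\<lambda>y. of_real (exp (\<sigma> n * y))) t =
          lap f (s (\<sigma> n) t) * \<phi> t * (of_real (exp (\<sigma> n * h)) * exp (\<i> * of_real (h * t)) - 1)"
          unfolding w_def using s0[OF \<sigma>(1), of n t] by simp
        then show "w n t * exp_moment h (\<lambda>y. of_real (exp (\<sigma> n * y))) t =
          of_real (exp (\<sigma> n * h)) * (lap f (s (\<sigma> n) t) * (exp (\<i> * of_real (h * t)) * \<phi> t))
          - lap f (s (\<sigma> n) t) * (exp (\<i> * of_real (0 * t)) * \<phi> t)"
          by (simp add: right_diff_distrib mult_ac)
      qed
      also have "\<dots> = J n h - J n 0"
        unfolding J_eq using i[of h] i[of 0] by (subst Bochner_Integration.integral_diff) auto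
      finally show ?thesis .
    qed
    ultimately show ?thesis by simp
  qed
  define \<kappa> where "\<kappa> = (LINT v|lborel. K v)"
  have T_le: "norm (T (\<lambda>t. exp_moment h (\<lambda>y. 1) t * \<phi> t)) \<le> 2 * B1 * \<kappa> + B2 * (D * poisson_mass) * poisson_mass"
    if h: "0 \<le> h" for h
  proof -
    have Kh: "integrable lborel (\<lambda>x. K (x - k))" "(LINT x|lborel. K (x - k)) = \<kappa>" for k
      using lborel_integrable_real_affine[OF K_integrable, of 1 "-k"]
        lborel_integral_real_affine[of 1 "\<lambda>x. K (x - k)" k] by (simp_all add: \<kappa>_def)
    have "fourier (\<lambda>t. \<i> * of_real t * (exp_moment h (\<lambda>y. 1) t * \<phi> t)) x = of_real (K (x - h) - K x)" for x
    proof -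
      have "(\<lambda>t. \<i> * of_real t * (exp_moment h (\<lambda>y. 1) t * \<phi> t)) = (\<lambda>t. exp (\<i> * of_real (h * t)) * \<phi> t - \<phi> t)"
        unfolding mult.assoc[symmetric] exp_moment_1[OF h] by (simp add: left_diff_distrib)
      then have "fourier (\<lambda>t. \<i> * of_real t * (exp_moment h (\<lambda>y. 1) t * \<phi> t)) x =
          fourier (\<lambda>t. exp (\<i> * of_real (h * t)) * \<phi> t) x - fourier \<phi> x"
        using fourier_diff[OF test_fun_integrable[OF test_fun_mult[OF smooth_fun_cis \<phi>]]
            test_fun_integrable[OF \<phi>]] by (simp only:)
      then show ?thesis unfolding fourier_modulate \<phi>_K by simp
    qed
    then have "norm (LINT x|lborel. h1 x * fourier (\<lambda>t. \<i> * of_real t * (exp_moment h (\<lambda>y. 1) t * \<phi> t)) x) \<le>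
        (LINT x|lborel. B1 * (K (x - h) + K (x - 0)))"
    proof (simp only:, intro order_trans[OF integral_norm_bound integral_mono])
      have i: "integrable lborel (\<lambda>x. B1 * (K (x - h) + K (x - 0)))"
        by (intro integrable_mult_right Bochner_Integration.integrable_add Kh)
      then show "integrable lborel (\<lambda>x. B1 * (K (x - h) + K (x - 0)))" .
      show le: "norm (h1 x * of_real (K (x - h) - K x)) \<le> B1 * (K (x - h) + K (x - 0))" for x
      proof -
        have "\<bar>K (x - h) - K x\<bar> \<le> K (x - h) + K x" using K_nonneg[of x] K_nonneg[of "x - h"] by simp
        then show ?thesis unfolding norm_mult norm_of_real using B1 h1_le by (intro mult_mono) auto
      qed
      show "integrable lborel (\<lambda>x. norm (h1 x * of_real (K (x - h) - K x)))"
        by (rule Bochner_Integration.integrable_bound[OF i]) (use order_trans[OF le abs_ge_self] in auto)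
    qed
    also have "\<dots> = B1 * ((LINT x|lborel. K (x - h)) + (LINT x|lborel. K (x - 0)))"
      by (simp add: Bochner_Integration.integral_add Kh(1)[of h] K_integrable)
    also have "\<dots> = 2 * B1 * \<kappa>" unfolding Kh(2) by simp
    finally have 1: "norm (LINT x|lborel. h1 x * fourier (\<lambda>t. \<i> * of_real t * (exp_moment h (\<lambda>y. 1) t * \<phi> t)) x) \<le> 2 * B1 * \<kappa>" .
    have F: "fourier (\<lambda>t. exp_moment h (\<lambda>y. 1) t * \<phi> t) x = of_real (LINT y|lborel. indicator {0..h} y * K (x - y))" for x
    proof -
      have "(\<lambda>y. indicator {0..h} y * fourier \<phi> (x - y)) = (\<lambda>y. complex_of_real (indicator {0..h} y * K (x - y)))"
        by (auto simp: \<phi>_K indicator_def)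
      then show ?thesis
        unfolding fourier_exp_moment_1[OF test_fun_integrable[OF \<phi>] h] by (simp only: integral_complex_of_real)
    qed
    \<comment> \<open>For \<open>x \<ge> 0\<close> the factor \<open>g x - g0 x\<close> is 0; for
      negative \<open>x\<close> the transform of the moment is a tail of \<open>K\<close>.\<close>
    have pointwise: "norm ((g x - g0 x) * fourier (\<lambda>t. exp_moment h (\<lambda>y. 1) t * \<phi> t) x) \<le>
        B2 * (D * poisson_mass) * (1 / (1 + x\<^sup>2))" for x
    proof (cases "0 \<le> x")
      case True
      have "0 \<le> poisson_mass" unfolding poisson_mass_def by (intro Bochner_Integration.integral_nonneg) simp
      then show ?thesis using True B2 D_pos by (simp add: g0_def)
    next
      case False
      have "0 \<le> (LINT y|lborel. indicator {0..h} y * K (x - y))"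
        using K_nonneg by (intro Bochner_Integration.integral_nonneg) simp
      then have "norm ((g x - g0 x) * fourier (\<lambda>t. exp_moment h (\<lambda>y. 1) t * \<phi> t) x) =
          norm (g x) * (LINT y|lborel. indicator {0..h} y * K (x - y))"
        using False by (simp add: F norm_mult g0_def)
      also have "\<dots> \<le> B2 * (D * poisson_mass / (1 + x\<^sup>2))"
        using False h B2 g_le K_nonneg
        by (intro mult_mono kernel_tail Bochner_Integration.integral_nonneg) auto
      finally show ?thesis by simp
    qed
    have "norm (LINT x|lborel. (g x - g0 x) * fourier (\<lambda>t. exp_moment h (\<lambda>y. 1) t * \<phi> t) x) \<le>
        (LINT x|lborel. B2 * (D * poisson_mass) * (1 / (1 + x\<^sup>2)))"
    proof (intro order_trans[OF integral_norm_bound integral_mono] pointwise)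
      show "integrable lborel (\<lambda>x. B2 * (D * poisson_mass) * (1 / (1 + x\<^sup>2)))"
        by (intro integrable_mult_right integrable_inverse_1_plus_square)
      show "integrable lborel (\<lambda>x. norm ((g x - g0 x) * fourier (\<lambda>t. exp_moment h (\<lambda>y. 1) t * \<phi> t) x))"
      proof (intro integrable_norm integrable_bounded_mult_fourier[OF m_test])
        show "norm (g x - g0 x) \<le> B2 + B2" for x
          by (rule order_trans[OF norm_triangle_ineq4 add_mono[OF g_le g0_le]])
      qed (auto intro: continuous_intros)
    qed
    also have "\<dots> = B2 * (D * poisson_mass) * poisson_mass"
      unfolding poisson_mass_def by (rule integral_mult_right_zero)
    finally show ?thesis
      unfolding T_def by (intro norm_triangle_le add_mono 1)
  qed
  have prim_slow: "norm (primitive g y - primitive g x) \<le> B2 * (y - x)" if "X \<le> x" "x \<le> y" for x y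
    using that X by (intro norm_primitive_diff_le[OF g_meas g_le]) auto
  \<comment> \<open>The primitive is Lipschitz with constant \<open>B2\<close>, so subtracting it
    raises the constant of the one-sided condition by \<open>B2\<close>.\<close>
  have C': "1 \<le> C + B2" using C B2 by simp
  have f_exp: "integrable lborel (\<lambda>x. f x * of_real (exp (- r * x)))" if "0 < r" for r
    using f_int[OF that] by (simp add: lap_line_def[abs_def])
  \<comment> \<open>Stated once for \<open>Re\<close> and \<open>Im\<close>: both commute with
    averages against the real kernel and do not increase norms.\<close>
  have part: "\<exists>B. \<forall>x\<ge>X. \<bar>part (f x)\<bar> \<le> B"
    if lin: "bounded_linear part" and part_le: "\<And>z. \<bar>part z\<bar> \<le> norm z"
      and slow: "\<And>x y. X \<le> x \<Longrightarrow> x \<le> y \<Longrightarrow> - C * (y - x + 1) \<le> part (\<tau> y) - part (\<tau> x)"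
    for part :: "complex \<Rightarrow> real"
  proof (rule bounded_above_cutoff[OF _ _ X C' _ _ \<sigma> \<sigma>_lim, where L = "\<lambda>h. part (T (\<lambda>t. exp_moment h (\<lambda>y. 1) t * \<phi> t))"])
    interpret bounded_linear part by (rule lin)
    have part_mult: "part (z * of_real a) = part z * a" for z a
      using scaleR[of a z] by (simp add: scaleR_conv_of_real mult.commute)
    show "(\<lambda>x. part (f x)) \<in> borel_measurable borel"
      by (rule borel_measurable_continuous_on[OF linear_continuous_on[OF lin]]) measurable
    show "part (f x) = 0" if "x < 0" for x using f_neg[OF that] zero by simp
    show "- (C + B2) * (y - x + 1) \<le> part (f y) - part (f x)" if "X \<le> x" "x \<le> y" for x y
      using slow[OF that] order_trans[OF part_le prim_slow[OF that]] that B2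
      by (simp add: f_def diff algebra_simps abs_le_iff)
    show "integrable lborel (\<lambda>x. part (f x) * exp (- r * x))" if "0 < r" for r
      using integrable_bounded_linear[OF lin f_exp[OF that]] unfolding part_mult .
    show "(\<lambda>n. (LINT x|lborel. part (f x) * (exp (- \<sigma> n * (x - h)) * K (x - h)))
        - (LINT x|lborel. part (f x) * (exp (- \<sigma> n * x) * K x))) \<longlonglongrightarrow> part (T (\<lambda>t. exp_moment h (\<lambda>y. 1) t * \<phi> t))"
      if "0 \<le> h" for h
    proof -
      have "part (J n k) = (LINT x|lborel. part (f x) * (exp (- \<sigma> n * (x - k)) * K (x - k)))" for n k
        unfolding J_def by (subst integral_bounded_linear[OF lin J_int, symmetric]) (simp only: part_mult)
      then show ?thesis using tendsto[OF J_lim[OF that]] by (simp add: diff)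
    qed
    show "\<bar>part (T (\<lambda>t. exp_moment h (\<lambda>y. 1) t * \<phi> t))\<bar> \<le> 2 * B1 * \<kappa> + B2 * (D * poisson_mass) * poisson_mass"
      if "0 \<le> h" for h
      by (rule order_trans[OF part_le T_le[OF that]])
  qed
  obtain bR where bR: "\<And>x. X \<le> x \<Longrightarrow> \<bar>Re (f x)\<bar> \<le> bR"
    using part[OF bounded_linear_Re abs_Re_le_cmod slow_Re] by blast
  obtain bI where bI: "\<And>x. X \<le> x \<Longrightarrow> \<bar>Im (f x)\<bar> \<le> bI"
    using part[OF bounded_linear_Im abs_Im_le_cmod slow_Im] by blast
  show ?thesis
    by (intro exI[of _ "bR + bI"] allI impI)
       (use order_trans[OF cmod_le add_mono[OF bR bI]] in \<open>simp add: f_def\<close>)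
qed

end

section \<open>The equivalence\<close>

text \<open>Differentiation under the integral sign. On the ball of radius \<open>Re s0 / 2\<close>
  real parts stay at least \<open>r\<close>, so the difference quotients of the exponential are at
  most \<open>x * exp (- r * x)\<close> and dominated convergence applies.\<close>

lemma lap_holomorphic:
  assumes [measurable]: "p \<in> borel_measurable borel" and van: "\<And>x. x < 0 \<Longrightarrow> p x = 0"
    and B: "\<And>x. norm (p x) \<le> B"
  shows "lap p holomorphic_on {s. 0 < Re s}"
proof -
  have B0: "0 \<le> B" using order_trans[OF norm_ge_zero B] .
  have line: "integrable lborel (lap_line p \<sigma>)" if "0 < \<sigma>" for \<sigma>
  proof (rule integrable_lap_line_growth[OF _ van _ that])
    show "norm (p x) \<le> B * (1 + x)" if "0 \<le> x" for x
      using order_trans[OF B, of "B * (1 + x)"] B0 that by (simp add: algebra_simps)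
  qed auto
  have "\<exists>D. (lap p has_field_derivative D) (at s0)" if s0: "0 < Re s0" for s0
  proof -
    define r where "r = Re s0 / 2"
    have r: "0 < r" using s0 by (simp add: r_def)
    have Re_ball: "r \<le> Re z" if "z \<in> ball s0 r" for z
    proof -
      have "\<bar>Re (s0 - z)\<bar> \<le> norm (s0 - z)" by (rule abs_Re_le_cmod)
      also have "\<dots> < r" using that by (simp add: dist_norm)
      finally show ?thesis unfolding r_def minus_complex.sel by linarith
    qed
    define E where "E = (\<lambda>x z. exp (- z * complex_of_real x))"
    have E_deriv: "(E x has_field_derivative - of_real x * E x z) (at z within S)" for x z S
      unfolding E_def by (auto intro!: derivative_eq_intros)
    have E_lip: "norm (E x z - E x s0) \<le> (x * exp (- r * x)) * norm (z - s0)"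
      if "0 \<le> x" "z \<in> ball s0 r" for x z
    proof (rule field_differentiable_bound[OF convex_ball E_deriv])
      fix z assume z: "z \<in> ball s0 r"
      have "r * x \<le> Re z * x" using Re_ball[OF z] that(1) by (rule mult_right_mono)
      then show "norm (- of_real x * E x z) \<le> x * exp (- r * x)"
        using that(1) by (auto simp: E_def norm_mult intro!: mult_left_mono)
    qed (use that r in auto)
    have "((\<lambda>z. (lap p z - lap p s0) / (z - s0)) \<longlongrightarrow> (LINT x|lborel. p x * (- of_real x * E x s0)))
        (at s0 within ball s0 r)"
      unfolding tendsto_at_iff_sequentially
    proof (intro allI impI)
      fix Z assume Z: "\<forall>i. Z i \<in> ball s0 r - {s0}" "Z \<longlonglongrightarrow> s0"
      have "(\<lambda>n. LINT x|lborel. p x * ((E x (Z n) - E x s0) / (Z n - s0))) \<longlonglongrightarrow>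
          (LINT x|lborel. p x * (- of_real x * E x s0))"
      proof (rule integral_dominated_convergence[where w = "\<lambda>x. B * (indicator {0..} x * ((1 + x) * exp (- r * x)))"])
        show "integrable lborel (\<lambda>x. B * (indicator {0..} x * ((1 + x) * exp (- r * x))))"
          by (intro integrable_mult_right integrable_linear_exp r)
        show "AE x in lborel. (\<lambda>n. p x * ((E x (Z n) - E x s0) / (Z n - s0))) \<longlonglongrightarrow> p x * (- of_real x * E x s0)"
        proof (intro AE_I2 tendsto_mult tendsto_const)
          fix x
          have "((\<lambda>z. (E x z - E x s0) / (z - s0)) \<longlongrightarrow> - of_real x * E x s0) (at s0 within ball s0 r)"
            using E_deriv[of x s0 "ball s0 r"] by (simp add: has_field_derivative_iff)
          then show "(\<lambda>n. (E x (Z n) - E x s0) / (Z n - s0)) \<longlonglongrightarrow> - of_real x * E x s0"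
            unfolding tendsto_at_iff_sequentially using Z by (auto simp: o_def)
        qed
        fix n
        show "AE x in lborel. norm (p x * ((E x (Z n) - E x s0) / (Z n - s0))) \<le>
            B * (indicator {0..} x * ((1 + x) * exp (- r * x)))"
        proof (intro AE_I2)
          fix x
          show "norm (p x * ((E x (Z n) - E x s0) / (Z n - s0))) \<le> B * (indicator {0..} x * ((1 + x) * exp (- r * x)))"
          proof (cases "0 \<le> x")
            case True
            have "norm ((E x (Z n) - E x s0) / (Z n - s0)) \<le> x * exp (- r * x)"
              using E_lip[OF True, of "Z n"] Z(1) by (auto simp: norm_divide divide_le_eq)
            also have "\<dots> \<le> (1 + x) * exp (- r * x)" by (intro mult_right_mono) auto
            finally have "norm (p x) * norm ((E x (Z n) - E x s0) / (Z n - s0)) \<le> B * ((1 + x) * exp (- r * x))"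
              using B B0 by (intro mult_mono) auto
            then show ?thesis using True unfolding norm_mult by simp
          qed (use van in simp)
        qed
      qed (auto simp: E_def)
      moreover have "(lap p (Z n) - lap p s0) / (Z n - s0) = (LINT x|lborel. p x * ((E x (Z n) - E x s0) / (Z n - s0)))" for n
      proof -
        have ZRe: "0 < Re (Z n)" using Re_ball[of "Z n"] Z(1) r by auto
        have "lap p (Z n) - lap p s0 = (LINT x|lborel. p x * E x (Z n) - p x * E x s0)"
          unfolding lap_def E_def
          by (rule Bochner_Integration.integral_diff[symmetric])
             (intro integrable_lap_integrand line ZRe s0)+
        then have "(lap p (Z n) - lap p s0) / (Z n - s0) =
            (LINT x|lborel. (p x * E x (Z n) - p x * E x s0) / (Z n - s0))" by simp
        then show ?thesis by (simp add: right_diff_distrib)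
      qed
      ultimately show "((\<lambda>z. (lap p z - lap p s0) / (z - s0)) \<circ> Z) \<longlonglongrightarrow>
          (LINT x|lborel. p x * (- of_real x * E x s0))"
        by (simp only: o_def)
    qed
    then have "(lap p has_field_derivative (LINT x|lborel. p x * (- of_real x * E x s0))) (at s0 within ball s0 r)"
      by (simp add: has_field_derivative_iff)
    then show ?thesis
      using r by (subst (asm) at_within_open[of s0 "ball s0 r"]) auto
  qed
  then show ?thesis
    by (auto simp: holomorphic_on_def field_differentiable_def intro: has_field_derivative_at_within)
qed

text \<open>The function \<open>h\<close> is the projection of \<open>q\<close> to the frequencies in \<open>[-1, 1]\<close>.\<close>

lemma integrable_low_frequency_part:
  assumes q: "integrable lborel q"
  obtains h B where "h \<in> borel_measurable borel" "\<And>x. norm (h x) \<le> B"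
    "\<And>\<phi>. test_fun {-1<..<1} \<phi> \<Longrightarrow> (LINT x|lborel. q x * fourier \<phi> x) = (LINT x|lborel. h x * fourier \<phi> x)"
proof -
  define b where "b = (\<lambda>t. indicator {-1..1} t *\<^sub>R fourier q t)"
  have b_int: "integrable lborel b"
    using borel_integrable_atLeastAtMost'[OF continuous_on_subset[OF continuous_fourier[OF q]], of "-1" 1]
    by (simp add: b_def set_integrable_def)
  define h where "h = (\<lambda>x. fourier b (- x) / of_real (2 * pi))"
  show ?thesis
  proof (rule that)
    show "h \<in> borel_measurable borel"
      unfolding h_def
      by (intro borel_measurable_continuous_onI continuous_intros continuous_on_compose2[OF continuous_fourier[OF b_int]]) auto
    show "norm (h x) \<le> (LINT t|lborel. norm (b t)) / (2 * pi)" for x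
      using norm_fourier_le[OF b_int, of "- x"] by (simp add: h_def norm_divide divide_right_mono)
    fix \<phi> assume \<phi>: "test_fun {-1<..<1} \<phi>"
    note \<phi>_int = test_fun_integrable[OF \<phi>] and F_int = fourier_test_fun_integrable[OF \<phi>]
    have "(LINT x|lborel. q x * fourier \<phi> x) = (LINT x|lborel. q x * (LINT t|lborel. \<phi> t * exp (- \<i> * of_real (x * t))))"
      unfolding fourier_def by (simp add: mult.commute)
    also have "\<dots> = (LINT t|lborel. \<phi> t * (LINT x|lborel. q x * exp (- \<i> * of_real (x * t))))"
      by (rule fubini_bounded_kernel[OF q \<phi>_int, where B = 1]) auto
    \<comment> \<open>Inversion rewrites \<open>\<phi>\<close>, and the indicator of
      \<open>[-1, 1]\<close> can be inserted because the support lies inside; the cutoff then passes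
      to the transform of \<open>q\<close>.\<close>
    also have "\<dots> = (LINT t|lborel. b t * (LINT x|lborel. fourier \<phi> x * exp (\<i> * of_real (t * x))) / of_real (2 * pi))"
    proof (intro Bochner_Integration.integral_cong refl)
      fix t
      have "\<phi> t = 0" if "t \<notin> {-1..1}"
        using \<phi> that by (intro tsupport_eq_0) (auto simp: test_fun_def)
      moreover have "\<phi> t = (LINT x|lborel. fourier \<phi> x * exp (\<i> * of_real (t * x))) / of_real (2 * pi)"
        using inv_fourier_fourier[OF \<phi>, of t] by (simp add: inv_fourier_def mult.commute)
      ultimately have "\<phi> t = indicator {-1..1} t *\<^sub>R ((LINT x|lborel. fourier \<phi> x * exp (\<i> * of_real (t * x))) / of_real (2 * pi))"
        by (cases "t \<in> {-1..1}") (simp_all del: atLeastAtMost_iff)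
      moreover have "(LINT x|lborel. q x * exp (- \<i> * of_real (x * t))) = fourier q t"
        unfolding fourier_def by (simp add: mult.commute)
      ultimately show "\<phi> t * (LINT x|lborel. q x * exp (- \<i> * of_real (x * t))) =
        b t * (LINT x|lborel. fourier \<phi> x * exp (\<i> * of_real (t * x))) / of_real (2 * pi)"
        by (simp add: b_def scaleR_conv_of_real mult_ac)
    qed
    also have "\<dots> = (LINT t|lborel. b t * (LINT x|lborel. fourier \<phi> x * exp (\<i> * of_real (t * x)))) / of_real (2 * pi)"
      by (rule integral_divide_zero)
    also have "(LINT t|lborel. b t * (LINT x|lborel. fourier \<phi> x * exp (\<i> * of_real (t * x)))) =
        (LINT x|lborel. fourier \<phi> x * (LINT t|lborel. b t * exp (\<i> * of_real (t * x))))"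
      by (rule fubini_bounded_kernel[OF b_int F_int, where B = 1]) auto
    also have "\<dots> / of_real (2 * pi) = (LINT x|lborel. fourier \<phi> x * (LINT t|lborel. b t * exp (\<i> * of_real (t * x))) / of_real (2 * pi))"
      by (rule integral_divide_zero[symmetric])
    also have "\<dots> = (LINT x|lborel. h x * fourier \<phi> x)"
      unfolding h_def fourier_def[of b] by (simp add: mult_ac)
    finally show "(LINT x|lborel. q x * fourier \<phi> x) = (LINT x|lborel. h x * fourier \<phi> x)" .
  qed
qed

section \<open>Local integrability, bounded oscillation and the two implications\<close>

lemma locally_integrable_measurable:
  fixes f :: "real \<Rightarrow> complex"
  assumes "\<And>a b. set_integrable lborel {a..b} f"
  shows "f \<in> borel_measurable borel"
proof (rule borel_measurable_LIMSEQ_metric)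
  show "(\<lambda>x. indicator {- real n..real n} x *\<^sub>R f x) \<in> borel_measurable borel" for n
    using borel_measurable_integrable[OF assms[of "- real n" "real n", unfolded set_integrable_def]] by simp
  fix x
  have "\<forall>\<^sub>F n in sequentially. indicator {- real n..real n} x *\<^sub>R f x = f x"
    using eventually_ge_at_top[of "nat \<lceil>\<bar>x\<bar>\<rceil>"]
    by eventually_elim (auto simp: indicator_def abs_le_iff; linarith)
  then show "(\<lambda>n. indicator {- real n..real n} x *\<^sub>R f x) \<longlonglongrightarrow> f x"
    by (rule tendsto_eventually)
qed

lemma set_integral_split:
  fixes f :: "real \<Rightarrow> complex"
  assumes loc: "\<And>a b. set_integrable lborel {a..b} f" and "a \<le> b" "b \<le> c"
  shows "(LINT x:{a..c}|lborel. f x) = (LINT x:{a..b}|lborel. f x) + (LINT x:{b..c}|lborel. f x)"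
proof -
  have "(LINT x:{a..c}|lborel. f x) = (LINT x:{a..b} \<union> {b<..c}|lborel. f x)"
    using assms by (simp add: ivl_disj_un_two(8))
  also have "\<dots> = (LINT x:{a..b}|lborel. f x) + (LINT x:{b<..c}|lborel. f x)"
    by (rule set_integral_Un) (auto intro: set_integrable_subset[OF loc[of b c]] loc)
  also have "(LINT x:{b<..c}|lborel. f x) = (LINT x:{b..c}|lborel. f x)"
    unfolding set_lebesgue_integral_def using locally_integrable_measurable[OF loc]
    by (intro integral_cong_AE)
       (use AE_lborel_singleton[of b] in \<open>auto simp: indicator_def elim!: eventually_mono\<close>)
  finally show ?thesis .
qed

lemma bdd_oscillatingD:
  assumes "bdd_oscillating f"
  obtains \<delta> X M where "0 < \<delta>" "0 \<le> X" "0 \<le> M"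
    "\<And>x h. X \<le> x \<Longrightarrow> 0 \<le> h \<Longrightarrow> h \<le> \<delta> \<Longrightarrow> norm (f (x + h) - f x) \<le> M"
proof -
  obtain \<delta> where \<delta>: "0 < \<delta>" and
    L: "Limsup at_top (\<lambda>x. SUP h\<in>{0..\<delta>}. ereal (norm (f (x + h) - f x))) < \<infinity>"
    using assms unfolding bdd_oscillating_def by blast
  obtain M where "Limsup at_top (\<lambda>x. SUP h\<in>{0..\<delta>}. ereal (norm (f (x + h) - f x))) < ereal M"
    using ereal_dense2[OF L] by blast
  from Limsup_lessD[OF this] obtain X where
    X: "\<And>x. X \<le> x \<Longrightarrow> (SUP h\<in>{0..\<delta>}. ereal (norm (f (x + h) - f x))) < ereal M"
    unfolding eventually_at_top_linorder by blast
  have "norm (f (x + h) - f x) \<le> M" if "X \<le> x" "0 \<le> h" "h \<le> \<delta>" for x h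
  proof -
    have "ereal (norm (f (x + h) - f x)) \<le> (SUP h\<in>{0..\<delta>}. ereal (norm (f (x + h) - f x)))"
      using that by (intro SUP_upper) auto
    from le_less_trans[OF this X[OF that(1)]] show ?thesis by simp
  qed
  then show ?thesis
    using \<delta> by (intro that[of \<delta> "max 0 X" "max 0 M"]) (auto intro: max.coboundedI2)
qed

lemma bdd_oscillatingI:
  assumes "0 < \<delta>" "\<And>x h. X \<le> x \<Longrightarrow> 0 \<le> h \<Longrightarrow> h \<le> \<delta> \<Longrightarrow> norm (f (x + h) - f x) \<le> M"
  shows "bdd_oscillating f"
proof -
  have "Limsup at_top (\<lambda>x. SUP h\<in>{0..\<delta>}. ereal (norm (f (x + h) - f x))) \<le> ereal M"
    using eventually_ge_at_top[of X]
    by (intro Limsup_bounded, elim eventually_mono) (auto intro!: SUP_least assms(2))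
  also have "\<dots> < \<infinity>" by simp
  finally show ?thesis unfolding bdd_oscillating_def using assms(1) by blast
qed

context
  fixes \<tau> :: "real \<Rightarrow> complex"
  assumes loc: "\<And>a b. set_integrable lborel {a..b} \<tau>"
    and vanish: "\<And>x. x < 0 \<Longrightarrow> \<tau> x = 0"
    and conv: "\<And>s. Re s > 0 \<Longrightarrow> laplace_converges \<tau> s"
    and bd: "bdd_decreasing \<tau>"
begin

lemma measurable_of_locally_integrable [measurable]: "\<tau> \<in> borel_measurable borel"
  by (rule locally_integrable_measurable[OF loc])

text \<open>Convergence is given only for the improper integral; at the real point
  \<open>\<sigma>\<close> it splits into real and imaginary parts, and the one-sided condition
  upgrades each to absolute integrability.\<close>

lemma lap_line_integrable_of_bdd_decreasing:
  assumes \<sigma>: "0 < \<sigma>"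
  shows "integrable lborel (lap_line \<tau> \<sigma>)"
proof -
  obtain L where L: "(laplace_partial \<tau> (of_real \<sigma>) \<longlongrightarrow> L) at_top"
    using conv[of "of_real \<sigma>"] \<sigma> by (auto simp: laplace_converges_def)
  have "integrable lborel (\<lambda>x. indicator {0..T} x *\<^sub>R (\<tau> x * exp (- of_real \<sigma> * of_real x)))" for T
  proof (rule Bochner_Integration.integrable_bound)
    show "integrable lborel (\<lambda>x. indicator {0..T} x *\<^sub>R \<tau> x)" using loc by (simp add: set_integrable_def)
    show "AE x in lborel. norm (indicator {0..T} x *\<^sub>R (\<tau> x * exp (- of_real \<sigma> * of_real x))) \<le> norm (indicator {0..T} x *\<^sub>R \<tau> x)"
      using \<sigma> by (intro AE_I2) (auto simp: indicator_def norm_mult intro!: mult_left_le)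
  qed measurable
  note part_int = this
  have exp_eq: "exp (- of_real \<sigma> * complex_of_real x) = of_real (exp (- \<sigma> * x))" for x
    by (simp add: exp_of_real[symmetric])
  have Re_part: "Re (laplace_partial \<tau> (of_real \<sigma>) T) = (LINT x:{0..T}|lborel. Re (\<tau> x) * exp (- \<sigma> * x))" for T
    unfolding laplace_partial_def set_lebesgue_integral_def
    by (subst integral_Re[OF part_int, symmetric], unfold exp_eq) simp
  have Im_part: "Im (laplace_partial \<tau> (of_real \<sigma>) T) = (LINT x:{0..T}|lborel. Im (\<tau> x) * exp (- \<sigma> * x))" for T
    unfolding laplace_partial_def set_lebesgue_integral_def
    by (subst integral_Im[OF part_int, symmetric], unfold exp_eq) simp
  have loc_Re: "set_integrable lborel {a..b} (\<lambda>x. Re (\<tau> x))" and loc_Im: "set_integrable lborel {a..b} (\<lambda>x. Im (\<tau> x))" for a b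
    using integrable_Re[OF loc[of a b, unfolded set_integrable_def]] integrable_Im[OF loc[of a b, unfolded set_integrable_def]]
    by (simp_all add: set_integrable_def)
  obtain X C where XC: "0 \<le> X" "1 \<le> C" "\<And>x y. X \<le> x \<Longrightarrow> x \<le> y \<Longrightarrow> - C * (y - x + 1) \<le> Re (\<tau> y) - Re (\<tau> x)"
    using bd bdd_decreasing_realD unfolding bdd_decreasing_def by blast
  obtain X' C' where XC': "0 \<le> X'" "1 \<le> C'" "\<And>x y. X' \<le> x \<Longrightarrow> x \<le> y \<Longrightarrow> - C' * (y - x + 1) \<le> Im (\<tau> y) - Im (\<tau> x)"
    using bd bdd_decreasing_realD unfolding bdd_decreasing_def by blast
  have "integrable lborel (\<lambda>x. Re (\<tau> x) * exp (- \<sigma> * x))"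
    using tendsto_Re[OF L] unfolding Re_part
    by (intro integrable_exp_of_slow[OF _ loc_Re _ XC \<sigma>]) (auto simp: vanish)
  moreover have "integrable lborel (\<lambda>x. Im (\<tau> x) * exp (- \<sigma> * x))"
    using tendsto_Im[OF L] unfolding Im_part
    by (intro integrable_exp_of_slow[OF _ loc_Im _ XC' \<sigma>]) (auto simp: vanish)
  ultimately have "integrable lborel (\<lambda>x. of_real (Re (\<tau> x) * exp (- \<sigma> * x)) + \<i> * of_real (Im (\<tau> x) * exp (- \<sigma> * x)))"
    by (intro Bochner_Integration.integrable_add integrable_mult_right)
       (simp_all only: complex_of_real_integrable_eq)
  moreover have "lap_line \<tau> \<sigma> = (\<lambda>x. of_real (Re (\<tau> x) * exp (- \<sigma> * x)) + \<i> * of_real (Im (\<tau> x) * exp (- \<sigma> * x)))"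
    by (simp add: fun_eq_iff lap_line_def complex_eq_iff)
  ultimately show ?thesis by (simp only:)
qed

lemma admissible_imp_primitive_plus_bounded:
  assumes G: "admissible_G \<tau> G"
  shows "\<exists>d>0. \<exists>g. g \<in> borel_measurable borel \<and> (\<exists>B. \<forall>x. norm (g x) \<le> B) \<and>
    (\<forall>\<phi>. test_fun {-d<..<d} \<phi> \<longrightarrow>
      boundary_value G \<phi> (LINT x|lborel. g x * fourier \<phi> x)) \<and>
    (\<exists>C X. \<forall>x\<ge>X. norm (\<tau> x - primitive g x) \<le> C)"
proof -
  from G obtain V where V: "open V" "0 \<in> V" "G holomorphic_on ({s. Re s > 0} \<inter> V)"
    and b1: "pseudomeasure_boundary (\<lambda>s. laplace \<tau> s - G s / s)" and b2: "pseudomeasure_boundary G"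
    unfolding admissible_G_def by blast
  obtain d1 h1 B1 where 1: "0 < d1" "h1 \<in> borel_measurable borel" "\<And>x. norm (h1 x) \<le> B1"
    "\<And>\<phi>. test_fun {-d1<..<d1} \<phi> \<Longrightarrow>
      boundary_value (\<lambda>s. laplace \<tau> s - G s / s) \<phi> (LINT x|lborel. h1 x * fourier \<phi> x)"
    by (rule pseudomeasure_boundaryD[OF b1]) blast
  obtain d2 g B2 where 2: "0 < d2" "g \<in> borel_measurable borel" "\<And>x. norm (g x) \<le> B2"
    "\<And>\<phi>. test_fun {-d2<..<d2} \<phi> \<Longrightarrow>
      boundary_value G \<phi> (LINT x|lborel. g x * fourier \<phi> x)"
    by (rule pseudomeasure_boundaryD[OF b2]) blast
  obtain e where e: "0 < e" "ball 0 e \<subseteq> V" using V(1,2) openE by blast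
  \<comment> \<open>With \<open>\<sigma> < e / 2\<close> and
    \<open>\<bar>t\<bar> < d \<le> e / 2\<close> the point \<sigma> + it stays in the ball inside
    \<open>V\<close>, where \<open>G\<close> is continuous on the right half-plane.\<close>
  define d where "d = Min {d1, d2, e / 2}"
  have d: "0 < d" "d \<le> d1" "d \<le> d2" "d \<le> e / 2" using 1(1) 2(1) e(1) by (auto simp: d_def)
  have sub: "{-d<..<d} \<subseteq> {-d1<..<d1}" "{-d<..<d} \<subseteq> {-d2<..<d2}" using d by auto
  obtain \<phi> K D c r where \<phi>: "test_fun {-d<..<d} \<phi>" "\<And>x. fourier \<phi> x = of_real (K x)"
    and K: "\<And>x. K x \<ge> 0" "continuous_on UNIV K" "\<And>x. K x \<le> D / (1 + x\<^sup>2)\<^sup>2" "D > 0" "c > 0" "r > 0" "r \<le> 1"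
    "\<And>x. \<bar>x\<bar> \<le> r \<Longrightarrow> c \<le> K x"
    using ex_positive_kernel[OF d(1)] by blast
  interpret decaying_kernel K D c r by unfold_locales (use K in auto)
  obtain X C where XC: "0 \<le> X" "1 \<le> C" "\<And>x y. X \<le> x \<Longrightarrow> x \<le> y \<Longrightarrow> - C * (y - x + 1) \<le> Re (\<tau> y) - Re (\<tau> x)"
    using bd bdd_decreasing_realD unfolding bdd_decreasing_def by blast
  obtain X' C' where XC': "0 \<le> X'" "1 \<le> C'" "\<And>x y. X' \<le> x \<Longrightarrow> x \<le> y \<Longrightarrow> - C' * (y - x + 1) \<le> Im (\<tau> y) - Im (\<tau> x)"
    using bd bdd_decreasing_realD unfolding bdd_decreasing_def by blast
  define X0 where "X0 = max X X'"
  define C0 where "C0 = max C C'"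
  have le: "C * (y - x + 1) \<le> C0 * (y - x + 1)" "C' * (y - x + 1) \<le> C0 * (y - x + 1)" if "x \<le> y" for x y
    using that by (auto simp: C0_def intro!: mult_right_mono)
  have "\<exists>B. \<forall>x\<ge>X0. norm (\<tau> x - primitive g x) \<le> B"
  proof (rule norm_remainder_bounded[where G = G and \<rho> = "e / 2" and C = C0, OF _ vanish lap_line_integrable_of_bdd_decreasing _ _ _ _ 2(2,3) 1(2,3) \<phi>])
    show "- C0 * (y - x + 1) \<le> Re (\<tau> y) - Re (\<tau> x)" if "X0 \<le> x" "x \<le> y" for x y
    proof -
      have "- C * (y - x + 1) \<le> Re (\<tau> y) - Re (\<tau> x)" using that by (intro XC(3)) (auto simp: X0_def)
      then show ?thesis using le(1)[OF that(2)] unfolding mult_minus_left by linarith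
    qed
    show "- C0 * (y - x + 1) \<le> Im (\<tau> y) - Im (\<tau> x)" if "X0 \<le> x" "x \<le> y" for x y
    proof -
      have "- C' * (y - x + 1) \<le> Im (\<tau> y) - Im (\<tau> x)" using that by (intro XC'(3)) (auto simp: X0_def)
      then show ?thesis using le(2)[OF that(2)] unfolding mult_minus_left by linarith
    qed
    show "continuous_on {-d<..<d} (\<lambda>t. G (of_real \<sigma> + \<i> * of_real t))" if \<sigma>: "0 < \<sigma>" "\<sigma> < e / 2" for \<sigma>
    proof (rule continuous_on_compose2[OF holomorphic_on_imp_continuous_on[OF V(3)]])
      show "continuous_on {-d<..<d} (\<lambda>t. of_real \<sigma> + \<i> * of_real t)" by (intro continuous_intros)
      show "(\<lambda>t. of_real \<sigma> + \<i> * of_real t) ` {-d<..<d} \<subseteq> {s. Re s > 0} \<inter> V"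
      proof safe
        fix t assume t: "t \<in> {-d<..<d}"
        have "norm (of_real \<sigma> + \<i> * of_real t) \<le> \<bar>\<sigma>\<bar> + \<bar>t\<bar>"
          by (rule order_trans[OF norm_triangle_ineq]) (simp add: norm_mult)
        also have "\<dots> < e" using \<sigma> t d(4) by auto
        finally show "of_real \<sigma> + \<i> * of_real t \<in> V" using e(2) by auto
      qed (use \<sigma> in auto)
    qed
  qed (use XC(1,2) XC'(1,2) e(1) 1(4) 2(4) test_fun_mono[OF _ sub(1)] test_fun_mono[OF _ sub(2)] in
        \<open>auto simp: X0_def C0_def\<close>)
  then have near: "\<exists>C X. \<forall>x\<ge>X. norm (\<tau> x - primitive g x) \<le> C" by blast
  have bounded: "\<exists>B. \<forall>x. norm (g x) \<le> B" using 2(3) by blast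
  have lim: "\<forall>\<phi>. test_fun {-d<..<d} \<phi> \<longrightarrow>
      boundary_value G \<phi> (LINT x|lborel. g x * fourier \<phi> x)"
    using 2(4) test_fun_mono[OF _ sub(2)] by simp
  show ?thesis
    by (rule exI[of _ d], rule conjI[OF d(1)], rule exI[of _ g], intro conjI 2(2) bounded lim near)
qed

text \<open>A primitive of a bounded function is Lipschitz on the half-line, and
  \<open>\<tau>\<close> stays within bounded distance of one.\<close>

lemma admissible_imp_bdd_oscillating:
  assumes "admissible_G \<tau> G"
  shows "bdd_oscillating \<tau>"
proof -
  obtain g B C X where g: "g \<in> borel_measurable borel" "\<And>x. norm (g x) \<le> B"
    and C: "\<And>x. X \<le> x \<Longrightarrow> norm (\<tau> x - primitive g x) \<le> C"
    using admissible_imp_primitive_plus_bounded[OF assms] by blast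
  show ?thesis
  proof (rule bdd_oscillatingI[of 1 "max 0 X"])
    fix x h :: real assume x: "max 0 X \<le> x" and h: "0 \<le> h" "h \<le> 1"
    have B: "0 \<le> B" using order_trans[OF norm_ge_zero g(2)] .
    have "norm (primitive g (x + h) - primitive g x) \<le> B * h"
      using norm_primitive_diff_le[OF g, of x "x + h"] x h by simp
    also have "\<dots> \<le> B" using B h by (simp add: mult_left_le)
    finally have P: "norm (primitive g (x + h) - primitive g x) \<le> B" .
    have "\<tau> (x + h) - \<tau> x = (\<tau> (x + h) - primitive g (x + h)) - (\<tau> x - primitive g x)
        + (primitive g (x + h) - primitive g x)" by simp
    also have "norm \<dots> \<le> C + C + B"
      using x h by (intro norm_triangle_le add_mono P norm_triangle_le_diff C) auto
    finally show "norm (\<tau> (x + h) - \<tau> x) \<le> C + C + B" .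
  qed simp
qed

text \<open>Conversely, \<open>g(x) = (\<tau>(x + \<delta>) - \<tau>(x)) / \<delta>\<close> has a primitive at bounded distance from \<open>\<tau>\<close>,
  and \<open>G = \<L>{g}\<close> is admissible.\<close>

lemma bdd_oscillating_imp_admissible:
  assumes "bdd_oscillating \<tau>"
  shows "\<exists>G. admissible_G \<tau> G"
proof -
  obtain \<delta> X M where \<delta>: "0 < \<delta>" and X: "0 \<le> X" and M: "0 \<le> M"
    "\<And>x h. X \<le> x \<Longrightarrow> 0 \<le> h \<Longrightarrow> h \<le> \<delta> \<Longrightarrow> norm (\<tau> (x + h) - \<tau> x) \<le> M"
    by (rule bdd_oscillatingD[OF assms]) blast
  \<comment> \<open>Set to 0 before \<open>X\<close>, where the oscillation bound says nothing, so
    that \<open>M / \<delta>\<close> bounds \<open>g\<close> everywhere.\<close>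
  define g where "g = (\<lambda>x. if X \<le> x then (\<tau> (x + \<delta>) - \<tau> x) / of_real \<delta> else 0)"
  have g_meas [measurable]: "g \<in> borel_measurable borel" unfolding g_def by measurable
  have g_le: "norm (g x) \<le> M / \<delta>" for x
    using M \<delta> by (auto simp: g_def norm_divide divide_right_mono)
  have g_neg: "g x = 0" if "x < 0" for x using that X by (simp add: g_def)
  have g_ind: "(\<lambda>x. indicator {0..} x * g x) = g"
    using g_neg by (auto simp: indicator_def fun_eq_iff not_le)
  have g_line: "integrable lborel (lap_line g \<sigma>)" if "0 < \<sigma>" for \<sigma>
  proof (rule integrable_lap_line_growth[OF g_meas g_neg _ that])
    show "norm (g x) \<le> M / \<delta> * (1 + x)" if "0 \<le> x" for x
    proof -
      have "M / \<delta> * 1 \<le> M / \<delta> * (1 + x)" using M(1) \<delta> that by (intro mult_left_mono) auto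
      then show ?thesis using order_trans[OF g_le] by simp
    qed
  qed auto
  note prim_meas [measurable] = primitive_measurable[OF g_meas g_le]
  note \<tau>_line = lap_line_integrable_of_bdd_decreasing
  define r where "r = (\<lambda>x. \<tau> x - primitive g x)"
  have [measurable]: "r \<in> borel_measurable borel" unfolding r_def by measurable
  have r_neg: "r x = 0" if "x < 0" for x
    using vanish[OF that] primitive_neg[OF g_meas g_le that] by (simp add: r_def)
  define I where "I = (\<lambda>a b. LINT y:{a..b}|lborel. \<tau> y)"
  \<comment> \<open>\<open>M\<close> bounds the distance of \<open>\<tau> x\<close> from its mean
    over \<open>[x, x + \<delta>]\<close>; the second term is the norm of the mean over the first
    window \<open>[X, X + \<delta>]\<close>.\<close>
  define M' where "M' = M + norm (I X (X + \<delta>)) / \<delta>"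
  have r_le: "norm (r x) \<le> M'" if x: "X \<le> x" for x
  proof -
    have shift_int: "set_integrable lborel {X..x} (\<lambda>y. \<tau> (y + \<delta>))"
      using lborel_integrable_real_affine[OF loc[of "X + \<delta>" "x + \<delta>", unfolded set_integrable_def], of 1 \<delta>]
      unfolding set_integrable_def
      by (rule back_subst[where P = "integrable lborel"])
         (auto simp: indicator_def fun_eq_iff add.commute)
    have shift: "(LINT y:{X..x}|lborel. \<tau> (y + \<delta>)) = I (X + \<delta>) (x + \<delta>)"
      unfolding I_def set_lebesgue_integral_def
      by (subst lborel_integral_real_affine[of 1 _ \<delta>])
         (auto intro!: Bochner_Integration.integral_cong simp: indicator_def add.commute)
    have "primitive g x = (LINT y:{X..x}|lborel. (\<tau> (y + \<delta>) - \<tau> y) / of_real \<delta>)"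
      unfolding primitive_def set_lebesgue_integral_def
      by (intro Bochner_Integration.integral_cong refl) (use X in \<open>auto simp: indicator_def g_def\<close>)
    also have "\<dots> = (LINT y:{X..x}|lborel. \<tau> (y + \<delta>) - \<tau> y) / of_real \<delta>"
      by (rule set_integral_divide_zero)
    also have "(LINT y:{X..x}|lborel. \<tau> (y + \<delta>) - \<tau> y) = I (X + \<delta>) (x + \<delta>) - I X x"
      using set_integral_diff(2)[OF shift_int loc] shift by (simp add: I_def)
    \<comment> \<open>Two splittings of the integral over \<open>[X, x + \<delta>]\<close> are
      compared, which leaves the last window minus the first, whether or not the windows
      overlap.\<close>
    also have "\<dots> = I x (x + \<delta>) - I X (X + \<delta>)"
    proof -
      have "I X (x + \<delta>) = I X x + I x (x + \<delta>)" "I X (x + \<delta>) = I X (X + \<delta>) + I (X + \<delta>) (x + \<delta>)"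
        unfolding I_def by (rule set_integral_split[OF loc]; use x \<delta> in simp)+
      then show ?thesis by (simp add: algebra_simps)
    qed
    finally have prim: "primitive g x = (I x (x + \<delta>) - I X (X + \<delta>)) / of_real \<delta>" .
    have const: "(LINT y:{x..x+\<delta>}|lborel. \<tau> x) = of_real \<delta> * \<tau> x"
      using \<delta> by (simp add: set_lebesgue_integral_def scaleR_conv_of_real)
    have const_int: "set_integrable lborel {x..x+\<delta>} (\<lambda>y. \<tau> x)"
      unfolding set_integrable_def by (rule integrable_indicator) (auto simp: emeasure_lborel_Icc_eq)
    have "of_real \<delta> * \<tau> x - I x (x + \<delta>) = (LINT y:{x..x+\<delta>}|lborel. \<tau> x - \<tau> y)"
      unfolding I_def const[symmetric] by (rule set_integral_diff(2)[OF const_int loc, symmetric])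
    also have "norm \<dots> \<le> (LINT y|lborel. M * indicator {x..x+\<delta>} y)"
      unfolding set_lebesgue_integral_def
    proof (rule order_trans[OF integral_norm_bound integral_mono])
      show "integrable lborel (\<lambda>y. norm (indicator {x..x+\<delta>} y *\<^sub>R (\<tau> x - \<tau> y)))"
        using set_integral_diff(1)[OF const_int loc] unfolding set_integrable_def by (rule integrable_norm)
      show "integrable lborel (\<lambda>y. M * indicator {x..x+\<delta>} y)"
        by (intro integrable_mult_right) (simp add: emeasure_lborel_Icc_eq)
      show "norm (indicator {x..x+\<delta>} y *\<^sub>R (\<tau> x - \<tau> y)) \<le> M * indicator {x..x+\<delta>} y" for y
        using M(2)[OF x, of "y - x"] by (auto simp: indicator_def norm_minus_commute)
    qed
    also have "\<dots> = M * \<delta>" using \<delta> by simp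
    finally have "norm (of_real \<delta> * \<tau> x - I x (x + \<delta>)) / \<delta> \<le> M" using \<delta> by (simp add: pos_divide_le_eq)
    moreover have "r x = (of_real \<delta> * \<tau> x - I x (x + \<delta>)) / of_real \<delta> + I X (X + \<delta>) / of_real \<delta>"
      unfolding r_def prim using \<delta> by (simp add: field_simps)
    ultimately show ?thesis
      unfolding M'_def using \<delta> by (simp add: norm_divide norm_triangle_le)
  qed
  \<comment> \<open>The remainder is bounded from \<open>X\<close> on but only integrable before.
    The integrable part \<open>q\<close> has a continuous Fourier transform, so near frequency 0 a
    bounded function can take its place.\<close>
  define r1 where "r1 = (\<lambda>x. indicator {X..} x *\<^sub>R r x)"
  define q where "q = (\<lambda>x. indicator {0..<X} x *\<^sub>R r x)"
  have r_split: "r x = r1 x + q x" for x using r_neg[of x] X by (auto simp: r1_def q_def indicator_def)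
  have [measurable]: "r1 \<in> borel_measurable borel" unfolding r1_def by measurable
  have M'0: "0 \<le> M'" unfolding M'_def using M \<delta> by simp
  have r1_le: "norm (r1 x) \<le> M'" for x
    using r_le[of x] M'0 by (auto simp: r1_def indicator_def)
  have q_int: "integrable lborel q"
  proof (rule Bochner_Integration.integrable_bound)
    have "set_integrable lborel {0..X} (\<lambda>x. \<tau> x - primitive g x)"
    proof (rule set_integral_diff(1)[OF loc])
      show "set_integrable lborel {0..X} (primitive g)"
        unfolding set_integrable_def
      proof (rule Bochner_Integration.integrable_bound)
        show "integrable lborel (\<lambda>x. (M / \<delta> * X) * indicator {0..X} x)"
          by (intro integrable_mult_right) (simp add: emeasure_lborel_Icc_eq)
        have "norm (primitive g x) \<le> M / \<delta> * X" if "0 \<le> x" "x \<le> X" for x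
        proof -
          have "M / \<delta> * x \<le> M / \<delta> * X" using that M \<delta> by (intro mult_left_mono) auto
          with norm_primitive_le[OF g_meas g_le that(1)] show ?thesis by (rule order_trans)
        qed
        then show "AE x in lborel. norm (indicator {0..X} x *\<^sub>R primitive g x) \<le> norm ((M / \<delta> * X) * indicator {0..X} x)"
          using M X \<delta> by (intro AE_I2) (auto simp: indicator_def)
      qed measurable
    qed
    then show "integrable lborel (\<lambda>x. indicator {0..X} x *\<^sub>R r x)" by (simp add: set_integrable_def r_def)
    show "AE x in lborel. norm (q x) \<le> norm (indicator {0..X} x *\<^sub>R r x)"
      by (intro AE_I2) (auto simp: q_def indicator_def)
    show "q \<in> borel_measurable lborel" unfolding q_def by measurable
  qed
  obtain h Bh where h: "h \<in> borel_measurable borel" "\<And>x. norm (h x) \<le> Bh"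
    "\<And>\<phi>. test_fun {-1<..<1} \<phi> \<Longrightarrow> (LINT x|lborel. q x * fourier \<phi> x) = (LINT x|lborel. h x * fourier \<phi> x)"
    by (rule integrable_low_frequency_part[OF q_int]) blast
  have b1: "pseudomeasure_boundary (\<lambda>s. laplace \<tau> s - lap g s / s)"
  proof (rule pseudomeasure_boundaryI[of "\<lambda>x. r1 x + h x" "M' + Bh" 1])
    show "(\<lambda>x. r1 x + h x) \<in> borel_measurable borel" using h(1) by measurable
    show "norm (r1 x + h x) \<le> M' + Bh" for x by (intro norm_triangle_le add_mono r1_le h(2))
    fix \<phi> assume \<phi>: "test_fun {-1<..<1} \<phi>"
    have q\<phi>: "integrable lborel (\<lambda>x. q x * fourier \<phi> x)"
    proof (rule Bochner_Integration.integrable_bound[OF integrable_mult_left[OF q_int, of "of_real (LINT t|lborel. norm (\<phi> t))"]])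
      show "(\<lambda>x. q x * fourier \<phi> x) \<in> borel_measurable lborel"
        using borel_measurable_integrable[OF q_int] borel_measurable_integrable[OF fourier_test_fun_integrable[OF \<phi>]] by simp
      show "AE x in lborel. norm (q x * fourier \<phi> x) \<le> norm (q x * of_real (LINT t|lborel. norm (\<phi> t)))"
        using order_trans[OF norm_fourier_le[OF test_fun_integrable[OF \<phi>]] abs_ge_self]
        by (intro AE_I2) (simp add: norm_mult mult_left_mono)
    qed
    note r1\<phi> = integrable_bounded_mult_fourier[OF \<phi> \<open>r1 \<in> borel_measurable borel\<close> r1_le]
    have r_line: "integrable lborel (lap_line r \<sigma>)" if "0 < \<sigma>" for \<sigma>
    proof -
      have "lap_line r \<sigma> = (\<lambda>x. lap_line \<tau> \<sigma> x - lap_line (primitive g) \<sigma> x)"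
        by (auto simp: lap_line_def r_def left_diff_distrib)
      then show ?thesis
        using Bochner_Integration.integrable_diff[OF \<tau>_line[OF that] integrable_lap_line_primitive[OF g_meas g_le that]]
        by simp
    qed
    have lim_r: "boundary_value (lap r) \<phi> (LINT x|lborel. r x * fourier \<phi> x)"
      using Bochner_Integration.integrable_add[OF r1\<phi> q\<phi>]
      by (intro lap_boundary r_line r_neg test_fun_integrable[OF \<phi>]) (auto simp: r_split distrib_right)
    have limit_eq: "(LINT x|lborel. r x * fourier \<phi> x) = (LINT x|lborel. (r1 x + h x) * fourier \<phi> x)"
      unfolding r_split distrib_right
      using r1\<phi> q\<phi> integrable_bounded_mult_fourier[OF \<phi> h(1,2)] h(3)[OF \<phi>] by (simp add: Bochner_Integration.integral_add)
    have ev: "\<forall>\<^sub>F \<sigma> in at_right 0. (LINT t|lborel. lap r (of_real \<sigma> + \<i> * of_real t) * \<phi> t) =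
      (LINT t|lborel. (laplace \<tau> (of_real \<sigma> + \<i> * of_real t) - lap g (of_real \<sigma> + \<i> * of_real t) / (of_real \<sigma> + \<i> * of_real t)) * \<phi> t)"
      using eventually_at_right_less[of "0::real"]
    proof eventually_elim
      case (elim \<sigma>)
      have "lap r s = laplace \<tau> s - lap g s / s" if "Re s = \<sigma>" for s
      proof -
        have "lap r s = lap \<tau> s - lap (primitive g) s"
          unfolding lap_def r_def left_diff_distrib
          by (rule Bochner_Integration.integral_diff; rule integrable_lap_integrand)
             (use elim that \<tau>_line integrable_lap_line_primitive[OF g_meas g_le] in auto)
        also have "lap (primitive g) s = lap g s / s"
          using lap_primitive[OF g_meas g_le, of s] elim that by (simp add: g_ind)
        also have "lap \<tau> s = laplace \<tau> s"
          using elim that by (intro laplace_eq_lap[symmetric] vanish \<tau>_line) auto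
        finally show ?thesis .
      qed
      then show ?case by simp
    qed
    show "boundary_value (\<lambda>s. laplace \<tau> s - lap g s / s) \<phi> (LINT x|lborel. (r1 x + h x) * fourier \<phi> x)"
      by (rule Lim_transform_eventually[OF lim_r[unfolded limit_eq] ev])
  qed simp
  have b2: "pseudomeasure_boundary (lap g)"
    by (rule pseudomeasure_boundaryI[OF g_meas g_le zero_less_one])
       (intro lap_boundary g_meas g_neg g_line test_fun_integrable integrable_bounded_mult_fourier[OF _ g_meas g_le]; assumption)
  have "admissible_G \<tau> (lap g)"
    unfolding admissible_G_def using b1 b2 lap_holomorphic[OF g_meas g_neg g_le]
    by (intro conjI exI[of _ UNIV]) auto
  then show ?thesis by blast
qed

end

theorem theorem3p6:
  fixes \<tau> :: "real \<Rightarrow> complex"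
  assumes loc: "\<And>a b. set_integrable lborel {a..b} \<tau>"
    and vanish: "\<And>x. x < 0 \<Longrightarrow> \<tau> x = 0"
    and conv: "\<And>s. Re s > 0 \<Longrightarrow> laplace_converges \<tau> s"
    and bd: "bdd_decreasing \<tau>"
  shows "(bdd_oscillating \<tau> \<longleftrightarrow> (\<exists>G. admissible_G \<tau> G))
    \<and> (\<forall>G. admissible_G \<tau> G \<longrightarrow>
         (\<exists>l0>0. \<forall>l. 0 < l \<and> l < l0 \<longrightarrow>
            (\<exists>g. Linf g
               \<and> (\<forall>\<phi>. test_fun {-l<..<l} \<phi> \<longrightarrow>
                    ((\<lambda>\<sigma>. LINT t|lborel. G (of_real \<sigma> + \<i> * of_real t) * \<phi> t)
                       \<longlongrightarrow> (LINT x|lborel. g x * fourier \<phi> x)) (at_right 0))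
               \<and> (\<exists>C. eventually (\<lambda>x. norm (\<tau> x - (LINT y:{0..x}|lborel. g y)) \<le> C) at_top))))"
proof (intro conjI iffI allI impI)
  show "\<exists>G. admissible_G \<tau> G" if "bdd_oscillating \<tau>"
    by (rule bdd_oscillating_imp_admissible[OF assms that])
  show "bdd_oscillating \<tau>" if "\<exists>G. admissible_G \<tau> G"
    using that admissible_imp_bdd_oscillating[OF assms] by blast
  fix G assume G: "admissible_G \<tau> G"
  obtain d g B C X where d: "0 < d" and g: "g \<in> borel_measurable borel" "\<And>x. norm (g x) \<le> B"
    and lim: "\<And>\<phi>. test_fun {-d<..<d} \<phi> \<Longrightarrow>
      boundary_value G \<phi> (LINT x|lborel. g x * fourier \<phi> x)"
    and C: "\<And>x. X \<le> x \<Longrightarrow> norm (\<tau> x - primitive g x) \<le> C"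
    using admissible_imp_primitive_plus_bounded[OF assms G] by blast
  have Linf: "Linf g" unfolding Linf_def using g by (auto intro!: exI[of _ B])
  have ev: "eventually (\<lambda>x. norm (\<tau> x - (LINT y:{0..x}|lborel. g y)) \<le> C) at_top"
    using eventually_ge_at_top[of X] by eventually_elim (use C in \<open>simp add: primitive_def\<close>)
  \<comment> \<open>One \<open>g\<close> serves every \<open>l < d\<close>, because a test function
    on the smaller interval is also one on the larger.\<close>
  have small: "test_fun {-d<..<d} \<phi>" if "l < d" "test_fun {-l<..<l} \<phi>" for l \<phi>
    using that by (auto elim!: test_fun_mono)
  show "\<exists>l0>0. \<forall>l. 0 < l \<and> l < l0 \<longrightarrow>
            (\<exists>g. Linf g
               \<and> (\<forall>\<phi>. test_fun {-l<..<l} \<phi> \<longrightarrow>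
                    ((\<lambda>\<sigma>. LINT t|lborel. G (of_real \<sigma> + \<i> * of_real t) * \<phi> t)
                       \<longlongrightarrow> (LINT x|lborel. g x * fourier \<phi> x)) (at_right 0))
               \<and> (\<exists>C. eventually (\<lambda>x. norm (\<tau> x - (LINT y:{0..x}|lborel. g y)) \<le> C) at_top))"
    by (intro exI[of _ d] exI[of _ g] exI[of _ C] conjI allI impI d Linf ev lim)
       (blast intro: small)
qed

end
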